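(* Let $p$ be an odd prime, $n\ge1$, and $L/K$ a cyclic Galois extension of degree $p^n$ with group $G=\langle\sigma\rangle$. For $0\le r,s<p^{n-1}$, $H_r\cong H_s$ as $K$-Hopf algebras if and only if $r=s$.
   Context: Let $N=\langle\eta\rangle$ be cyclic of order $p^n$ and $\delta\in\mathrm{Aut}(N)$ the $(p-1)$-th power of a generator of the cyclic group $\mathrm{Aut}(N)$. Let $\rho(\eta)\in\mathrm{Perm}(N)$ be $x\mapsto x\eta^{-1}$ and $\lambda_N(\nu)(x)=\nu x$. For $0\le s<p^{n-1}$ let $\beta_s:G\to\mathrm{Perm}(N)$ be the homomorphism with $\beta_s(\sigma)=\rho(\eta)\circ\delta^{s}$ (an element of $\mathrm{Hol}(N)$ with translation part $\rho(\eta)$ and automorphism part $\delta^s$). Let $b_s:G\to N$, $b_s(g)=\beta_s(g)(1_N)$ (a bijection), and $\alpha_s:N\to\mathrm{Perm}(G)$, $\alpha_s(\nu)=b_s^{-1}\circ\lambda_N(\nu)\circ b_s$. Then $\alpha_s(N)$ is a regular subgroup of $\mathrm{Perm}(G)$ normalized by the left regular representation $\lambda(G)$, and $H_s=L[\alpha_s(N)]^G$, where $G$ acts on $L$ as Galois automorphisms and on $\alpha_s(N)$ by $g\ast\nu=\lambda(g)\nu\lambda(g)^{-1}$. *)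

theory Defs
  imports "HOL-Algebra.Algebra" "HOL-Computational_Algebra.Primes"
begin

section \<open>Free modules and tensor products\<close>

text \<open>
  Formal \<open>R\<close>-linear combinations of elements of \<open>B\<close> are functions of finite support that vanish
  outside \<open>B\<close>. The ring part of the record (\<open>mult\<close>, \<open>one\<close>) plays no role for a module and is
  left unspecified.
\<close>

definition free_module :: "('a, 'r) ring_scheme \<Rightarrow> 'x set \<Rightarrow> ('a, 'x \<Rightarrow> 'a) module" where
  "free_module R B =
    \<lparr>carrier = {u. (\<forall>x\<in>B. u x \<in> carrier R) \<and> (\<forall>x. x \<notin> B \<longrightarrow> u x = \<zero>\<^bsub>R\<^esub>)
                   \<and> finite {x. u x \<noteq> \<zero>\<^bsub>R\<^esub>}},
     monoid.mult = undefined,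
     monoid.one = undefined,
     ring.zero = (\<lambda>_. \<zero>\<^bsub>R\<^esub>),
     ring.add = (\<lambda>u v x. u x \<oplus>\<^bsub>R\<^esub> v x),
     module.smult = (\<lambda>c u x. c \<otimes>\<^bsub>R\<^esub> u x)\<rparr>"

definition single :: "('a, 'r) ring_scheme \<Rightarrow> 'x \<Rightarrow> ('x \<Rightarrow> 'a)" where
  "single R x = (\<lambda>y. if y = x then \<one>\<^bsub>R\<^esub> else \<zero>\<^bsub>R\<^esub>)"

text \<open>The map \<open>\<Sum> u\<^sub>x x \<mapsto> \<Sum> u\<^sub>x \<phi>(x)\<close> of formal linear combinations.\<close>

definition free_map :: "('a, 'r) ring_scheme \<Rightarrow> ('x \<Rightarrow> 'y) \<Rightarrow> ('x \<Rightarrow> 'a) \<Rightarrow> ('y \<Rightarrow> 'a)" where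
  "free_map R \<phi> u = (\<lambda>y. finsum R u {x. u x \<noteq> \<zero>\<^bsub>R\<^esub> \<and> \<phi> x = y})"

text \<open>
  \<open>V \<otimes>\<^sub>R W\<close> is the free module on \<open>V \<times> W\<close> modulo the submodule generated by the bilinearity
  relations; its elements are cosets of that submodule.
\<close>

definition bilinear_relations ::
  "('a, 'r) ring_scheme \<Rightarrow> ('a, 'v, 'e) module_scheme \<Rightarrow> ('a, 'w, 'f) module_scheme
    \<Rightarrow> ('v \<times> 'w \<Rightarrow> 'a) set" where
  "bilinear_relations R V W = (let F = free_module R (carrier V \<times> carrier W) in
      {single R (v \<oplus>\<^bsub>V\<^esub> v', w) \<ominus>\<^bsub>F\<^esub> (single R (v, w) \<oplus>\<^bsub>F\<^esub> single R (v', w)) | v v' w.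
         v \<in> carrier V \<and> v' \<in> carrier V \<and> w \<in> carrier W}
    \<union> {single R (v, w \<oplus>\<^bsub>W\<^esub> w') \<ominus>\<^bsub>F\<^esub> (single R (v, w) \<oplus>\<^bsub>F\<^esub> single R (v, w')) | v w w'.
         v \<in> carrier V \<and> w \<in> carrier W \<and> w' \<in> carrier W}
    \<union> {single R (c \<odot>\<^bsub>V\<^esub> v, w) \<ominus>\<^bsub>F\<^esub> (c \<odot>\<^bsub>F\<^esub> single R (v, w)) | c v w.
         c \<in> carrier R \<and> v \<in> carrier V \<and> w \<in> carrier W}
    \<union> {single R (v, c \<odot>\<^bsub>W\<^esub> w) \<ominus>\<^bsub>F\<^esub> (c \<odot>\<^bsub>F\<^esub> single R (v, w)) | c v w.
         c \<in> carrier R \<and> v \<in> carrier V \<and> w \<in> carrier W})"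

definition tensor_kernel ::
  "('a, 'r) ring_scheme \<Rightarrow> ('a, 'v, 'e) module_scheme \<Rightarrow> ('a, 'w, 'f) module_scheme
    \<Rightarrow> ('v \<times> 'w \<Rightarrow> 'a) set" where
  "tensor_kernel R V W =
    \<Inter> {S. submodule S R (free_module R (carrier V \<times> carrier W)) \<and> bilinear_relations R V W \<subseteq> S}"

definition tensor_class ::
  "('a, 'r) ring_scheme \<Rightarrow> ('a, 'v, 'e) module_scheme \<Rightarrow> ('a, 'w, 'f) module_scheme
    \<Rightarrow> ('v \<times> 'w \<Rightarrow> 'a) \<Rightarrow> ('v \<times> 'w \<Rightarrow> 'a) set" where
  "tensor_class R V W u = tensor_kernel R V W +>\<^bsub>free_module R (carrier V \<times> carrier W)\<^esub> u"

definition tensor_carrier ::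
  "('a, 'r) ring_scheme \<Rightarrow> ('a, 'v, 'e) module_scheme \<Rightarrow> ('a, 'w, 'f) module_scheme
    \<Rightarrow> ('v \<times> 'w \<Rightarrow> 'a) set set" where
  "tensor_carrier R V W = tensor_class R V W ` carrier (free_module R (carrier V \<times> carrier W))"

text \<open>
  The map \<open>\<Sum> c (v \<otimes> w) \<mapsto> \<Sum> c (f v \<otimes> g w)\<close> into \<open>V' \<otimes>\<^sub>R W'\<close>. The source may be a tensor product
  over \<open>R\<close> or over a subring of \<open>R\<close>. For \<open>f\<close>, \<open>g\<close> linear over the ring of the source, all
  representatives \<open>u\<close> of \<open>t\<close> give the same class, so that the union is that class.
\<close>

definition tensor_map ::
  "('a, 'r) ring_scheme \<Rightarrow> ('a, 'v2, 'e) module_scheme \<Rightarrow> ('a, 'w2, 'f) module_scheme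
    \<Rightarrow> ('v \<Rightarrow> 'v2) \<Rightarrow> ('w \<Rightarrow> 'w2) \<Rightarrow> ('v \<times> 'w \<Rightarrow> 'a) set \<Rightarrow> ('v2 \<times> 'w2 \<Rightarrow> 'a) set" where
  "tensor_map R V' W' f g t = (\<Union>u\<in>t. tensor_class R V' W' (free_map R (map_prod f g) u))"


section \<open>Hopf algebras\<close>

text \<open>
  The data of a Hopf algebra \<open>H\<close>. The ground ring \<open>R\<close> is passed separately, as for modules;
  \<open>comult\<close> takes values in \<open>tensor_carrier R H H\<close>.
\<close>

record ('a, 'b) hopf = "('a, 'b) module" +
  comult :: "'b \<Rightarrow> ('b \<times> 'b \<Rightarrow> 'a) set"
  counit :: "'b \<Rightarrow> 'a"
  antipode :: "'b \<Rightarrow> 'b"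

definition hopf_iso ::
  "('a, 'r) ring_scheme \<Rightarrow> ('a, 'b, 'e) hopf_scheme \<Rightarrow> ('a, 'c, 'f) hopf_scheme
    \<Rightarrow> ('b \<Rightarrow> 'c) set" where
  "hopf_iso R H H' = {f \<in> ring_iso H H'.
      (\<forall>c\<in>carrier R. \<forall>h\<in>carrier H. f (c \<odot>\<^bsub>H\<^esub> h) = c \<odot>\<^bsub>H'\<^esub> f h) \<and>
      (\<forall>h\<in>carrier H. comult H' (f h) = tensor_map R H' H' f f (comult H h)) \<and>
      (\<forall>h\<in>carrier H. counit H' (f h) = counit H h) \<and>
      (\<forall>h\<in>carrier H. antipode H' (f h) = f (antipode H h))}"

definition hopf_isomorphic ::
  "('a, 'r) ring_scheme \<Rightarrow> ('a, 'b, 'e) hopf_scheme \<Rightarrow> ('a, 'c, 'f) hopf_scheme \<Rightarrow> bool" where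
  "hopf_isomorphic R H H' \<longleftrightarrow> hopf_iso R H H' \<noteq> {}"


section \<open>Group algebras\<close>

text \<open>The group algebra \<open>R[M]\<close> with \<open>\<Delta>(m) = m \<otimes> m\<close>, \<open>\<epsilon>(m) = 1\<close>, \<open>S(m) = m\<^sup>-\<^sup>1\<close> for \<open>m \<in> M\<close>.\<close>

definition group_algebra ::
  "('a, 'r) ring_scheme \<Rightarrow> ('m, 's) monoid_scheme \<Rightarrow> ('a, 'm \<Rightarrow> 'a) module" where
  "group_algebra R M = (free_module R (carrier M))
    \<lparr>monoid.mult := (\<lambda>a b. free_map R (\<lambda>(x, y). x \<otimes>\<^bsub>M\<^esub> y) (\<lambda>(x, y). a x \<otimes>\<^bsub>R\<^esub> b y)),
     monoid.one := single R \<one>\<^bsub>M\<^esub>\<rparr>"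

definition group_hopf ::
  "('a, 'r) ring_scheme \<Rightarrow> ('m, 's) monoid_scheme \<Rightarrow> ('a, 'm \<Rightarrow> 'a) hopf" where
  "group_hopf R M = module.extend (group_algebra R M)
    \<lparr>comult = (\<lambda>a. tensor_class R (group_algebra R M) (group_algebra R M)
                     (free_map R (\<lambda>m. (single R m, single R m)) a)),
     counit = (\<lambda>a. finsum R a {m. a m \<noteq> \<zero>\<^bsub>R\<^esub>}),
     antipode = free_map R (\<lambda>m. inv\<^bsub>M\<^esub> m)\<rparr>"


section \<open>Galois extensions and descent\<close>

definition galois_group :: "('a, 'r) ring_scheme \<Rightarrow> 'a set \<Rightarrow> ('a \<Rightarrow> 'a) monoid" where
  "galois_group L K = (BijGroup (carrier L))
    \<lparr>carrier := {g \<in> ring_hom L L \<inter> Bij (carrier L). \<forall>k\<in>K. g k = k}\<rparr>"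

definition galois_extension :: "('a, 'r) ring_scheme \<Rightarrow> 'a set \<Rightarrow> bool" where
  "galois_extension L K \<longleftrightarrow> field L \<and> subfield K L \<and> ring.finite_dimension L K (carrier L) \<and>
     {x \<in> carrier L. \<forall>g\<in>carrier (galois_group L K). g x = x} = K"

definition left_regular :: "('g, 's) monoid_scheme \<Rightarrow> 'g \<Rightarrow> ('g \<Rightarrow> 'g)" where
  "left_regular G g = (\<lambda>x\<in>carrier G. g \<otimes>\<^bsub>G\<^esub> x)"

definition conj_left_regular ::
  "('g, 's) monoid_scheme \<Rightarrow> 'g \<Rightarrow> ('g \<Rightarrow> 'g) \<Rightarrow> ('g \<Rightarrow> 'g)" where
  "conj_left_regular G g m =
     left_regular G g \<otimes>\<^bsub>BijGroup (carrier G)\<^esub> m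
       \<otimes>\<^bsub>BijGroup (carrier G)\<^esub> inv\<^bsub>BijGroup (carrier G)\<^esub> (left_regular G g)"

text \<open>\<open>g \<cdot> \<Sum> a\<^sub>m m = \<Sum> g(a\<^sub>m) (\<lambda>(g) m \<lambda>(g)\<^sup>-\<^sup>1)\<close>, for \<open>g\<close> in a group \<open>G\<close> of automorphisms of \<open>L\<close>.\<close>

definition descent_action ::
  "('a, 'r) ring_scheme \<Rightarrow> ('a \<Rightarrow> 'a, 's) monoid_scheme \<Rightarrow> ('a \<Rightarrow> 'a)
    \<Rightarrow> ((('a \<Rightarrow> 'a) \<Rightarrow> ('a \<Rightarrow> 'a)) \<Rightarrow> 'a) \<Rightarrow> ((('a \<Rightarrow> 'a) \<Rightarrow> ('a \<Rightarrow> 'a)) \<Rightarrow> 'a)" where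
  "descent_action L G g a = free_map L (conj_left_regular G g) (\<lambda>m. g (a m))"

text \<open>
  The \<open>K\<close>-Hopf algebra \<open>H = L[M]\<^sup>G\<close>, for \<open>G\<close> the Galois group of \<open>L/K\<close> and \<open>M\<close> a regular subgroup of
  \<open>Perm(G)\<close> normalized by \<open>\<lambda>(G)\<close>. All operations are those of \<open>L[M]\<close>. For the comultiplication this
  means that \<open>\<Delta>(h)\<close> is the element of \<open>H \<otimes>\<^sub>K H\<close> whose image under the (injective) canonical map
  \<open>H \<otimes>\<^sub>K H \<rightarrow> L[M] \<otimes>\<^sub>L L[M]\<close> is the comultiplication of \<open>h\<close> in \<open>L[M]\<close>.
\<close>

definition descent_hopf ::
  "('a, 'r) ring_scheme \<Rightarrow> 'a set \<Rightarrow> (('a \<Rightarrow> 'a) \<Rightarrow> ('a \<Rightarrow> 'a), 's) monoid_scheme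
    \<Rightarrow> ('a, (('a \<Rightarrow> 'a) \<Rightarrow> ('a \<Rightarrow> 'a)) \<Rightarrow> 'a) hopf" where
  "descent_hopf L K M =
    (let G = galois_group L K;
         A = group_hopf L M;
         H = A\<lparr>carrier := {a \<in> carrier A. \<forall>g\<in>carrier G. descent_action L G g a = a}\<rparr>
     in H\<lparr>comult := (\<lambda>h. THE t. t \<in> tensor_carrier (L\<lparr>carrier := K\<rparr>) H H \<and>
                              tensor_map L A A (\<lambda>a. a) (\<lambda>a. a) t = comult A h)\<rparr>)"


section \<open>The regular subgroups attached to a cyclic group\<close>

definition right_regular :: "('n, 's) monoid_scheme \<Rightarrow> 'n \<Rightarrow> ('n \<Rightarrow> 'n)" where
  "right_regular N \<nu> = (\<lambda>x\<in>carrier N. x \<otimes>\<^bsub>N\<^esub> inv\<^bsub>N\<^esub> \<nu>)"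

text \<open>
  \<open>beta G \<sigma> N \<eta> \<delta> s\<close> is the homomorphism \<open>\<beta>\<^sub>s : G \<rightarrow> Perm(N)\<close> with \<open>\<beta>\<^sub>s(\<sigma>) = \<rho>(\<eta>) \<circ> \<delta>\<^sup>s\<close>; extensionality
  makes it unique as a function on the whole type.
\<close>

definition beta ::
  "('g, 's) monoid_scheme \<Rightarrow> 'g \<Rightarrow> ('n, 't) monoid_scheme \<Rightarrow> 'n \<Rightarrow> ('n \<Rightarrow> 'n) \<Rightarrow> nat
    \<Rightarrow> 'g \<Rightarrow> ('n \<Rightarrow> 'n)" where
  "beta G \<sigma> N \<eta> \<delta> s =
    (THE f. f \<in> hom G (BijGroup (carrier N)) \<and> f \<in> extensional (carrier G) \<and>
       f \<sigma> = right_regular N \<eta> \<otimes>\<^bsub>BijGroup (carrier N)\<^esub> (\<delta> [^]\<^bsub>AutoGroup N\<^esub> s))"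

definition b_map ::
  "('g, 's) monoid_scheme \<Rightarrow> 'g \<Rightarrow> ('n, 't) monoid_scheme \<Rightarrow> 'n \<Rightarrow> ('n \<Rightarrow> 'n) \<Rightarrow> nat
    \<Rightarrow> 'g \<Rightarrow> 'n" where
  "b_map G \<sigma> N \<eta> \<delta> s g = beta G \<sigma> N \<eta> \<delta> s g \<one>\<^bsub>N\<^esub>"

definition alpha ::
  "('g, 's) monoid_scheme \<Rightarrow> 'g \<Rightarrow> ('n, 't) monoid_scheme \<Rightarrow> 'n \<Rightarrow> ('n \<Rightarrow> 'n) \<Rightarrow> nat
    \<Rightarrow> 'n \<Rightarrow> ('g \<Rightarrow> 'g)" where
  "alpha G \<sigma> N \<eta> \<delta> s \<nu> =
    (\<lambda>x\<in>carrier G. inv_into (carrier G) (b_map G \<sigma> N \<eta> \<delta> s)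
                      (left_regular N \<nu> (b_map G \<sigma> N \<eta> \<delta> s x)))"

definition alpha_group ::
  "('g, 's) monoid_scheme \<Rightarrow> 'g \<Rightarrow> ('n, 't) monoid_scheme \<Rightarrow> 'n \<Rightarrow> ('n \<Rightarrow> 'n) \<Rightarrow> nat
    \<Rightarrow> ('g \<Rightarrow> 'g) monoid" where
  "alpha_group G \<sigma> N \<eta> \<delta> s =
    (BijGroup (carrier G))\<lparr>carrier := alpha G \<sigma> N \<eta> \<delta> s ` carrier N\<rparr>"

definition hopf_galois_structure ::
  "('a, 'r) ring_scheme \<Rightarrow> 'a set \<Rightarrow> ('a \<Rightarrow> 'a) \<Rightarrow> ('n, 't) monoid_scheme \<Rightarrow> 'n
    \<Rightarrow> ('n \<Rightarrow> 'n) \<Rightarrow> nat \<Rightarrow> ('a, (('a \<Rightarrow> 'a) \<Rightarrow> ('a \<Rightarrow> 'a)) \<Rightarrow> 'a) hopf" where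
  "hopf_galois_structure L K \<sigma> N \<eta> \<delta> s =
     descent_hopf L K (alpha_group (galois_group L K) \<sigma> N \<eta> \<delta> s)"

end

theory Submission
  imports Defs "HOL-Number_Theory.Residues"
begin

text \<open>
  Write \<open>M\<^sub>s = \<alpha>\<^sub>s(N)\<close>. Conjugation by \<open>\<lambda>(\<sigma>)\<close> acts on \<open>M\<^sub>s \<cong> N\<close> as \<open>\<delta>\<^sup>s\<close>, because \<open>b\<^sub>s\<close> intertwines \<open>\<lambda>(\<sigma>)\<close>
  with \<open>\<rho>(\<eta>) \<delta>\<^sup>s\<close>; here \<open>b\<^sub>s(\<sigma>\<^sup>k) = \<eta>\<close> to the power \<open>-(1 + D + \<dots> + D\<^sup>k\<^sup>-\<^sup>1)\<close> with \<open>D \<equiv> 1\<close> modulo the odd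
  prime \<open>p\<close>, so that \<open>b\<^sub>s\<close> is bijective.

  A Hopf isomorphism \<open>f : H\<^sub>r \<rightarrow> H\<^sub>s\<close> extends \<open>L\<close>-linearly to \<open>L[M\<^sub>r] \<rightarrow> L[M\<^sub>s]\<close> and is thus given by a
  matrix \<open>\<Phi>(m, x)\<close>. Compatibility with comultiplication makes the entries of each row orthogonal
  idempotents of the field \<open>L\<close>, and compatibility with the counit makes the row sums 1, so \<open>\<Phi>\<close> is the
  matrix of a map \<open>\<phi> : M\<^sub>r \<rightarrow> M\<^sub>s\<close>. This map is a \<open>G\<close>-equivariant surjective homomorphism. Automorphisms
  of a cyclic group are power maps, so \<open>\<delta>\<^sup>r = \<delta>\<^sup>s\<close>, and \<open>r = s\<close> since \<open>\<delta>\<close> has order \<open>p\<^sup>n\<^sup>-\<^sup>1\<close>.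

  The base change is made explicit by elements \<open>l\<^sub>i, l'\<^sub>i\<close> of \<open>L\<close> with \<open>\<Sum> l'\<^sub>i g(l\<^sub>i) = 1\<close> for \<open>g = 1\<close> and \<open>0\<close>
  for the other \<open>g\<close> in \<open>G\<close>: the orbit sums of \<open>l\<^sub>i m\<close>, together with those of \<open>l'\<^sub>i t m\<close> where \<open>t\<close> has
  trace 1, form dual frames of \<open>L[M]\<^sup>G\<close>. They show that \<open>L[M]\<^sup>G \<otimes>\<^sub>K L[M]\<^sup>G\<close> embeds into \<open>L[M] \<otimes>\<^sub>L L[M]\<close> with
  the comultiplication in its image.
\<close>

section \<open>Geometric sums modulo prime powers\<close>

text \<open>A Hopf isomorphism is known only on invariants and only over K, whereas the argument
  needs identities between single entries of a matrix over L. \<open>invariants_separate\<close>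
  bridges this: the invariants span the functions on M over L, so such an identity holds once its
  sums against all invariants agree. Idempotence, row sums, surjectivity, multiplicativity and
  equivariance are all obtained in this way. The order of G is not given. It is derived from the
  degree: independence of automorphisms bounds it from above, nondegeneracy of the trace form from
  below. The exponent p - 1 in the definition of \<delta> is that of Fermat's theorem. It makes the
  exponent of \<delta> congruent to 1 modulo p, without which the geometric sums would miss a
  residue class modulo p. At the end some \<nu> lies over a generator by surjectivity, and
  conjugating by \<sigma> compares the two exponents at that generator.\<close>

abbreviation geo_sum :: "nat \<Rightarrow> nat \<Rightarrow> nat" where
  "geo_sum D k \<equiv> (\<Sum>i<k. D ^ i)"

lemma geo_sum_add: "geo_sum D (j + k) = geo_sum D j + D ^ j * geo_sum D k"
  by (induction k) (simp_all add: power_add algebra_simps)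

text \<open>Each index below \<open>p * m\<close> is i + p j with i < p and j < m, which splits the
  sum into a product. The passage from D to \<open>D ^ p\<close> in the second factor drives the
  valuation argument below.\<close>

lemma geo_sum_mult: "geo_sum D (p * m) = geo_sum D p * geo_sum (D ^ p) m"
proof (induction m)
  case (Suc m)
  then show ?case
    using geo_sum_add[of D "p * m" p] 
    by (simp add: distrib_left power_mult[symmetric] add.commute mult.commute)
qed simp

lemma cong_geo_sum_mod_p:
  assumes "[D = 1] (mod p)" shows "[geo_sum D k = k] (mod p)"
proof (induction k)
  case (Suc k)
  have "[D ^ k = 1] (mod p)"
    using cong_pow[OF assms, of k] by simp
  from cong_add[OF Suc this] show ?case by (simp add: add.commute)
qed simp

text \<open>Modulo p^2 the power D^i is 1 + i p t, so the sum is p plus t p times the sum of the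
  indices below p. For odd p that index sum is divisible by p, and exactly one factor p
  remains.\<close>

lemma geo_sum_prime:
  fixes p :: nat
  assumes p: "Factorial_Ring.prime p" "odd p" and D: "[D = 1] (mod p)"
  obtains c where "geo_sum D p = p * c" "[c = 1] (mod p)"
proof -
  \<comment> \<open>On the naturals 0 is congruent to 1 only for modulus 1; primality removes this
    alternative.\<close>
  obtain t where t: "D = 1 + p * t \<or> D = 0 \<and> p = 1" 
    using D by (metis add.commute cong_to_1'_nat mult.commute)
  then have t: "D = 1 + p * t" using p(1) by auto
  have pw: "\<exists>c. D ^ i = 1 + i * (p * t) + p * p * c" for i
  proof (induction i)
    case (Suc i)
    then obtain c where c: "D ^ i = 1 + i * (p * t) + p * p * c" by blast
    show ?case
      \<comment> \<open>The coefficient of \<open>p * p\<close> after multiplying out with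
        \<open>1 + p * t\<close>.\<close>
      by (rule exI[of _ "i * t * t + c * (1 + p * t)"])
        (simp add: c, simp add: t algebra_simps)
  qed simp
  then obtain c where c: "\<And>i. D ^ i = 1 + i * (p * t) + p * p * c i" by metis
  \<comment> \<open>Oddness enters here: the sum of the indices below p is p q with the integer q =
    (p - 1) / 2.\<close>
  obtain q where q: "p = 2 * q + 1" using p(2) by (elim oddE)
  have "\<Sum>{..<2 * q + 1} = (2 * q + 1) * q"
    by (induction q) (simp_all add: algebra_simps)
  then have "\<Sum>{..<p} = p * q" using q by simp
  have "geo_sum D p = (\<Sum>i<p. 1 + i * (p * t) + p * p * c i)"
    using c by simp
  also have "\<dots> = p + \<Sum>{..<p} * (p * t) + p * p * (\<Sum>i<p. c i)"
    by (simp only: sum.distrib sum_distrib_left sum_distrib_right) simp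
  also have "\<dots> = p * (1 + p * (q * t + (\<Sum>i<p. c i)))"
    using \<open>\<Sum>{..<p} = p * q\<close> by (simp add: algebra_simps)
  finally show ?thesis
    by (rule that) (simp only: cong_add_lcancel_0_nat cong_0_iff dvd_triv_left)
qed

text \<open>Lifting the exponent: k and its geometric sum have the same p-adic valuation. If k = p
  m, the sum is p c times the sum of length m for \<open>D ^ p\<close>, with c a unit modulo p; if p
  does not divide k, it does not divide the sum either. \<open>D\<close> varies in the induction
  because of the passage to \<open>D ^ p\<close>.\<close>

lemma prime_power_dvd_geo_sum_iff:
  fixes p :: nat
  assumes p: "Factorial_Ring.prime p" "odd p" and D: "[D = 1] (mod p)"
  shows "p ^ n dvd geo_sum D k \<longleftrightarrow> p ^ n dvd k"
  using D
proof (induction n arbitrary: D k)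
  case (Suc n)
  have dvd: "p dvd geo_sum D k \<longleftrightarrow> p dvd k"
    using cong_geo_sum_mod_p[OF Suc.prems] by (rule cong_dvd_iff[OF cong_sym[OF cong_sym]])
  show ?case
  proof (cases "p dvd k")
    case True
    then obtain m where m: "k = p * m" by blast
    obtain c where c: "geo_sum D p = p * c" "[c = 1] (mod p)"
      using geo_sum_prime[OF p Suc.prems] by blast
    have "coprime (p ^ n) c"
      using c(2) p(1) by (metis cong_imp_coprime cong_sym coprime_1_left coprime_commute coprime_power_left_iff)
    moreover have "[D ^ p = 1] (mod p)"
      using cong_pow[OF Suc.prems, of p] by simp
    ultimately show ?thesis
      using Suc.IH[of "D ^ p" m] p(1)
      by (simp add: m geo_sum_mult c(1) mult.assoc coprime_dvd_mult_right_iff prime_gt_0_nat)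
  next
    case False
    then show ?thesis
      using dvd by (metis dvd_mult_left power_Suc)
  qed
qed simp

text \<open>For j <= k the difference of the sums is D^j times the sum of length k - j, and D^j is a
  unit modulo p. This becomes the injectivity of b.\<close>

lemma geo_sum_cong_iff:
  fixes p :: nat
  assumes p: "Factorial_Ring.prime p" "odd p" and D: "[D = 1] (mod p)"
  shows "[geo_sum D j = geo_sum D k] (mod p ^ n) \<longleftrightarrow> [j = k] (mod p ^ n)"
proof -
  have le: "[geo_sum D j = geo_sum D k] (mod p ^ n) \<longleftrightarrow> [j = k] (mod p ^ n)" if jk: "j \<le> k" for j k
  proof -
    obtain m where m: "k = j + m" using le_Suc_ex[OF jk] by auto
    have "coprime (p ^ n) (D ^ j)"
      using D p(1) by (metis cong_imp_coprime cong_sym coprime_1_left coprime_commute coprime_power_left_iff coprime_power_right_iff)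
    then show ?thesis
      using prime_power_dvd_geo_sum_iff[OF assms, of n m]
      by (simp add: m geo_sum_add cong_sym_eq[of j "j + m"] cong_sym_eq[of "geo_sum D j" "geo_sum D j + D ^ j * geo_sum D m"] cong_add_lcancel_0_nat
          cong_0_iff coprime_dvd_mult_right_iff)
  qed
  show ?thesis
    using le[of j k] le[of k j] by (metis cong_sym_eq linear)
qed

text \<open>D^k - 1 is D - 1 times the geometric sum of length k, which \<open>p ^ n\<close> divides
  for k = \<open>p ^ n\<close>.\<close>

lemma power_prime_power_cong_1:
  fixes p :: nat
  assumes p: "Factorial_Ring.prime p" "odd p" and D: "[D = 1] (mod p)"
  shows "[D ^ (p ^ n) = 1] (mod p ^ n)"
proof -
  \<comment> \<open>Keeps the natural subtraction \<open>D - 1\<close> exact.\<close>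
  have "D > 0" using D p(1) by (metis bot_nat_0.not_eq_extremum cong_0_1_nat prime_gt_1_nat less_numeral_extra(4) cong_sym)
  have "D ^ k = 1 + (D - 1) * geo_sum D k" for k
    using \<open>D > 0\<close> by (cases D, simp, induction k) (auto simp: algebra_simps)
  from this[of "p ^ n"] show ?thesis
    using prime_power_dvd_geo_sum_iff[OF assms, of n "p ^ n"]
    by (auto simp only: cong_add_lcancel_0_nat cong_0_iff dvd_mult dvd_refl)
qed

section \<open>Finite sums and linear systems\<close>

context abelian_monoid begin

lemma finsum_closedI: "(\<And>i. i \<in> A \<Longrightarrow> f i \<in> carrier G) \<Longrightarrow> finsum G f A \<in> carrier G"
  by (rule finsum_closed) auto

lemma finsum_congI:
  "\<lbrakk>\<And>i. i \<in> A \<Longrightarrow> f i = g i; \<And>i. i \<in> A \<Longrightarrow> g i \<in> carrier G\<rbrakk> \<Longrightarrow> finsum G f A = finsum G g A"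
  by (rule finsum_cong') auto

lemma finsum_eq_zeroI: "(\<And>i. i \<in> A \<Longrightarrow> f i = \<zero>) \<Longrightarrow> finsum G f A = \<zero>"
  by (rule add.finprod_one_eqI)

lemma finsum_add:
  "\<lbrakk>\<And>i. i \<in> A \<Longrightarrow> f i \<in> carrier G; \<And>i. i \<in> A \<Longrightarrow> g i \<in> carrier G\<rbrakk>
    \<Longrightarrow> finsum G (\<lambda>i. f i \<oplus> g i) A = finsum G f A \<oplus> finsum G g A"
  by (rule finsum_addf) auto

lemma finsum_swap:
  assumes "finite A" "finite B" "\<And>x y. x \<in> A \<Longrightarrow> y \<in> B \<Longrightarrow> f x y \<in> carrier G"
  shows "(\<Oplus>x\<in>A. \<Oplus>y\<in>B. f x y) = (\<Oplus>y\<in>B. \<Oplus>x\<in>A. f x y)"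
  using assms(1,3)
proof (induction A)
  case empty
  then show ?case by (simp add: finsum_eq_zeroI)
next
  case (insert a A)
  have "(\<Oplus>x\<in>insert a A. \<Oplus>y\<in>B. f x y) = (\<Oplus>y\<in>B. f a y) \<oplus> (\<Oplus>x\<in>A. \<Oplus>y\<in>B. f x y)"
    using insert by (intro finsum_insert) (auto intro!: finsum_closedI)
  also have "\<dots> = (\<Oplus>y\<in>B. f a y) \<oplus> (\<Oplus>y\<in>B. \<Oplus>x\<in>A. f x y)"
    using insert by simp
  also have "\<dots> = (\<Oplus>y\<in>B. f a y \<oplus> (\<Oplus>x\<in>A. f x y))"
    using insert by (intro finsum_add[symmetric]) (auto intro!: finsum_closedI)
  also have "\<dots> = (\<Oplus>y\<in>B. \<Oplus>x\<in>insert a A. f x y)"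
    using insert by (intro finsum_congI) (auto intro!: finsum_closedI simp: finsum_insert Pi_def)
  finally show ?case .
qed

lemma finsum_delta:
  assumes "finite A" "i \<in> A \<Longrightarrow> f i \<in> carrier G"
  shows "(\<Oplus>j\<in>A. if j = i then f j else \<zero>) = (if i \<in> A then f i else \<zero>)"
proof (cases "i \<in> A")
  case True
  have "(\<Oplus>j\<in>A. if j = i then f j else \<zero>) = (\<Oplus>j\<in>A. if i = j then f i else \<zero>)"
    using assms True by (intro finsum_congI) auto
  also have "\<dots> = f i"
    using add.finprod_singleton[of i A "\<lambda>_. f i"] assms True by auto
  finally show ?thesis using True by simp
qed (auto intro!: finsum_eq_zeroI)

lemma finsum_reindex_bij:
  assumes "bij_betw h A B" "\<And>b. b \<in> B \<Longrightarrow> f b \<in> carrier G"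
  shows "finsum G f B = (\<Oplus>x\<in>A. f (h x))"
proof -
  have "B = h ` A" "inj_on h A" using assms(1) by (auto simp: bij_betw_def)
  then show ?thesis using finsum_reindex[of f h A] assms(2) by auto
qed

lemma finsum_mono_neutral:
  assumes "finite B" "A \<subseteq> B" "\<And>i. i \<in> B - A \<Longrightarrow> f i = \<zero>" "\<And>i. i \<in> A \<Longrightarrow> f i \<in> carrier G"
  shows "finsum G f A = finsum G f B"
proof (rule add.finprod_mono_neutral_cong_left[OF assms(1,2)])
  show "f \<in> B \<rightarrow> carrier G"
  proof
    fix i assume "i \<in> B"
    then show "f i \<in> carrier G" using assms(3,4) by (cases "i \<in> A") auto
  qed
qed (use assms in auto)

lemma finsum_Times:
  assumes "finite A" "finite B" "\<And>x y. x \<in> A \<Longrightarrow> y \<in> B \<Longrightarrow> f (x, y) \<in> carrier G"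
  shows "finsum G f (A \<times> B) = (\<Oplus>x\<in>A. \<Oplus>y\<in>B. f (x, y))"
  using assms(1,3)
proof (induction A)
  case (insert a A)
  have "finsum G f (insert a A \<times> B) = finsum G f (Pair a ` B \<union> A \<times> B)"
    by (rule arg_cong[where f = "finsum G f"]) auto
  also have "\<dots> = finsum G f (Pair a ` B) \<oplus> finsum G f (A \<times> B)"
    using insert assms(2) by (intro finsum_Un_disjoint) auto
  also have "finsum G f (Pair a ` B) = (\<Oplus>y\<in>B. f (a, y))"
    using insert by (intro finsum_reindex) (auto simp: inj_on_def)
  finally show ?case
    using insert by (simp add: finsum_insert Pi_def finsum_closedI)
qed simp

lemma finsum_lessThan_add:
  fixes m n :: nat
  assumes "\<And>i. i < n + m \<Longrightarrow> f i \<in> carrier G"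
  shows "finsum G f {..<n + m} = finsum G f {..<n} \<oplus> (\<Oplus>i\<in>{..<m}. f (n + i))"
  using assms
proof (induction m)
  case (Suc m)
  then show ?case
    by (simp add: lessThan_Suc Pi_def a_ac finsum_closedI)
qed (simp add: Pi_def)

end

context ring begin

lemma finsum_distrib_left:
  "\<lbrakk>finite A; a \<in> carrier R; \<And>i. i \<in> A \<Longrightarrow> f i \<in> carrier R\<rbrakk> \<Longrightarrow> a \<otimes> finsum R f A = (\<Oplus>i\<in>A. a \<otimes> f i)"
  by (rule finsum_rdistr) auto

lemma finsum_distrib_right:
  "\<lbrakk>finite A; a \<in> carrier R; \<And>i. i \<in> A \<Longrightarrow> f i \<in> carrier R\<rbrakk> \<Longrightarrow> finsum R f A \<otimes> a = (\<Oplus>i\<in>A. f i \<otimes> a)"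
  by (rule finsum_ldistr) auto

end

text \<open>Gaussian elimination, by induction on the number of equations. If the last equation has
  a nonzero coefficient at k, it is used to eliminate the unknown k from the others; one equation
  and one unknown disappear together.\<close>

lemma (in field) exists_nontrivial_solution:
  fixes m :: nat
  assumes "finite A" "card A > m"
    and "\<And>j i. j < m \<Longrightarrow> i \<in> A \<Longrightarrow> a j i \<in> carrier R"
  shows "\<exists>c. (\<forall>i\<in>A. c i \<in> carrier R) \<and> (\<exists>i\<in>A. c i \<noteq> \<zero>) \<and>
             (\<forall>j<m. (\<Oplus>i\<in>A. a j i \<otimes> c i) = \<zero>)"
  using assms
proof (induction m arbitrary: A a)
  case 0
  then show ?case by (intro exI[of _ "\<lambda>_. \<one>"]) (auto simp: card_gt_0_iff)
next
  case (Suc m)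
  show ?case
  proof (cases "\<forall>i\<in>A. a m i = \<zero>")
    case True
    obtain c where c: "\<forall>i\<in>A. c i \<in> carrier R" "\<exists>i\<in>A. c i \<noteq> \<zero>"
        "\<forall>j<m. (\<Oplus>i\<in>A. a j i \<otimes> c i) = \<zero>"
      using Suc.IH[of A a] Suc.prems by (auto simp: Suc_lessD)
    have "(\<Oplus>i\<in>A. a m i \<otimes> c i) = \<zero>"
      using True c(1) by (intro finsum_eq_zeroI) auto
    then show ?thesis using c by (intro exI[of _ c]) (auto simp: less_Suc_eq)
  next
    case False
    then obtain k where k: "k \<in> A" "a m k \<noteq> \<zero>" by blast
    define B where "B = A - {k}"
    have B: "finite B" "k \<notin> B" "A = insert k B" "card B > m"
      using Suc.prems k(1) by (auto simp: B_def)
    define q where "q = inv (a m k)"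
    have am: "a j i \<in> carrier R" if "j \<le> m" "i \<in> A" for j i
      using Suc.prems(3) that by auto
    have q: "q \<in> carrier R" "a m k \<otimes> q = \<one>"
      using k am[of m k] field_Units by (auto simp: q_def)
    \<comment> \<open>Row j minus the multiple of the last row that clears column k.\<close>
    define a' where "a' j i = a j i \<ominus> a j k \<otimes> q \<otimes> a m i" for j i
    have a': "a' j i \<in> carrier R" if "j \<le> m" "i \<in> A" for j i
      using am that q k by (simp add: a'_def)
    obtain c where c: "\<forall>i\<in>B. c i \<in> carrier R" "\<exists>i\<in>B. c i \<noteq> \<zero>"
        "\<forall>j<m. (\<Oplus>i\<in>B. a' j i \<otimes> c i) = \<zero>"
      using Suc.IH[of B a'] B a' by auto
    define s where "s = (\<Oplus>i\<in>B. a m i \<otimes> c i)"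
    have s: "s \<in> carrier R" unfolding s_def using c am B by (intro finsum_closedI) auto
    \<comment> \<open>The value at the pivot is forced by the last equation.\<close>
    define c' where "c' = c(k := \<ominus> (q \<otimes> s))"
    have c': "c' i \<in> carrier R" if "i \<in> A" for i
      using that B q s c(1) by (auto simp: c'_def)
    have c'B: "(\<Oplus>i\<in>B. a j i \<otimes> c' i) = (\<Oplus>i\<in>B. a j i \<otimes> c i)" if "j \<le> m" for j
      using B am c(1) that by (intro finsum_congI) (auto simp: c'_def)
    have ins: "(\<Oplus>i\<in>A. a j i \<otimes> c' i) = \<ominus> (a j k \<otimes> q \<otimes> s) \<oplus> (\<Oplus>i\<in>B. a j i \<otimes> c i)" if "j \<le> m" for j
    proof -
      have "(\<Oplus>i\<in>A. a j i \<otimes> c' i) = a j k \<otimes> c' k \<oplus> (\<Oplus>i\<in>B. a j i \<otimes> c' i)"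
        unfolding B(3) using B am c' that by (intro finsum_insert) auto
      then show ?thesis
        using c'B[OF that] am that k s q by (simp add: c'_def r_minus m_assoc)
    qed
    have "(\<Oplus>i\<in>A. a j i \<otimes> c' i) = \<zero>" if "j < Suc m" for j
    proof (cases "j = m")
      case True
      then show ?thesis
        using ins[of m] s q l_neg by (simp add: s_def[symmetric])
    next
      case False
      then have j: "j < m" using that by simp
      have "(\<Oplus>i\<in>B. a j i \<otimes> c i) = (\<Oplus>i\<in>B. a' j i \<otimes> c i \<oplus> (a j k \<otimes> q) \<otimes> (a m i \<otimes> c i))"
      proof (rule finsum_congI)
        fix i assume "i \<in> B"
        then have "a j i \<in> carrier R" "a j k \<in> carrier R" "a m i \<in> carrier R" "c i \<in> carrier R"
          using j c(1) B by (auto intro!: am)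
        then show "a j i \<otimes> c i = a' j i \<otimes> c i \<oplus> (a j k \<otimes> q) \<otimes> (a m i \<otimes> c i)"
          "a' j i \<otimes> c i \<oplus> (a j k \<otimes> q) \<otimes> (a m i \<otimes> c i) \<in> carrier R"
          using q(1) by (simp_all add: a'_def) algebra
      qed
      also have "\<dots> = (\<Oplus>i\<in>B. a' j i \<otimes> c i) \<oplus> (\<Oplus>i\<in>B. (a j k \<otimes> q) \<otimes> (a m i \<otimes> c i))"
        using B j c(1) q am a' by (intro finsum_add) auto
      also have "\<dots> = a j k \<otimes> q \<otimes> s"
        using c(3) j B c(1) q am k finsum_distrib_left[of B "a j k \<otimes> q" "\<lambda>i. a m i \<otimes> c i"] s by (simp add: s_def)
      finally show ?thesis
        using ins[of j] j am k q s l_neg by simp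
    qed
    moreover have "\<exists>i\<in>A. c' i \<noteq> \<zero>"
      using c(2) B by (auto simp: c'_def)
    ultimately show ?thesis using c' by blast
  qed
qed

section \<open>Automorphisms of a Galois extension\<close>

text \<open>Functions in HOL are total, so \<open>aut_ext\<close> ties equality in G to equality on
  \<open>carrier L\<close>. It provides the element of L on which two distinct automorphisms
  differ.\<close>

locale field_automorphisms = field L + G: group G
  for L :: "('a, 'l) ring_scheme" (structure) and G :: "('a \<Rightarrow> 'a) monoid" +
  assumes aut_hom: "g \<in> carrier G \<Longrightarrow> g \<in> ring_hom L L"
    and aut_mult: "\<lbrakk>g \<in> carrier G; h \<in> carrier G; x \<in> carrier L\<rbrakk> \<Longrightarrow> (g \<otimes>\<^bsub>G\<^esub> h) x = g (h x)"
    and aut_one: "x \<in> carrier L \<Longrightarrow> \<one>\<^bsub>G\<^esub> x = x"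
    and aut_ext: "\<lbrakk>g \<in> carrier G; h \<in> carrier G; \<And>x. x \<in> carrier L \<Longrightarrow> g x = h x\<rbrakk> \<Longrightarrow> g = h"
begin

lemma aut_closed [simp]: "\<lbrakk>g \<in> carrier G; x \<in> carrier L\<rbrakk> \<Longrightarrow> g x \<in> carrier L"
  using ring_hom_closed[OF aut_hom] by blast

lemma aut_add [simp]: "\<lbrakk>g \<in> carrier G; x \<in> carrier L; y \<in> carrier L\<rbrakk> \<Longrightarrow> g (x \<oplus> y) = g x \<oplus> g y"
  using ring_hom_add[OF aut_hom] by blast

lemma aut_times [simp]: "\<lbrakk>g \<in> carrier G; x \<in> carrier L; y \<in> carrier L\<rbrakk> \<Longrightarrow> g (x \<otimes> y) = g x \<otimes> g y"
  using ring_hom_mult[OF aut_hom] by blast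

lemma aut_1 [simp]: "g \<in> carrier G \<Longrightarrow> g \<one> = \<one>"
  using ring_hom_one[OF aut_hom] by blast

lemma aut_0 [simp]: "g \<in> carrier G \<Longrightarrow> g \<zero> = \<zero>"
  using ring_hom_zero[OF aut_hom ring_axioms ring_axioms] by blast

lemma aut_finsum:
  assumes "g \<in> carrier G" "finite A" "\<And>i. i \<in> A \<Longrightarrow> f i \<in> carrier L"
  shows "g (\<Oplus>i\<in>A. f i) = (\<Oplus>i\<in>A. g (f i))"
  using assms(2,3)
proof (induction A)
  case (insert a A)
  have fs: "f a \<in> carrier L" "(\<Oplus>i\<in>A. f i) \<in> carrier L"
    using insert by (auto intro!: finsum_closedI)
  have "(\<Oplus>i\<in>insert a A. f i) = f a \<oplus> (\<Oplus>i\<in>A. f i)"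
    using insert by (intro finsum_insert) auto
  moreover have "(\<Oplus>i\<in>insert a A. g (f i)) = g (f a) \<oplus> (\<Oplus>i\<in>A. g (f i))"
    using insert assms(1) by (intro finsum_insert) auto
  ultimately show ?case
    using insert assms(1) fs by simp
qed (use assms in simp)

text \<open>Seen as functions of g, the sums of l'_i g(l_i) are closed under multiplication by a
  g(x) + b. Multiplying out gives n terms with l_i x and l'_i a, and n terms with l_i and l'_i
  b.\<close>

lemma separating_step:
  fixes n :: nat
  assumes l: "\<And>i. i < n \<Longrightarrow> l i \<in> carrier L" "\<And>i. i < n \<Longrightarrow> l' i \<in> carrier L"
    and x: "x \<in> carrier L" and a: "a \<in> carrier L" and b: "b \<in> carrier L"
  obtains l2 l2' where "\<And>i. i < n + n \<Longrightarrow> l2 i \<in> carrier L" "\<And>i. i < n + n \<Longrightarrow> l2' i \<in> carrier L"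
    "\<And>g. g \<in> carrier G \<Longrightarrow>
      (\<Oplus>i\<in>{..<n + n}. l2' i \<otimes> g (l2 i)) = (\<Oplus>i\<in>{..<n}. l' i \<otimes> g (l i)) \<otimes> (a \<otimes> g x \<oplus> b)"
proof
  let ?l2 = "\<lambda>i. if i < n then l i \<otimes> x else l (i - n)"
  let ?l2' = "\<lambda>i. if i < n then l' i \<otimes> a else l' (i - n) \<otimes> b"
  show c: "?l2 i \<in> carrier L" "?l2' i \<in> carrier L" if "i < n + n" for i
    using that l x a b by auto
  fix g assume g: "g \<in> carrier G"
  let ?s = "\<Oplus>i\<in>{..<n}. l' i \<otimes> g (l i)"
  have s: "?s \<in> carrier L" using l g by (intro finsum_closedI) auto
  have "(\<Oplus>i\<in>{..<n + n}. ?l2' i \<otimes> g (?l2 i))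
      = (\<Oplus>i\<in>{..<n}. ?l2' i \<otimes> g (?l2 i)) \<oplus> (\<Oplus>i\<in>{..<n}. ?l2' (n + i) \<otimes> g (?l2 (n + i)))"
    using c g by (intro finsum_lessThan_add) auto
  also have "(\<Oplus>i\<in>{..<n}. ?l2' i \<otimes> g (?l2 i)) = (\<Oplus>i\<in>{..<n}. (l' i \<otimes> g (l i)) \<otimes> (a \<otimes> g x))"
    using l x a g by (intro finsum_congI) (auto simp: m_ac)
  also have "(\<Oplus>i\<in>{..<n}. ?l2' (n + i) \<otimes> g (?l2 (n + i))) = (\<Oplus>i\<in>{..<n}. (l' i \<otimes> g (l i)) \<otimes> b)"
    using l b g by (intro finsum_congI) (auto simp: m_ac)
  also have "(\<Oplus>i\<in>{..<n}. (l' i \<otimes> g (l i)) \<otimes> (a \<otimes> g x)) = ?s \<otimes> (a \<otimes> g x)"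
    using l x a g by (intro finsum_distrib_right[symmetric]) auto
  also have "(\<Oplus>i\<in>{..<n}. (l' i \<otimes> g (l i)) \<otimes> b) = ?s \<otimes> b"
    using l b g by (intro finsum_distrib_right[symmetric]) auto
  finally show "(\<Oplus>i\<in>{..<n + n}. ?l2' i \<otimes> g (?l2 i)) = ?s \<otimes> (a \<otimes> g x \<oplus> b)"
    using s x a b g by (simp add: r_distr)
qed

text \<open>
  If \<open>d = h x - g x \<noteq> 0\<close>, the factor \<open>k \<mapsto> (k x - g x) / d\<close> takes the value 1 at \<open>h\<close> and 0 at \<open>g\<close>;
  the product of such factors separates \<open>h\<close> from finitely many automorphisms.
\<close>

lemma exists_separating:
  assumes "finite F" "F \<subseteq> carrier G" "h \<in> carrier G" "h \<notin> F"
  obtains n :: nat and l l' where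
    "\<And>i. i < n \<Longrightarrow> l i \<in> carrier L" "\<And>i. i < n \<Longrightarrow> l' i \<in> carrier L"
    "(\<Oplus>i\<in>{..<n}. l' i \<otimes> h (l i)) = \<one>"
    "\<And>g. g \<in> F \<Longrightarrow> (\<Oplus>i\<in>{..<n}. l' i \<otimes> g (l i)) = \<zero>"
proof -
  have "\<exists>(n::nat) l l'. (\<forall>i<n. l i \<in> carrier L \<and> l' i \<in> carrier L) \<and>
      (\<Oplus>i\<in>{..<n}. l' i \<otimes> h (l i)) = \<one> \<and> (\<forall>g\<in>F. (\<Oplus>i\<in>{..<n}. l' i \<otimes> g (l i)) = \<zero>)"
    using assms
  proof (induction F)
    case empty
    have "(\<Oplus>i\<in>{..<Suc 0}. \<one> \<otimes> h \<one>) = \<one>"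
      using empty by (simp add: lessThan_Suc)
    then show ?case
      by (intro exI[of _ "Suc 0"] exI[of _ "\<lambda>_. \<one>"]) auto
  next
    case (insert g F)
    have "\<exists>(n::nat) l l'. (\<forall>i<n. l i \<in> carrier L \<and> l' i \<in> carrier L) \<and>
      (\<Oplus>i\<in>{..<n}. l' i \<otimes> h (l i)) = \<one> \<and> (\<forall>g\<in>F. (\<Oplus>i\<in>{..<n}. l' i \<otimes> g (l i)) = \<zero>)"
      using insert.prems by (intro insert.IH) auto
    then obtain n :: nat and l l' where n: "\<forall>i<n. l i \<in> carrier L \<and> l' i \<in> carrier L"
      "(\<Oplus>i\<in>{..<n}. l' i \<otimes> h (l i)) = \<one>" "\<forall>g\<in>F. (\<Oplus>i\<in>{..<n}. l' i \<otimes> g (l i)) = \<zero>"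
      by (elim exE conjE)
    then have ll: "\<And>i. i < n \<Longrightarrow> l i \<in> carrier L" "\<And>i. i < n \<Longrightarrow> l' i \<in> carrier L"
      "(\<Oplus>i\<in>{..<n}. l' i \<otimes> h (l i)) = \<one>"
      "\<And>g. g \<in> F \<Longrightarrow> (\<Oplus>i\<in>{..<n}. l' i \<otimes> g (l i)) = \<zero>"
      by auto
    have g: "g \<in> carrier G" and h: "h \<in> carrier G" and "g \<noteq> h" using insert.prems by auto
    then obtain x where x: "x \<in> carrier L" "g x \<noteq> h x" using aut_ext by blast
    define d where "d = h x \<ominus> g x"
    have d: "d \<in> carrier L" "d \<noteq> \<zero>"
      using x g h r_right_minus_eq[of "h x" "g x"] unfolding d_def by (simp, metis aut_closed)
    define q where "q = inv d"
    have q: "q \<in> carrier L" "q \<otimes> d = \<one>"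
      using d field_Units by (auto simp: q_def)
    have qg: "\<ominus> (q \<otimes> g x) \<in> carrier L" using q g x by simp
    obtain l2 l2' where l2: "\<And>i. i < n + n \<Longrightarrow> l2 i \<in> carrier L" "\<And>i. i < n + n \<Longrightarrow> l2' i \<in> carrier L"
      and s: "\<And>k. k \<in> carrier G \<Longrightarrow> (\<Oplus>i\<in>{..<n + n}. l2' i \<otimes> k (l2 i))
                 = (\<Oplus>i\<in>{..<n}. l' i \<otimes> k (l i)) \<otimes> (q \<otimes> k x \<oplus> \<ominus> (q \<otimes> g x))"
      by (rule separating_step[OF ll(1,2) x(1) q(1) qg]) blast+
    have "q \<otimes> h x \<oplus> \<ominus> (q \<otimes> g x) = q \<otimes> d"
      using q x g h unfolding d_def by (simp add: r_distr r_minus minus_eq)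
    then have "(\<Oplus>i\<in>{..<n + n}. l2' i \<otimes> h (l2 i)) = \<one>"
      using s[OF h] ll(3) q by simp
    moreover have "(\<Oplus>i\<in>{..<n + n}. l2' i \<otimes> k (l2 i)) = \<zero>" if "k \<in> insert g F" for k
    proof -
      have k: "k \<in> carrier G" using that insert.prems by auto
      have c: "(\<Oplus>i\<in>{..<n}. l' i \<otimes> k (l i)) \<in> carrier L" "q \<otimes> k x \<oplus> \<ominus> (q \<otimes> g x) \<in> carrier L"
        using k ll x q g by (auto intro!: finsum_closedI)
      show ?thesis
      proof (cases "k = g")
        case True
        then have "q \<otimes> k x \<oplus> \<ominus> (q \<otimes> g x) = \<zero>" using q x g r_neg by simp
        then show ?thesis using s[OF k] c by simp
      next
        case False
        then show ?thesis using that s[OF k] c ll(4)[of k] by simp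
      qed
    qed
    ultimately show ?case
      using l2 by blast
  qed
  then show ?thesis using that by blast
qed

text \<open>Dedekind independence. Evaluating the relation at the l_i of a family that separates h
  from the rest of F, weighting with the l'_i and summing singles out the coefficient of h.\<close>

lemma automorphisms_independent:
  assumes F: "finite F" "F \<subseteq> carrier G" and c: "\<And>g. g \<in> F \<Longrightarrow> c g \<in> carrier L"
    and z: "\<And>x. x \<in> carrier L \<Longrightarrow> (\<Oplus>g\<in>F. g x \<otimes> c g) = \<zero>" and h: "h \<in> F"
  shows "c h = \<zero>"
proof -
  obtain n :: nat and l l' where l: "\<And>i. i < n \<Longrightarrow> l i \<in> carrier L" "\<And>i. i < n \<Longrightarrow> l' i \<in> carrier L"
    and one: "(\<Oplus>i\<in>{..<n}. l' i \<otimes> h (l i)) = \<one>"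
    and zero: "\<And>g. g \<in> F - {h} \<Longrightarrow> (\<Oplus>i\<in>{..<n}. l' i \<otimes> g (l i)) = \<zero>"
    using exists_separating[of "F - {h}" h] F h by blast
  have gc: "g x \<in> carrier L" if "g \<in> F" "x \<in> carrier L" for g x
    using that F by auto
  have "\<zero> = (\<Oplus>i\<in>{..<n}. l' i \<otimes> (\<Oplus>g\<in>F. g (l i) \<otimes> c g))"
    using l z by (intro finsum_eq_zeroI[symmetric]) auto
  also have "\<dots> = (\<Oplus>i\<in>{..<n}. \<Oplus>g\<in>F. l' i \<otimes> g (l i) \<otimes> c g)"
    using l gc c F by (intro finsum_congI) (auto simp: finsum_distrib_left m_assoc intro!: finsum_closedI finsum_congI)
  also have "\<dots> = (\<Oplus>g\<in>F. \<Oplus>i\<in>{..<n}. l' i \<otimes> g (l i) \<otimes> c g)"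
    using l gc c F by (intro finsum_swap) auto
  also have "\<dots> = (\<Oplus>g\<in>F. if g = h then c g else \<zero>)"
  proof (rule finsum_congI)
    fix g assume g: "g \<in> F"
    have "(\<Oplus>i\<in>{..<n}. l' i \<otimes> g (l i) \<otimes> c g) = (\<Oplus>i\<in>{..<n}. l' i \<otimes> g (l i)) \<otimes> c g"
      using l gc c F g by (intro finsum_distrib_right[symmetric]) auto
    then show "(\<Oplus>i\<in>{..<n}. l' i \<otimes> g (l i) \<otimes> c g) = (if g = h then c g else \<zero>)"
      using one zero g c by auto
  qed (use c in auto)
  also have "\<dots> = c h"
    using F h c by (subst finsum_delta) auto
  finally show ?thesis by simp
qed

end

section \<open>Galois extensions: finiteness of the group and the bound by the degree\<close>

locale galois_descent = field_automorphisms L G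
  for L :: "('a, 'l) ring_scheme" (structure) and G :: "('a \<Rightarrow> 'a) monoid" and K :: "'a set" +
  assumes K_subfield: "subfield K L"
    and K_fixed: "\<lbrakk>g \<in> carrier G; x \<in> K\<rbrakk> \<Longrightarrow> g x = x"
    and fixed_K: "\<lbrakk>x \<in> carrier L; \<And>g. g \<in> carrier G \<Longrightarrow> g x = x\<rbrakk> \<Longrightarrow> x \<in> K"
begin

lemma K_subring: "subring K L"
  using subfieldE(1)[OF K_subfield] .

lemma K_in_carrier [simp]: "x \<in> K \<Longrightarrow> x \<in> carrier L"
  using subringE(1)[OF K_subring] by blast

lemma Span_functional_zero:
  assumes add: "\<And>x y. \<lbrakk>x \<in> carrier L; y \<in> carrier L\<rbrakk> \<Longrightarrow> \<phi> (x \<oplus> y) = \<phi> x \<oplus> \<phi> y"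
    and smult: "\<And>k x. \<lbrakk>k \<in> K; x \<in> carrier L\<rbrakk> \<Longrightarrow> \<phi> (k \<otimes> x) = k \<otimes> \<phi> x"
    and z: "\<phi> \<zero> = \<zero>"
    and Vs: "set Vs \<subseteq> carrier L" "\<And>v. v \<in> set Vs \<Longrightarrow> \<phi> v = \<zero>"
    and x: "x \<in> Span K Vs"
  shows "\<phi> x = \<zero>"
  using Vs x
proof (induction Vs arbitrary: x)
  case Nil
  then show ?case using z by simp
next
  case (Cons v Vs)
  then obtain k y where ky: "k \<in> K" "y \<in> Span K Vs" "x = k \<otimes> v \<oplus> y"
    by (auto simp: line_extension_mem_iff)
  have "y \<in> carrier L"
    using ky Span_in_carrier[of K Vs] Cons.prems K_in_carrier by (meson list.set_intros(2) subsetD subsetI)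
  then show ?case
    using Cons ky by (simp add: add smult)
qed

text \<open>With more than d automorphisms, some nontrivial combination of them vanishes on a
  spanning list of length d. Being K-linear, it vanishes on L, against independence.\<close>

lemma card_automorphisms_le:
  assumes dim: "dimension d K (carrier L)" and F: "finite F" "F \<subseteq> carrier G"
  shows "card F \<le> d"
proof (rule ccontr)
  assume "\<not> card F \<le> d"
  then have gt: "card F > d" by simp
  obtain Vs where Vs: "set Vs \<subseteq> carrier L" "length Vs = d" "Span K Vs = carrier L"
    using exists_base[OF K_subfield dim] by blast
  have gx: "g x \<in> carrier L" if "g \<in> F" "x \<in> carrier L" for g x
    using that F by auto
  have vj: "Vs ! j \<in> carrier L" if "j < d" for j
    using Vs that by auto
  obtain c where c: "\<forall>g\<in>F. c g \<in> carrier L" "\<exists>g\<in>F. c g \<noteq> \<zero>"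
     "\<forall>j<d. (\<Oplus>g\<in>F. g (Vs ! j) \<otimes> c g) = \<zero>"
    using exists_nontrivial_solution[OF F(1) gt, of "\<lambda>j g. g (Vs ! j)"] gx vj by blast
  let ?\<phi> = "\<lambda>x. \<Oplus>g\<in>F. g x \<otimes> c g"
  have "?\<phi> x = \<zero>" if x: "x \<in> carrier L" for x
  proof (rule Span_functional_zero[of ?\<phi> Vs x])
    fix x y assume xy: "x \<in> carrier L" "y \<in> carrier L"
    show "?\<phi> (x \<oplus> y) = ?\<phi> x \<oplus> ?\<phi> y"
    proof -
      have "?\<phi> (x \<oplus> y) = (\<Oplus>g\<in>F. g x \<otimes> c g \<oplus> g y \<otimes> c g)"
        using xy F(2) c(1) gx by (intro finsum_congI) (auto simp: l_distr subset_iff)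
      then show ?thesis using xy F(2) c(1) gx by (subst finsum_add[symmetric]) auto
    qed
  next
    fix k x assume kx: "k \<in> K" "x \<in> carrier L"
    show "?\<phi> (k \<otimes> x) = k \<otimes> ?\<phi> x"
      using kx F c(1) gx by (subst finsum_distrib_left) (auto simp: subset_iff K_fixed m_assoc intro!: finsum_congI)
  next
    fix v assume "v \<in> set Vs"
    then show "?\<phi> v = \<zero>" using c(3) Vs(2) by (metis in_set_conv_nth)
  qed (use Vs x F c in \<open>auto simp: subset_iff intro!: finsum_eq_zeroI\<close>)
  then show False
    using automorphisms_independent[OF F, of c] c(1,2) by blast
qed

lemma finite_automorphisms:
  assumes "dimension d K (carrier L)"
  shows "finite (carrier G)"
proof (rule ccontr)
  assume "infinite (carrier G)"
  then obtain F where "F \<subseteq> carrier G" "finite F" "card F = Suc d"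
    using infinite_arbitrarily_large by blast
  then show False using card_automorphisms_le[OF assms, of F] by simp
qed

section \<open>The trace form and the lower bound for the order of the group\<close>

definition trace :: "'a \<Rightarrow> 'a" where
  "trace x = (\<Oplus>g\<in>carrier G. g x)"

lemma bij_left_mult: "h \<in> carrier G \<Longrightarrow> bij_betw (\<lambda>g. h \<otimes>\<^bsub>G\<^esub> g) (carrier G) (carrier G)"
  by (rule bij_betw_byWitness[of _ "\<lambda>g. inv\<^bsub>G\<^esub> h \<otimes>\<^bsub>G\<^esub> g"])
    (auto simp: G.m_assoc[symmetric] image_subset_iff)

lemma trace_closed [simp]: "x \<in> carrier L \<Longrightarrow> trace x \<in> carrier L"
  unfolding trace_def by (intro finsum_closedI) auto

lemma trace_in_K:
  assumes fin: "finite (carrier G)" and x: "x \<in> carrier L"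
  shows "trace x \<in> K"
proof (rule fixed_K)
  fix h assume h: "h \<in> carrier G"
  have "h (trace x) = (\<Oplus>g\<in>carrier G. h (g x))"
    unfolding trace_def using h x fin by (intro aut_finsum) auto
  also have "\<dots> = (\<Oplus>g\<in>carrier G. (h \<otimes>\<^bsub>G\<^esub> g) x)"
    using h x by (intro finsum_congI) (auto simp: aut_mult)
  also have "\<dots> = trace x"
    unfolding trace_def using h x finsum_reindex_bij[OF bij_left_mult[OF h], of "\<lambda>g. g x"] by simp
  finally show "h (trace x) = trace x" .
qed (use x in simp)

text \<open>Separating the identity from the other automorphisms is the case g = 1. The general case
  follows by applying g to the sum for g^-1 h.\<close>

lemma exists_dual_family:
  assumes fin: "finite (carrier G)"
  obtains n :: nat and l l' where
    "\<And>i. i < n \<Longrightarrow> l i \<in> carrier L" "\<And>i. i < n \<Longrightarrow> l' i \<in> carrier L"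
    "\<And>g h. \<lbrakk>g \<in> carrier G; h \<in> carrier G\<rbrakk> \<Longrightarrow>
       (\<Oplus>i\<in>{..<n}. g (l' i) \<otimes> h (l i)) = (if g = h then \<one> else \<zero>)"
proof -
  obtain n :: nat and l l' where l: "\<And>i. i < n \<Longrightarrow> l i \<in> carrier L" "\<And>i. i < n \<Longrightarrow> l' i \<in> carrier L"
    and one: "(\<Oplus>i\<in>{..<n}. l' i \<otimes> \<one>\<^bsub>G\<^esub> (l i)) = \<one>"
    and zero: "\<And>g. g \<in> carrier G - {\<one>\<^bsub>G\<^esub>} \<Longrightarrow> (\<Oplus>i\<in>{..<n}. l' i \<otimes> g (l i)) = \<zero>"
    using exists_separating[of "carrier G - {\<one>\<^bsub>G\<^esub>}" "\<one>\<^bsub>G\<^esub>"] fin by blast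
  have "(\<Oplus>i\<in>{..<n}. g (l' i) \<otimes> h (l i)) = (if g = h then \<one> else \<zero>)"
    if gh: "g \<in> carrier G" "h \<in> carrier G" for g h
  proof -
    let ?k = "inv\<^bsub>G\<^esub> g \<otimes>\<^bsub>G\<^esub> h"
    have k: "?k \<in> carrier G" "g \<otimes>\<^bsub>G\<^esub> ?k = h" "?k = \<one>\<^bsub>G\<^esub> \<longleftrightarrow> g = h"
      using gh by (auto simp: G.m_assoc[symmetric] G.inv_solve_left')
    have "(\<Oplus>i\<in>{..<n}. g (l' i) \<otimes> h (l i)) = (\<Oplus>i\<in>{..<n}. g (l' i \<otimes> ?k (l i)))"
      using gh k l by (intro finsum_congI) (auto simp: aut_mult[symmetric])
    also have "\<dots> = g (\<Oplus>i\<in>{..<n}. l' i \<otimes> ?k (l i))"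
      using gh k l by (intro aut_finsum[symmetric]) auto
    also have "\<dots> = (if g = h then \<one> else \<zero>)"
      using one zero[of ?k] k gh by auto
    finally show ?thesis .
  qed
  then show ?thesis using that l by blast
qed

text \<open>trace(y x) is the sum of g(y) g(x), a combination of automorphisms evaluated at y.
  Independence kills its coefficients g(x), among them x itself.\<close>

lemma trace_nondegenerate:
  assumes fin: "finite (carrier G)" and x: "x \<in> carrier L"
    and z: "\<And>y. y \<in> carrier L \<Longrightarrow> trace (y \<otimes> x) = \<zero>"
  shows "x = \<zero>"
proof -
  have "\<one>\<^bsub>G\<^esub> x = \<zero>"
  proof (rule automorphisms_independent[OF fin subset_refl, of "\<lambda>g. g x"])
    fix y assume "y \<in> carrier L"
    then show "(\<Oplus>g\<in>carrier G. g y \<otimes> g x) = \<zero>"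
      using z[of y] x unfolding trace_def by (subst finsum_congI[of _ _ "\<lambda>g. g (y \<otimes> x)"]) auto
  qed (use x in auto)
  then show ?thesis using aut_one x by simp
qed

text \<open>Nondegeneracy at 1 gives an element of nonzero trace, which is scaled by an element of
  K. Dividing by the order of G instead would fail in characteristic p.\<close>

lemma exists_trace_one:
  assumes fin: "finite (carrier G)"
  obtains t where "t \<in> carrier L" "trace t = \<one>"
proof -
  obtain y where y: "y \<in> carrier L" "trace y \<noteq> \<zero>"
    using trace_nondegenerate[OF fin, of \<one>] by auto
  define q where "q = inv (trace y)"
  have q: "q \<in> K" "q \<in> carrier L" "q \<otimes> trace y = \<one>"
    using y subfield_m_inv[OF K_subfield, of "trace y"] trace_in_K[OF fin y(1)] K_in_carrier
    by (auto simp: q_def)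
  have "trace (q \<otimes> y) = (\<Oplus>g\<in>carrier G. q \<otimes> g y)"
    unfolding trace_def using q y by (intro finsum_congI) (auto simp: K_fixed)
  also have "\<dots> = q \<otimes> trace y"
    unfolding trace_def using q y fin by (intro finsum_distrib_left[symmetric]) auto
  finally show ?thesis using that[of "q \<otimes> y"] q y by simp
qed

text \<open>\<open>independent\<close> speaks of \<open>combine\<close> on lists, whereas traces
  give indexed sums; this translates between them.\<close>

lemma combine_eq_finsum:
  assumes "set Us \<subseteq> carrier L" "\<And>j. j < length Us \<Longrightarrow> c j \<in> carrier L"
  shows "combine (map c [0..<length Us]) Us = (\<Oplus>j\<in>{..<length Us}. c j \<otimes> Us ! j)"
  using assms
proof (induction Us rule: rev_induct)
  case (snoc u Us)
  have Us: "set Us \<subseteq> carrier L" "u \<in> carrier L" using snoc by auto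
  have "combine (map c [0..<length Us] @ [c (length Us)]) (Us @ [u])
      = combine (map c [0..<length Us]) Us \<oplus> combine [c (length Us)] [u]"
    using snoc.prems by (intro combine_append[symmetric]) auto
  also have "combine (map c [0..<length Us]) Us = (\<Oplus>j\<in>{..<length Us}. c j \<otimes> Us ! j)"
    using snoc by simp
  also have "\<dots> = (\<Oplus>j\<in>{..<length Us}. c j \<otimes> (Us @ [u]) ! j)"
    using snoc.prems(2) Us by (intro finsum_congI) (auto simp: nth_append subset_iff)
  also have "\<dots> \<oplus> combine [c (length Us)] [u] = (\<Oplus>j\<in>{..<Suc (length Us)}. c j \<otimes> (Us @ [u]) ! j)"
  proof -
    have "(\<Oplus>j\<in>{..<Suc (length Us)}. c j \<otimes> (Us @ [u]) ! j)
        = c (length Us) \<otimes> (Us @ [u]) ! length Us \<oplus> (\<Oplus>j\<in>{..<length Us}. c j \<otimes> (Us @ [u]) ! j)"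
      unfolding lessThan_Suc using snoc.prems(2) Us
      by (intro finsum_insert) (auto simp: nth_append subset_iff)
    moreover have "(\<Oplus>j\<in>{..<length Us}. c j \<otimes> (Us @ [u]) ! j) \<in> carrier L"
      using snoc.prems(2) Us by (intro finsum_closedI) (auto simp: nth_append subset_iff)
    ultimately show ?thesis using snoc.prems(2) Us by (simp add: a_comm)
  qed
  finally show ?case by simp
qed simp

text \<open>If d exceeded the order of G, a nontrivial c would satisfy: the sum of g(v_j) c_j is 0
  for every g, where v is a K-basis. Then the sum of trace(y c_j) v_j is 0 for every y. The traces
  lie in K, so they vanish, and nondegeneracy gives c = 0. That K is the full fixed field enters
  through \<open>trace_in_K\<close>.\<close>

lemma dimension_le_card_automorphisms:
  assumes dim: "dimension d K (carrier L)"
  shows "d \<le> card (carrier G)"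
proof (rule ccontr)
  assume "\<not> d \<le> card (carrier G)"
  then have gt: "card {..<d} > card (carrier G)" by simp
  have fin: "finite (carrier G)" by (rule finite_automorphisms[OF dim])
  obtain e where e: "bij_betw e {..<card (carrier G)} (carrier G)"
    using ex_bij_betw_nat_finite[OF fin] by (auto simp: atLeast0LessThan)
  obtain Vs where Vs: "set Vs \<subseteq> carrier L" "independent K Vs" "length Vs = d"
    using exists_base[OF K_subfield dim] by blast
  have vj: "Vs ! j \<in> carrier L" if "j < d" for j
    using Vs that by auto
  have ej: "e j \<in> carrier G" if "j < card (carrier G)" for j
    using that e by (auto simp: bij_betw_def)
  obtain c where c: "\<forall>j\<in>{..<d}. c j \<in> carrier L" "\<exists>j\<in>{..<d}. c j \<noteq> \<zero>"
     "\<forall>i<card (carrier G). (\<Oplus>j\<in>{..<d}. e i (Vs ! j) \<otimes> c j) = \<zero>"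
    using exists_nontrivial_solution[OF finite_lessThan gt, of "\<lambda>i j. e i (Vs ! j)"] vj ej by auto
  have sol: "(\<Oplus>j\<in>{..<d}. g (Vs ! j) \<otimes> c j) = \<zero>" if gG: "g \<in> carrier G" for g
  proof -
    obtain i where "i < card (carrier G)" "g = e i"
      using gG bij_betw_imp_surj_on[OF e] by (metis imageE lessThan_iff)
    then show ?thesis using c(3) by blast
  qed
  have tr0: "trace (y \<otimes> c j) = \<zero>" if y: "y \<in> carrier L" and j: "j < d" for y j
  proof -
    have "(\<Oplus>j\<in>{..<d}. trace (y \<otimes> c j) \<otimes> Vs ! j)
        = (\<Oplus>j\<in>{..<d}. \<Oplus>g\<in>carrier G. g (y \<otimes> c j) \<otimes> Vs ! j)"
      unfolding trace_def using c(1) y vj fin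
      by (intro finsum_congI finsum_distrib_right finsum_closedI) auto
    also have "\<dots> = (\<Oplus>g\<in>carrier G. \<Oplus>j\<in>{..<d}. g (y \<otimes> c j) \<otimes> Vs ! j)"
      using c(1) y vj fin by (intro finsum_swap) auto
    also have "\<dots> = \<zero>"
    proof (rule finsum_eq_zeroI)
      fix g assume g: "g \<in> carrier G"
      then have ig: "inv\<^bsub>G\<^esub> g \<in> carrier G" by simp
      have gi: "g ((inv\<^bsub>G\<^esub> g) x) = x" if "x \<in> carrier L" for x
        using that g ig aut_mult[OF g ig that] aut_one by simp
      \<comment> \<open>Writing v_j as g applied to g^-1(v_j) pulls g out of the sum and leaves the
        relation for g^-1.\<close>
      have "(\<Oplus>j\<in>{..<d}. g (y \<otimes> c j) \<otimes> Vs ! j)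
          = (\<Oplus>j\<in>{..<d}. g (y \<otimes> ((inv\<^bsub>G\<^esub> g) (Vs ! j) \<otimes> c j)))"
        using c(1) y vj g ig by (intro finsum_congI) (auto simp: gi m_ac)
      also have "\<dots> = g (\<Oplus>j\<in>{..<d}. y \<otimes> ((inv\<^bsub>G\<^esub> g) (Vs ! j) \<otimes> c j))"
        using c(1) y vj g ig by (intro aut_finsum[symmetric]) auto
      also have "(\<Oplus>j\<in>{..<d}. y \<otimes> ((inv\<^bsub>G\<^esub> g) (Vs ! j) \<otimes> c j)) = y \<otimes> \<zero>"
        using c(1) y vj g ig by (subst finsum_distrib_left[symmetric]) (auto simp: sol)
      finally show "(\<Oplus>j\<in>{..<d}. g (y \<otimes> c j) \<otimes> Vs ! j) = \<zero>" using y g by simp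
    qed
    finally have "combine (map (\<lambda>j. trace (y \<otimes> c j)) [0..<length Vs]) Vs = \<zero>"
      using c(1) y Vs by (subst combine_eq_finsum) auto
    then have "set (take (length Vs) (map (\<lambda>j. trace (y \<otimes> c j)) [0..<length Vs])) \<subseteq> {\<zero>}"
      using c(1) y Vs fin by (intro independent_imp_trivial_combine[OF K_subfield Vs(2)]) (auto intro!: trace_in_K)
    then show ?thesis using j Vs(3) by (auto simp: image_subset_iff)
  qed
  then have "c j = \<zero>" if "j < d" for j
    using trace_nondegenerate[OF fin, of "c j"] c(1) that by auto
  then show False using c(2) by auto
qed

lemma card_automorphisms:
  assumes "dimension d K (carrier L)"
  shows "card (carrier G) = d"
  using dimension_le_card_automorphisms[OF assms]
    card_automorphisms_le[OF assms finite_automorphisms[OF assms]] by simp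

end

section \<open>Free modules and cosets of submodules\<close>

lemma free_module_sel [simp]:
  "carrier (free_module R B) = {u. (\<forall>x\<in>B. u x \<in> carrier R) \<and> (\<forall>x. x \<notin> B \<longrightarrow> u x = \<zero>\<^bsub>R\<^esub>)
                   \<and> finite {x. u x \<noteq> \<zero>\<^bsub>R\<^esub>}}"
  "\<zero>\<^bsub>free_module R B\<^esub> = (\<lambda>_. \<zero>\<^bsub>R\<^esub>)"
  "u \<oplus>\<^bsub>free_module R B\<^esub> v = (\<lambda>x. u x \<oplus>\<^bsub>R\<^esub> v x)"
  "c \<odot>\<^bsub>free_module R B\<^esub> u = (\<lambda>x. c \<otimes>\<^bsub>R\<^esub> u x)"
  by (simp_all add: free_module_def)

context cring begin

lemma free_module_value:
  "u \<in> carrier (free_module R B) \<Longrightarrow> u x \<in> carrier R"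
  by (cases "x \<in> B") auto

lemma free_module_is_module: "module R (free_module R B)"
proof (rule moduleI)
  have plus: "finite {x. u x \<oplus> v x \<noteq> \<zero>}"
    if "finite {x. u x \<noteq> \<zero>}" "finite {x. v x \<noteq> \<zero>}" for u v :: "'c \<Rightarrow> 'a"
    by (rule finite_subset[of _ "{x. u x \<noteq> \<zero>} \<union> {x. v x \<noteq> \<zero>}"]) (use that in auto)
  show "abelian_group (free_module R B)"
  proof (rule abelian_groupI)
    fix u assume u: "u \<in> carrier (free_module R B)"
    have "{x. \<ominus> u x \<noteq> \<zero>} \<subseteq> {x. u x \<noteq> \<zero>}" by auto
    then have "(\<lambda>x. \<ominus> u x) \<in> carrier (free_module R B)"
      using u finite_subset by auto
    moreover have "(\<lambda>x. \<ominus> u x) \<oplus>\<^bsub>free_module R B\<^esub> u = \<zero>\<^bsub>free_module R B\<^esub>"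
      using free_module_value[OF u] by (auto simp: l_neg)
    ultimately show "\<exists>v\<in>carrier (free_module R B). v \<oplus>\<^bsub>free_module R B\<^esub> u = \<zero>\<^bsub>free_module R B\<^esub>"
      by blast
  next
    fix u v w
    assume "u \<in> carrier (free_module R B)" "v \<in> carrier (free_module R B)" "w \<in> carrier (free_module R B)"
    note c = this[THEN free_module_value]
    show "u \<oplus>\<^bsub>free_module R B\<^esub> v \<oplus>\<^bsub>free_module R B\<^esub> w
        = u \<oplus>\<^bsub>free_module R B\<^esub> (v \<oplus>\<^bsub>free_module R B\<^esub> w)"
      using c by (simp add: a_assoc)
  next
    fix u v assume "u \<in> carrier (free_module R B)" "v \<in> carrier (free_module R B)"
    note c = this[THEN free_module_value]
    show "u \<oplus>\<^bsub>free_module R B\<^esub> v = v \<oplus>\<^bsub>free_module R B\<^esub> u"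
      using c by (simp add: a_comm)
  next
    fix u assume u: "u \<in> carrier (free_module R B)"
    show "\<zero>\<^bsub>free_module R B\<^esub> \<oplus>\<^bsub>free_module R B\<^esub> u = u"
      using free_module_value[OF u] by simp
  qed (use plus in auto)
next
  fix c d u
  assume cd: "c \<in> carrier R" "d \<in> carrier R" and u: "u \<in> carrier (free_module R B)"
  show "(c \<oplus> d) \<odot>\<^bsub>free_module R B\<^esub> u = c \<odot>\<^bsub>free_module R B\<^esub> u \<oplus>\<^bsub>free_module R B\<^esub> d \<odot>\<^bsub>free_module R B\<^esub> u"
    "(c \<otimes> d) \<odot>\<^bsub>free_module R B\<^esub> u = c \<odot>\<^bsub>free_module R B\<^esub> (d \<odot>\<^bsub>free_module R B\<^esub> u)"
    using cd free_module_value[OF u] by (simp_all add: l_distr m_assoc)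
next
  fix c u v
  assume c: "c \<in> carrier R" and "u \<in> carrier (free_module R B)" "v \<in> carrier (free_module R B)"
  note uv = this(2,3)[THEN free_module_value]
  show "c \<odot>\<^bsub>free_module R B\<^esub> (u \<oplus>\<^bsub>free_module R B\<^esub> v) = c \<odot>\<^bsub>free_module R B\<^esub> u \<oplus>\<^bsub>free_module R B\<^esub> c \<odot>\<^bsub>free_module R B\<^esub> v"
    using c uv by (simp add: r_distr)
next
  fix u assume u: "u \<in> carrier (free_module R B)"
  show "\<one> \<odot>\<^bsub>free_module R B\<^esub> u = u"
    using free_module_value[OF u] by simp
next
  fix c u assume c: "c \<in> carrier R" and u: "u \<in> carrier (free_module R B)"
  have "{x. c \<otimes> u x \<noteq> \<zero>} \<subseteq> {x. u x \<noteq> \<zero>}" using c by auto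
  then show "c \<odot>\<^bsub>free_module R B\<^esub> u \<in> carrier (free_module R B)"
    using c u finite_subset by auto
qed (rule cring_axioms)

lemma single_closed [simp]: "x \<in> B \<Longrightarrow> single R x \<in> carrier (free_module R B)"
  by (auto simp: single_def)

lemma free_module_induct:
  assumes u: "u \<in> carrier (free_module R B)"
    and zero: "P \<zero>\<^bsub>free_module R B\<^esub>"
    and step: "\<And>u c x. \<lbrakk>u \<in> carrier (free_module R B); P u; c \<in> carrier R; x \<in> B\<rbrakk>
       \<Longrightarrow> P (u \<oplus>\<^bsub>free_module R B\<^esub> c \<odot>\<^bsub>free_module R B\<^esub> single R x)"
  shows "P u"
proof -
  have "finite {x. u x \<noteq> \<zero>}" using u by simp
  then show ?thesis using u
  proof (induction "{x. u x \<noteq> \<zero>}" arbitrary: u rule: finite_induct)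
    case empty
    then have "u = \<zero>\<^bsub>free_module R B\<^esub>" by (auto simp: fun_eq_iff)
    then show ?case using zero by simp
  next
    case (insert x S)
    let ?v = "u(x := \<zero>)"
    have xB: "x \<in> B" and ux: "u x \<in> carrier R"
      using insert.hyps(4) insert.prems by (auto intro: free_module_value)
    have S: "S = {y. ?v y \<noteq> \<zero>}"
      using insert.hyps(2,4) by auto
    have v: "?v \<in> carrier (free_module R B)"
      using insert.prems S insert.hyps(1) by auto
    have "u = ?v \<oplus>\<^bsub>free_module R B\<^esub> u x \<odot>\<^bsub>free_module R B\<^esub> single R x"
      using free_module_value[OF insert.prems] by (auto simp: fun_eq_iff single_def)
    then show ?case
      using step[OF v insert.hyps(3)[OF S v] ux xB] by simp
  qed
qed

lemma free_map_id: "u \<in> carrier (free_module R B) \<Longrightarrow> free_map R (\<lambda>x. x) u = u"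
proof
  fix y assume u: "u \<in> carrier (free_module R B)"
  show "free_map R (\<lambda>x. x) u y = u y"
  proof (cases "u y = \<zero>")
    case True
    then have eq: "{x. u x \<noteq> \<zero> \<and> x = y} = {}" by auto
    show ?thesis unfolding free_map_def eq using True by simp
  next
    case False
    then have eq: "{x. u x \<noteq> \<zero> \<and> x = y} = {y}" by auto
    show ?thesis unfolding free_map_def eq using free_module_value[OF u, of y] by simp
  qed
qed

text \<open>Replaces the support of \<open>u\<close>, which varies with \<open>u\<close>, by a fixed
  finite set, so that sums can be exchanged.\<close>

lemma free_map_eq_finsum:
  assumes S: "finite S" "{x. u x \<noteq> \<zero>} \<subseteq> S" and u: "\<And>x. x \<in> S \<Longrightarrow> u x \<in> carrier R"
  shows "free_map R \<phi> u y = (\<Oplus>x\<in>S. if \<phi> x = y then u x else \<zero>)"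
proof -
  have "free_map R \<phi> u y = finsum R (\<lambda>x. if \<phi> x = y then u x else \<zero>) {x. u x \<noteq> \<zero> \<and> \<phi> x = y}"
    unfolding free_map_def using S u by (intro finsum_congI) auto
  also have "\<dots> = (\<Oplus>x\<in>S. if \<phi> x = y then u x else \<zero>)"
    using S u by (intro finsum_mono_neutral) auto
  finally show ?thesis .
qed

lemma free_map_closed:
  assumes u: "u \<in> carrier (free_module R B)" and \<phi>: "\<And>x. x \<in> B \<Longrightarrow> \<phi> x \<in> B'"
  shows "free_map R \<phi> u \<in> carrier (free_module R B')"
    and "{y. free_map R \<phi> u y \<noteq> \<zero>} \<subseteq> \<phi> ` {x. u x \<noteq> \<zero>}"
proof -
  show sub: "{y. free_map R \<phi> u y \<noteq> \<zero>} \<subseteq> \<phi> ` {x. u x \<noteq> \<zero>}"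
  proof
    fix y assume "y \<in> {y. free_map R \<phi> u y \<noteq> \<zero>}"
    then have "{x. u x \<noteq> \<zero> \<and> \<phi> x = y} \<noteq> {}"
      unfolding free_map_def by (metis (mono_tags, lifting) finsum_empty mem_Collect_eq)
    then show "y \<in> \<phi> ` {x. u x \<noteq> \<zero>}" by auto
  qed
  have suppB: "x \<in> B" if "u x \<noteq> \<zero>" for x using u that by auto
  have "free_map R \<phi> u y = \<zero>" if "y \<notin> B'" for y
    using that sub suppB \<phi> by blast
  moreover have "free_map R \<phi> u y \<in> carrier R" for y
    unfolding free_map_def using free_module_value[OF u] by (intro finsum_closedI) auto
  moreover have "finite {y. free_map R \<phi> u y \<noteq> \<zero>}"
    using u by (intro finite_subset[OF sub]) simp
  ultimately show "free_map R \<phi> u \<in> carrier (free_module R B')" by simp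
qed

end

section \<open>Congruence modulo a submodule\<close>

context module begin

text \<open>Membership in the carrier is built in, so that chains of congruences need no side
  conditions.\<close>

definition mod_eq :: "'c set \<Rightarrow> 'c \<Rightarrow> 'c \<Rightarrow> bool" where
  "mod_eq J u v \<longleftrightarrow> u \<in> carrier M \<and> v \<in> carrier M \<and> u \<ominus>\<^bsub>M\<^esub> v \<in> J"

context
  fixes J assumes J: "submodule J R M"
begin

lemma mod_eq_refl: "u \<in> carrier M \<Longrightarrow> mod_eq J u u"
  using subgroup.one_closed[OF submodule.axioms(1)[OF J]] by (simp add: mod_eq_def M.minus_eq M.r_neg)

lemma mod_eq_sym: "mod_eq J u v \<Longrightarrow> mod_eq J v u"
proof -
  assume a: "mod_eq J u v"
  then have "\<ominus>\<^bsub>M\<^esub> (u \<ominus>\<^bsub>M\<^esub> v) \<in> J"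
    using submoduleE(3)[OF J] by (simp add: mod_eq_def)
  moreover have "\<ominus>\<^bsub>M\<^esub> (u \<ominus>\<^bsub>M\<^esub> v) = v \<ominus>\<^bsub>M\<^esub> u"
    using a by (simp add: mod_eq_def M.minus_eq M.minus_add M.a_comm[of "\<ominus>\<^bsub>M\<^esub> u" v])
  ultimately show ?thesis using a by (simp add: mod_eq_def)
qed

lemma mod_eq_trans: "mod_eq J u v \<Longrightarrow> mod_eq J v w \<Longrightarrow> mod_eq J u w"
proof -
  assume a: "mod_eq J u v" "mod_eq J v w"
  then have "(u \<ominus>\<^bsub>M\<^esub> v) \<oplus>\<^bsub>M\<^esub> (v \<ominus>\<^bsub>M\<^esub> w) \<in> J"
    using submoduleE(5)[OF J] by (auto simp: mod_eq_def)
  moreover have "(u \<ominus>\<^bsub>M\<^esub> v) \<oplus>\<^bsub>M\<^esub> (v \<ominus>\<^bsub>M\<^esub> w) = u \<ominus>\<^bsub>M\<^esub> w"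
    using a by (simp add: mod_eq_def M.minus_eq M.a_assoc M.r_neg1)
  ultimately show ?thesis using a by (simp add: mod_eq_def)
qed

lemma mod_eq_add: "mod_eq J u v \<Longrightarrow> mod_eq J u' v' \<Longrightarrow> mod_eq J (u \<oplus>\<^bsub>M\<^esub> u') (v \<oplus>\<^bsub>M\<^esub> v')"
proof -
  assume a: "mod_eq J u v" "mod_eq J u' v'"
  then have "(u \<ominus>\<^bsub>M\<^esub> v) \<oplus>\<^bsub>M\<^esub> (u' \<ominus>\<^bsub>M\<^esub> v') \<in> J"
    using submoduleE(5)[OF J] by (auto simp: mod_eq_def)
  moreover have "(u \<ominus>\<^bsub>M\<^esub> v) \<oplus>\<^bsub>M\<^esub> (u' \<ominus>\<^bsub>M\<^esub> v') = (u \<oplus>\<^bsub>M\<^esub> u') \<ominus>\<^bsub>M\<^esub> (v \<oplus>\<^bsub>M\<^esub> v')"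
    using a by (simp add: mod_eq_def M.minus_eq M.a_ac M.minus_add)
  ultimately show ?thesis using a by (simp add: mod_eq_def)
qed

lemma mod_eq_smult: "c \<in> carrier R \<Longrightarrow> mod_eq J u v \<Longrightarrow> mod_eq J (c \<odot>\<^bsub>M\<^esub> u) (c \<odot>\<^bsub>M\<^esub> v)"
proof -
  assume a: "c \<in> carrier R" "mod_eq J u v"
  then have "c \<odot>\<^bsub>M\<^esub> (u \<ominus>\<^bsub>M\<^esub> v) \<in> J"
    using submoduleE(4)[OF J] by (auto simp: mod_eq_def)
  moreover have "c \<odot>\<^bsub>M\<^esub> (u \<ominus>\<^bsub>M\<^esub> v) = c \<odot>\<^bsub>M\<^esub> u \<ominus>\<^bsub>M\<^esub> c \<odot>\<^bsub>M\<^esub> v"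
    using a by (simp add: mod_eq_def M.minus_eq smult_r_distr smult_r_minus)
  ultimately show ?thesis using a by (simp add: mod_eq_def)
qed

lemma mod_eq_finsum:
  assumes "finite A" "\<And>i. i \<in> A \<Longrightarrow> mod_eq J (f i) (g i)"
  shows "mod_eq J (finsum M f A) (finsum M g A)"
  using assms
proof (induction A)
  case empty
  then show ?case by (simp add: mod_eq_refl)
next
  case (insert a A)
  have c: "f i \<in> carrier M" "g i \<in> carrier M" if "i \<in> insert a A" for i
    using insert.prems[OF that] by (auto simp: mod_eq_def)
  have "finsum M f (insert a A) = f a \<oplus>\<^bsub>M\<^esub> finsum M f A"
    "finsum M g (insert a A) = g a \<oplus>\<^bsub>M\<^esub> finsum M g A"
    using insert.hyps c by (auto intro!: M.finsum_insert)
  then show ?case using mod_eq_add insert by simp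
qed

lemma coset_eq_iff_mod_eq:
  assumes "u \<in> carrier M" "v \<in> carrier M"
  shows "J +>\<^bsub>M\<^esub> u = J +>\<^bsub>M\<^esub> v \<longleftrightarrow> mod_eq J u v"
proof -
  have sub: "subgroup J (add_monoid M)" by (rule submodule.axioms(1)[OF J])
  have "J +>\<^bsub>M\<^esub> u = J +>\<^bsub>M\<^esub> v \<longleftrightarrow> u \<in> J +>\<^bsub>M\<^esub> v"
    unfolding a_r_coset_def
    using M.add.repr_independence[OF _ _ sub] M.add.rcos_self[OF _ sub] assms by fastforce
  also have "\<dots> \<longleftrightarrow> u \<ominus>\<^bsub>M\<^esub> v \<in> J"
  proof
    assume "u \<in> J +>\<^bsub>M\<^esub> v"
    then obtain j where "j \<in> J" "u = j \<oplus>\<^bsub>M\<^esub> v" by (auto simp: a_r_coset_def r_coset_def)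
    moreover then have "j \<in> carrier M" using submoduleE(1)[OF J] by blast
    ultimately show "u \<ominus>\<^bsub>M\<^esub> v \<in> J"
      using assms by (simp add: M.minus_eq M.a_assoc M.r_neg)
  next
    assume "u \<ominus>\<^bsub>M\<^esub> v \<in> J"
    moreover have "u = (u \<ominus>\<^bsub>M\<^esub> v) \<oplus>\<^bsub>M\<^esub> v"
      using assms by (simp add: M.minus_eq M.a_assoc M.l_neg)
    ultimately show "u \<in> J +>\<^bsub>M\<^esub> v" by (auto simp: a_r_coset_def r_coset_def)
  qed
  finally show ?thesis using assms by (simp add: mod_eq_def)
qed

lemma mem_coset_iff_mod_eq:
  assumes "v \<in> carrier M"
  shows "u \<in> J +>\<^bsub>M\<^esub> v \<longleftrightarrow> mod_eq J u v"
proof -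
  have sub: "subgroup J (add_monoid M)" by (rule submodule.axioms(1)[OF J])
  have "u \<in> J +>\<^bsub>M\<^esub> v \<Longrightarrow> u \<in> carrier M"
    using assms submoduleE(1)[OF J] by (auto simp: a_r_coset_def r_coset_def)
  moreover have "u \<in> J +>\<^bsub>M\<^esub> v \<longleftrightarrow> J +>\<^bsub>M\<^esub> u = J +>\<^bsub>M\<^esub> v" if "u \<in> carrier M"
    unfolding a_r_coset_def
    using M.add.repr_independence[OF _ _ sub] M.add.rcos_self[OF _ sub] assms that by fastforce
  ultimately show ?thesis
    using coset_eq_iff_mod_eq assms by (metis mod_eq_def)
qed

end

end

section \<open>Tensor products of modules of functions\<close>

text \<open>\<open>finsum\<close> depends on the whole record, so a sum formed in the subring is not
  literally the sum formed in R.\<close>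

lemma (in ring) finsum_subring:
  assumes K: "subring K R" and f: "\<And>i. i \<in> A \<Longrightarrow> f i \<in> K"
  shows "finsum (R\<lparr>carrier := K\<rparr>) f A = finsum R f A" "finsum R f A \<in> K"
proof -
  interpret K: ring "R\<lparr>carrier := K\<rparr>" by (rule subring_is_ring[OF K])
  have KR: "x \<in> carrier R" if "x \<in> K" for x using subringE(1)[OF K] that by blast
  have "finsum (R\<lparr>carrier := K\<rparr>) f A = finsum R f A \<and> finsum R f A \<in> K"
    using f
  proof (induction A rule: infinite_finite_induct)
    \<comment> \<open>Both sums are zero by convention.\<close>
    case (infinite A)
    then show ?case using K.finsum_infinite[of A f] finsum_infinite[of A f] subringE(2)[OF K] by simp
  next
    case empty
    then show ?case using K.finsum_empty[of f] finsum_empty[of f] subringE(2)[OF K] by simp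
  next
    case (insert a A)
    have "finsum R f (insert a A) = f a \<oplus> finsum R f A"
      using insert by (intro finsum_insert) (auto intro: KR)
    moreover have "finsum (R\<lparr>carrier := K\<rparr>) f (insert a A) = f a \<oplus> finsum (R\<lparr>carrier := K\<rparr>) f A"
      using insert K.finsum_insert[of A a f] by auto
    ultimately show ?case
      using insert subringE(7)[OF K] by simp
  qed
  then show "finsum (R\<lparr>carrier := K\<rparr>) f A = finsum R f A" "finsum R f A \<in> K" by auto
qed

lemma (in cring) subring_is_cring:
  assumes "subring K R"
  shows "cring (R\<lparr>carrier := K\<rparr>)"
  using subcring_iff[OF subringE(1)[OF assms]] subcringI'[OF assms] by simp

text \<open>
  The coefficient of \<open>(x, y)\<close> in the image of \<open>\<Sum> c (a \<otimes> b)\<close> under \<open>L\<^sup>M \<otimes> L\<^sup>M \<rightarrow> L\<^sup>M\<^sup>\<times>\<^sup>M\<close>.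
\<close>

definition tensor_coeff ::
  "('a, 'r) ring_scheme \<Rightarrow> (('m \<Rightarrow> 'a) \<times> ('m \<Rightarrow> 'a) \<Rightarrow> 'a) \<Rightarrow> 'm \<Rightarrow> 'm \<Rightarrow> 'a" where
  "tensor_coeff L u x y = (\<Oplus>\<^bsub>L\<^esub>ab\<in>{ab. u ab \<noteq> \<zero>\<^bsub>L\<^esub>}. u ab \<otimes>\<^bsub>L\<^esub> (fst ab x \<otimes>\<^bsub>L\<^esub> snd ab y))"

text \<open>
  The frame \<open>v = \<Sum> W\<^sub>i(v) h\<^sub>i\<close>, with \<open>W\<^sub>i(v) = \<Sum> W\<^sub>i(m) v(m)\<close> in \<open>K\<close>, plays the role of a \<open>K\<close>-basis of \<open>V\<close>
  with its dual basis. Both \<open>L[M]\<^sup>G\<close> over \<open>K\<close> and \<open>L[M]\<close> over \<open>L\<close> carry one.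
\<close>

locale framed_module = cring L
  for L :: "('a, 'l) ring_scheme" (structure) and K :: "'a set" and M :: "'m set"
    and V :: "('a, 'm \<Rightarrow> 'a, 'e) module_scheme" and I :: "'i set" and W h :: "'i \<Rightarrow> 'm \<Rightarrow> 'a" +
  assumes K_subring: "subring K L"
    and fin_M: "finite M" and fin_I: "finite I"
    and V_value: "v \<in> carrier V \<Longrightarrow> v m \<in> carrier L"
    and V_outside: "\<lbrakk>v \<in> carrier V; m \<notin> M\<rbrakk> \<Longrightarrow> v m = \<zero>"
    and V_add: "v \<oplus>\<^bsub>V\<^esub> w = (\<lambda>m. v m \<oplus> w m)"
    and V_smult: "c \<odot>\<^bsub>V\<^esub> v = (\<lambda>m. c \<otimes> v m)"
    and V_zero_closed: "(\<lambda>_. \<zero>) \<in> carrier V"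
    and V_add_closed: "\<lbrakk>v \<in> carrier V; w \<in> carrier V\<rbrakk> \<Longrightarrow> (\<lambda>m. v m \<oplus> w m) \<in> carrier V"
    and V_smult_closed: "\<lbrakk>c \<in> K; v \<in> carrier V\<rbrakk> \<Longrightarrow> (\<lambda>m. c \<otimes> v m) \<in> carrier V"
    and W_value: "\<lbrakk>i \<in> I; m \<in> M\<rbrakk> \<Longrightarrow> W i m \<in> carrier L"
    and h_closed: "i \<in> I \<Longrightarrow> h i \<in> carrier V"
    and W_pairing: "\<lbrakk>i \<in> I; v \<in> carrier V\<rbrakk> \<Longrightarrow> (\<Oplus>m\<in>M. W i m \<otimes> v m) \<in> K"
    and frame: "\<lbrakk>x \<in> M; y \<in> M\<rbrakk> \<Longrightarrow> (\<Oplus>i\<in>I. W i x \<otimes> h i y) = (if x = y then \<one> else \<zero>)"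
begin

abbreviation "R \<equiv> L\<lparr>carrier := K\<rparr>"
abbreviation "F \<equiv> free_module R (carrier V \<times> carrier V)"
abbreviation "J \<equiv> tensor_kernel R V V"

sublocale R: cring R
  by (rule subring_is_cring[OF K_subring])

sublocale F: module R F
  by (rule R.free_module_is_module)

lemma K_carrier [simp]: "x \<in> K \<Longrightarrow> x \<in> carrier L"
  using subringE(1)[OF K_subring] by blast

lemma F_value: "u \<in> carrier F \<Longrightarrow> u ab \<in> K"
  using R.free_module_value[of u "carrier V \<times> carrier V" ab] by simp

lemma F_finite: "u \<in> carrier F \<Longrightarrow> finite {ab. u ab \<noteq> \<zero>}"
  by simp

lemma F_supp: "u \<in> carrier F \<Longrightarrow> u ab \<noteq> \<zero> \<Longrightarrow> fst ab \<in> carrier V \<and> snd ab \<in> carrier V"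
  by (cases ab) auto

lemma single_F [simp]: "\<lbrakk>a \<in> carrier V; b \<in> carrier V\<rbrakk> \<Longrightarrow> single R (a, b) \<in> carrier F"
  by (rule R.single_closed) simp

section \<open>Linearity of the coefficients of a tensor\<close>

lemma tensor_coeff_superset:
  assumes u: "u \<in> carrier F" and S: "finite S" "{ab. u ab \<noteq> \<zero>} \<subseteq> S" "S \<subseteq> carrier V \<times> carrier V"
  shows "tensor_coeff L u x y = (\<Oplus>ab\<in>S. u ab \<otimes> (fst ab x \<otimes> snd ab y))"
  unfolding tensor_coeff_def
proof (rule finsum_mono_neutral[OF S(1,2)])
  fix ab assume "ab \<in> S - {ab. u ab \<noteq> \<zero>}"
  moreover then have "fst ab x \<in> carrier L" "snd ab y \<in> carrier L"
    using S(3) by (auto intro!: V_value)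
  ultimately show "u ab \<otimes> (fst ab x \<otimes> snd ab y) = \<zero>" by simp
next
  fix ab assume "ab \<in> {ab. u ab \<noteq> \<zero>}"
  then show "u ab \<otimes> (fst ab x \<otimes> snd ab y) \<in> carrier L"
    using F_supp[OF u] F_value[OF u] by (simp add: V_value)
qed

lemma tensor_coeff_closed:
  assumes u: "u \<in> carrier F"
  shows "tensor_coeff L u x y \<in> carrier L"
  unfolding tensor_coeff_def
  using F_supp[OF u] F_value[OF u] by (intro finsum_closedI) (simp add: V_value)

lemma tensor_coeff_add:
  assumes u: "u \<in> carrier F" and v: "v \<in> carrier F"
  shows "tensor_coeff L (u \<oplus>\<^bsub>F\<^esub> v) x y = tensor_coeff L u x y \<oplus> tensor_coeff L v x y"
proof -
  let ?S = "{ab. u ab \<noteq> \<zero>} \<union> {ab. v ab \<noteq> \<zero>}"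
  have S: "finite ?S" "?S \<subseteq> carrier V \<times> carrier V"
    using u v by auto
  have uv: "u \<oplus>\<^bsub>F\<^esub> v \<in> carrier F" using u v by (rule F.M.a_closed)
  have supp: "{ab. (u \<oplus>\<^bsub>F\<^esub> v) ab \<noteq> \<zero>} \<subseteq> ?S" by auto
  have c: "u ab \<in> carrier L" "v ab \<in> carrier L" for ab
    using F_value[OF u] F_value[OF v] by auto
  have ab: "fst ab x \<in> carrier L" "snd ab y \<in> carrier L" if "ab \<in> ?S" for ab
    using that S(2) by (auto intro!: V_value)
  have "tensor_coeff L (u \<oplus>\<^bsub>F\<^esub> v) x y = (\<Oplus>ab\<in>?S. (u \<oplus>\<^bsub>F\<^esub> v) ab \<otimes> (fst ab x \<otimes> snd ab y))"
    by (rule tensor_coeff_superset[OF uv S(1) supp S(2)])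
  also have "\<dots> = (\<Oplus>ab\<in>?S. u ab \<otimes> (fst ab x \<otimes> snd ab y) \<oplus> v ab \<otimes> (fst ab x \<otimes> snd ab y))"
    using c ab by (intro finsum_congI) (auto simp: l_distr)
  also have "\<dots> = (\<Oplus>ab\<in>?S. u ab \<otimes> (fst ab x \<otimes> snd ab y)) \<oplus> (\<Oplus>ab\<in>?S. v ab \<otimes> (fst ab x \<otimes> snd ab y))"
    using c ab by (intro finsum_add) auto
  also have "\<dots> = tensor_coeff L u x y \<oplus> tensor_coeff L v x y"
    using S tensor_coeff_superset[OF u S(1) _ S(2)] tensor_coeff_superset[OF v S(1) _ S(2)] by simp
  finally show ?thesis .
qed

lemma tensor_coeff_smult:
  assumes u: "u \<in> carrier F" and c: "c \<in> K"
  shows "tensor_coeff L (c \<odot>\<^bsub>F\<^esub> u) x y = c \<otimes> tensor_coeff L u x y"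
proof -
  let ?S = "{ab. u ab \<noteq> \<zero>}"
  have S: "finite ?S" "?S \<subseteq> carrier V \<times> carrier V" using u by auto
  have uv: "c \<odot>\<^bsub>F\<^esub> u \<in> carrier F" using u c F.smult_closed by simp
  have supp: "{ab. (c \<odot>\<^bsub>F\<^esub> u) ab \<noteq> \<zero>} \<subseteq> ?S" using c by auto
  have uc: "u ab \<in> carrier L" for ab
    using F_value[OF u] by auto
  have ab: "fst ab x \<in> carrier L" "snd ab y \<in> carrier L" if "ab \<in> ?S" for ab
    using that S(2) by (auto intro!: V_value)
  have "tensor_coeff L (c \<odot>\<^bsub>F\<^esub> u) x y = (\<Oplus>ab\<in>?S. (c \<odot>\<^bsub>F\<^esub> u) ab \<otimes> (fst ab x \<otimes> snd ab y))"
    by (rule tensor_coeff_superset[OF uv S(1) supp S(2)])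
  also have "\<dots> = (\<Oplus>ab\<in>?S. c \<otimes> (u ab \<otimes> (fst ab x \<otimes> snd ab y)))"
    using uc c ab by (intro finsum_congI) (auto simp: m_assoc)
  also have "\<dots> = c \<otimes> tensor_coeff L u x y"
    unfolding tensor_coeff_def using S(1) c uc ab by (intro finsum_distrib_left[symmetric]) auto
  finally show ?thesis .
qed

lemma tensor_coeff_single:
  assumes "a \<in> carrier V" "b \<in> carrier V"
  shows "tensor_coeff L (single R (a, b)) x y = a x \<otimes> b y"
proof -
  have "tensor_coeff L (single R (a, b)) x y
      = (\<Oplus>ab\<in>{(a, b)}. single R (a, b) ab \<otimes> (fst ab x \<otimes> snd ab y))"
    using assms by (intro tensor_coeff_superset single_F) (auto simp: single_def)
  then show ?thesis
    using assms V_value by (simp add: single_def)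
qed

lemma tensor_coeff_zero: "tensor_coeff L \<zero>\<^bsub>F\<^esub> x y = \<zero>"
  unfolding tensor_coeff_def by (rule finsum_eq_zeroI) simp

lemma tensor_coeff_minus:
  assumes u: "u \<in> carrier F" and v: "v \<in> carrier F"
  shows "tensor_coeff L (u \<ominus>\<^bsub>F\<^esub> v) x y = \<zero> \<longleftrightarrow> tensor_coeff L u x y = tensor_coeff L v x y"
proof -
  have w: "u \<ominus>\<^bsub>F\<^esub> v \<in> carrier F" using u v by (rule F.M.minus_closed)
  have "(u \<ominus>\<^bsub>F\<^esub> v) \<oplus>\<^bsub>F\<^esub> v = u"
    unfolding F.M.minus_eq
    by (simp only: F.M.a_assoc[OF u F.M.a_inv_closed[OF v] v] F.M.l_neg[OF v] F.M.r_zero[OF u])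
  then have "tensor_coeff L u x y = tensor_coeff L (u \<ominus>\<^bsub>F\<^esub> v) x y \<oplus> tensor_coeff L v x y"
    using tensor_coeff_add[OF w v] by simp
  then show ?thesis
    using tensor_coeff_closed[OF w, of x y] tensor_coeff_closed[OF v, of x y]
    by (auto simp: add.r_cancel_one)
qed

section \<open>The submodule of bilinearity relations\<close>

lemma bilinear_relations_F: "bilinear_relations R V V \<subseteq> carrier F"
proof -
  have sm: "c \<odot>\<^bsub>F\<^esub> u \<in> carrier F" if "c \<in> K" "u \<in> carrier F" for c u
    using F.smult_closed[of c u] that by simp
  show ?thesis
    unfolding bilinear_relations_def Let_def V_add V_smult
    by (auto intro!: F.M.minus_closed F.M.a_closed sm single_F V_add_closed V_smult_closed
        simp del: free_module_sel simp: partial_object.simps)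
qed

lemma J_submodule: "submodule J R F"
proof (rule F.submoduleI)
  let ?S = "{S. submodule S R F \<and> bilinear_relations R V V \<subseteq> S}"
  \<comment> \<open>The family is nonempty; an empty intersection would be
    \<open>UNIV\<close>.\<close>
  have car: "carrier F \<in> ?S"
    using F.carrier_is_submodule bilinear_relations_F by blast
  then show "J \<subseteq> carrier F" unfolding tensor_kernel_def by blast
  show "\<zero>\<^bsub>F\<^esub> \<in> J"
    unfolding tensor_kernel_def
    using subgroup.one_closed[OF submodule.axioms(1)] by fastforce
  show "\<ominus>\<^bsub>F\<^esub> a \<in> J" if "a \<in> J" for a
    using that F.submoduleE(3) unfolding tensor_kernel_def by blast
  show "a \<oplus>\<^bsub>F\<^esub> b \<in> J" if "a \<in> J" "b \<in> J" for a b
    using that F.submoduleE(5) unfolding tensor_kernel_def by blast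
  show "c \<odot>\<^bsub>F\<^esub> a \<in> J" if "c \<in> carrier R" "a \<in> J" for a c
    using that F.submoduleE(4) unfolding tensor_kernel_def by blast
qed

lemma relations_J: "bilinear_relations R V V \<subseteq> J"
  unfolding tensor_kernel_def by blast

text \<open>The coefficient at (x, y) is linear and kills the bilinearity relations, so its kernel
  is one of the submodules intersected in \<open>J\<close>. Thus coefficients are well defined on
  the tensor product.\<close>

lemma J_tensor_coeff:
  assumes "u \<in> J" shows "tensor_coeff L u x y = \<zero>"
proof -
  let ?Z = "{u \<in> carrier F. tensor_coeff L u x y = \<zero>}"
  have "submodule ?Z R F"
  proof (rule F.submoduleI)
    show "\<zero>\<^bsub>F\<^esub> \<in> ?Z" using tensor_coeff_zero F.M.zero_closed by blast
    show "\<ominus>\<^bsub>F\<^esub> a \<in> ?Z" if "a \<in> ?Z" for a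
    proof -
      have a: "a \<in> carrier F" "tensor_coeff L a x y = \<zero>" using that by auto
      have "tensor_coeff L (\<zero>\<^bsub>F\<^esub> \<ominus>\<^bsub>F\<^esub> a) x y = \<zero>"
        using tensor_coeff_minus[OF F.M.zero_closed a(1)] a(2) tensor_coeff_zero by simp
      moreover have "\<zero>\<^bsub>F\<^esub> \<ominus>\<^bsub>F\<^esub> a = \<ominus>\<^bsub>F\<^esub> a"
        unfolding F.M.minus_eq by (rule F.M.l_zero[OF F.M.a_inv_closed[OF a(1)]])
      ultimately show ?thesis using F.M.a_inv_closed[OF a(1)] by simp
    qed
    show "a \<oplus>\<^bsub>F\<^esub> b \<in> ?Z" if "a \<in> ?Z" "b \<in> ?Z" for a b
      using that tensor_coeff_add[of a b x y] F.M.a_closed[of a b] by simp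
    show "c \<odot>\<^bsub>F\<^esub> a \<in> ?Z" if "c \<in> carrier R" "a \<in> ?Z" for a c
      using that tensor_coeff_smult[of a c x y] F.smult_closed[of c a] by simp
  qed blast
  moreover have "bilinear_relations R V V \<subseteq> ?Z"
  proof
    fix \<rho> assume \<rho>: "\<rho> \<in> bilinear_relations R V V"
    have sm: "c \<odot>\<^bsub>F\<^esub> u \<in> carrier F" if "c \<in> K" "u \<in> carrier F" for c u
      using F.smult_closed[of c u] that by simp
    note s = single_F V_add_closed V_smult_closed V_value F.M.a_closed sm
    have "tensor_coeff L \<rho> x y = \<zero>"
      using \<rho> unfolding bilinear_relations_def Let_def V_add V_smult
    proof (elim UnE CollectE exE conjE)
      fix v v' w assume "v \<in> carrier V" "v' \<in> carrier V" "w \<in> carrier V"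
        and \<rho>: "\<rho> = single R (\<lambda>m. v m \<oplus> v' m, w) \<ominus>\<^bsub>F\<^esub> (single R (v, w) \<oplus>\<^bsub>F\<^esub> single R (v', w))"
      then show ?thesis
        unfolding \<rho> by (subst tensor_coeff_minus)
          (simp_all add: s tensor_coeff_add tensor_coeff_single l_distr del: free_module_sel)
    next
      fix v w w' assume "v \<in> carrier V" "w' \<in> carrier V" "w \<in> carrier V"
        and \<rho>: "\<rho> = single R (v, \<lambda>m. w m \<oplus> w' m) \<ominus>\<^bsub>F\<^esub> (single R (v, w) \<oplus>\<^bsub>F\<^esub> single R (v, w'))"
      then show ?thesis
        unfolding \<rho> by (subst tensor_coeff_minus)
          (simp_all add: s tensor_coeff_add tensor_coeff_single r_distr del: free_module_sel)
    next
      fix c v w assume "c \<in> carrier R" "v \<in> carrier V" "w \<in> carrier V"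
        and \<rho>: "\<rho> = single R (\<lambda>m. c \<otimes> v m, w) \<ominus>\<^bsub>F\<^esub> (c \<odot>\<^bsub>F\<^esub> single R (v, w))"
      then show ?thesis
        unfolding \<rho> by (subst tensor_coeff_minus)
          (simp_all add: s tensor_coeff_smult tensor_coeff_single m_assoc del: free_module_sel)
    next
      fix c v w assume "c \<in> carrier R" "v \<in> carrier V" "w \<in> carrier V"
        and \<rho>: "\<rho> = single R (v, \<lambda>m. c \<otimes> w m) \<ominus>\<^bsub>F\<^esub> (c \<odot>\<^bsub>F\<^esub> single R (v, w))"
      then show ?thesis
        unfolding \<rho> by (subst tensor_coeff_minus)
          (simp_all add: s tensor_coeff_smult tensor_coeff_single m_lcomm del: free_module_sel)
    qed
    then show "\<rho> \<in> ?Z" using \<rho> bilinear_relations_F by blast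
  qed
  ultimately have "J \<subseteq> ?Z" unfolding tensor_kernel_def by blast
  then show ?thesis using assms by blast
qed

section \<open>Expansion in the frame\<close>

definition frame_coeff :: "'i \<Rightarrow> ('m \<Rightarrow> 'a) \<Rightarrow> 'a" where
  "frame_coeff i v = (\<Oplus>m\<in>M. W i m \<otimes> v m)"

lemma frame_coeff_K: "\<lbrakk>i \<in> I; v \<in> carrier V\<rbrakk> \<Longrightarrow> frame_coeff i v \<in> K"
  unfolding frame_coeff_def by (rule W_pairing)

text \<open>After exchanging the sums the frame identity acts as a Kronecker delta. It is stated for
  any function into L, as \<open>exists_comult_repr\<close> applies it to a product
  \<open>W j m \<otimes> v m\<close> with arbitrary L-valued v.\<close>

lemma frame_sum:
  assumes w: "\<And>m. m \<in> M \<Longrightarrow> w m \<in> carrier L" and y: "y \<in> M"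
  shows "(\<Oplus>i\<in>I. (\<Oplus>m\<in>M. W i m \<otimes> w m) \<otimes> h i y) = w y"
proof -
  have hy: "h i y \<in> carrier L" if "i \<in> I" for i using V_value[OF h_closed[OF that]] .
  have "(\<Oplus>i\<in>I. (\<Oplus>m\<in>M. W i m \<otimes> w m) \<otimes> h i y) = (\<Oplus>i\<in>I. \<Oplus>m\<in>M. W i m \<otimes> h i y \<otimes> w m)"
  proof (rule finsum_congI)
    fix i assume i: "i \<in> I"
    have "(\<Oplus>m\<in>M. W i m \<otimes> w m) \<otimes> h i y = (\<Oplus>m\<in>M. W i m \<otimes> w m \<otimes> h i y)"
      using w hy fin_M W_value i by (intro finsum_distrib_right) auto
    also have "\<dots> = (\<Oplus>m\<in>M. W i m \<otimes> h i y \<otimes> w m)"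
      using w hy W_value i by (intro finsum_congI) (auto simp: m_ac)
    finally show "(\<Oplus>m\<in>M. W i m \<otimes> w m) \<otimes> h i y = (\<Oplus>m\<in>M. W i m \<otimes> h i y \<otimes> w m)" .
  qed (use w hy W_value in \<open>auto intro!: finsum_closedI\<close>)
  also have "\<dots> = (\<Oplus>m\<in>M. \<Oplus>i\<in>I. W i m \<otimes> h i y \<otimes> w m)"
    using w hy fin_M fin_I W_value by (intro finsum_swap) auto
  also have "\<dots> = (\<Oplus>m\<in>M. if m = y then w m else \<zero>)"
  proof (rule finsum_congI)
    fix m assume m: "m \<in> M"
    have "(\<Oplus>i\<in>I. W i m \<otimes> h i y \<otimes> w m) = (\<Oplus>i\<in>I. W i m \<otimes> h i y) \<otimes> w m"
      using w hy fin_I W_value m by (intro finsum_distrib_right[symmetric]) auto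
    then show "(\<Oplus>i\<in>I. W i m \<otimes> h i y \<otimes> w m) = (if m = y then w m else \<zero>)"
      using frame[OF m y] w[OF m] w[OF y] by simp
  qed (use w in auto)
  also have "\<dots> = w y"
    using w y fin_M by (subst finsum_delta) auto
  finally show ?thesis .
qed

lemma frame_expansion:
  assumes v: "v \<in> carrier V"
  shows "(\<lambda>m. \<Oplus>i\<in>I. frame_coeff i v \<otimes> h i m) = v"
proof
  fix y
  show "(\<Oplus>i\<in>I. frame_coeff i v \<otimes> h i y) = v y"
  proof (cases "y \<in> M")
    case True
    then show ?thesis unfolding frame_coeff_def using frame_sum[of v y] V_value[OF v] by blast
  next
    case False
    have "frame_coeff i v \<otimes> h i y = \<zero>" if "i \<in> I" for i
      using V_outside[OF h_closed[OF that] False] frame_coeff_K[OF that v] by simp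
    then show ?thesis using V_outside[OF v False] by (simp add: finsum_eq_zeroI)
  qed
qed

lemma combination_closed:
  assumes "finite A" "\<And>i. i \<in> A \<Longrightarrow> c i \<in> K" "\<And>i. i \<in> A \<Longrightarrow> f i \<in> carrier V"
  shows "(\<lambda>m. \<Oplus>i\<in>A. c i \<otimes> f i m) \<in> carrier V"
  using assms
proof (induction A)
  case (insert a A)
  have "(\<lambda>m. \<Oplus>i\<in>insert a A. c i \<otimes> f i m) = (\<lambda>m. c a \<otimes> f a m \<oplus> (\<Oplus>i\<in>A. c i \<otimes> f i m))"
    using insert by (intro ext finsum_insert) (auto simp: V_value)
  then show ?case using V_add_closed[OF V_smult_closed] insert by simp
next
  case empty
  show ?case using V_zero_closed by (simp only: finsum_empty)
qed

lemma additive_combination: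
  assumes add: "\<And>v w. \<lbrakk>v \<in> carrier V; w \<in> carrier V\<rbrakk> \<Longrightarrow> \<psi> (\<lambda>m. v m \<oplus> w m) = \<psi> v \<oplus> \<psi> w"
    and smult: "\<And>c v. \<lbrakk>c \<in> K; v \<in> carrier V\<rbrakk> \<Longrightarrow> \<psi> (\<lambda>m. c \<otimes> v m) = c \<otimes> \<psi> v"
    and closed: "\<And>v. v \<in> carrier V \<Longrightarrow> \<psi> v \<in> carrier L"
    and A: "finite A" "\<And>i. i \<in> A \<Longrightarrow> c i \<in> K" "\<And>i. i \<in> A \<Longrightarrow> f i \<in> carrier V"
  shows "\<psi> (\<lambda>m. \<Oplus>i\<in>A. c i \<otimes> f i m) = (\<Oplus>i\<in>A. c i \<otimes> \<psi> (f i))"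
  using A
proof (induction A)
  case empty
  have "\<psi> (\<lambda>m. \<zero> \<otimes> \<zero>) = \<zero> \<otimes> \<psi> (\<lambda>_. \<zero>)"
    using smult[of \<zero> "\<lambda>_. \<zero>"] V_zero_closed subringE(2)[OF K_subring] by simp
  then show ?case using closed[OF V_zero_closed] by simp
next
  case (insert a A)
  have "(\<lambda>m. \<Oplus>i\<in>insert a A. c i \<otimes> f i m) = (\<lambda>m. c a \<otimes> f a m \<oplus> (\<Oplus>i\<in>A. c i \<otimes> f i m))"
    using insert by (intro ext finsum_insert) (auto simp: V_value)
  moreover have "(\<Oplus>i\<in>insert a A. c i \<otimes> \<psi> (f i)) = c a \<otimes> \<psi> (f a) \<oplus> (\<Oplus>i\<in>A. c i \<otimes> \<psi> (f i))"
    using insert closed by (intro finsum_insert) auto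
  ultimately show ?case
    using insert add[OF V_smult_closed combination_closed, of "c a" "f a" A c f] smult[of "c a" "f a"] by simp
qed

text \<open>This is the L-linear extension of a K-linear functional \<psi>: expand v in the frame,
  pull the coefficients, which lie in K, out of \<psi>, and collect the factors of each
  v(m).\<close>

lemma linear_functional_repr:
  assumes add: "\<And>v w. \<lbrakk>v \<in> carrier V; w \<in> carrier V\<rbrakk> \<Longrightarrow> \<psi> (\<lambda>m. v m \<oplus> w m) = \<psi> v \<oplus> \<psi> w"
    and smult: "\<And>c v. \<lbrakk>c \<in> K; v \<in> carrier V\<rbrakk> \<Longrightarrow> \<psi> (\<lambda>m. c \<otimes> v m) = c \<otimes> \<psi> v"
    and closed: "\<And>v. v \<in> carrier V \<Longrightarrow> \<psi> v \<in> carrier L"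
    and v: "v \<in> carrier V"
  shows "\<psi> v = (\<Oplus>m\<in>M. v m \<otimes> (\<Oplus>i\<in>I. W i m \<otimes> \<psi> (h i)))"
proof -
  have ph: "\<psi> (h i) \<in> carrier L" if "i \<in> I" for i using closed h_closed that by blast
  have vm: "v m \<in> carrier L" for m by (rule V_value[OF v])
  have "\<psi> v = \<psi> (\<lambda>m. \<Oplus>i\<in>I. frame_coeff i v \<otimes> h i m)"
    using frame_expansion[OF v] by simp
  also have "\<dots> = (\<Oplus>i\<in>I. frame_coeff i v \<otimes> \<psi> (h i))"
    using frame_coeff_K v h_closed fin_I by (intro additive_combination add smult closed) auto
  also have "\<dots> = (\<Oplus>i\<in>I. \<Oplus>m\<in>M. v m \<otimes> (W i m \<otimes> \<psi> (h i)))"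
  proof (rule finsum_congI)
    fix i assume i: "i \<in> I"
    have "frame_coeff i v \<otimes> \<psi> (h i) = (\<Oplus>m\<in>M. W i m \<otimes> v m \<otimes> \<psi> (h i))"
      unfolding frame_coeff_def using ph vm fin_M W_value i by (intro finsum_distrib_right) auto
    also have "\<dots> = (\<Oplus>m\<in>M. v m \<otimes> (W i m \<otimes> \<psi> (h i)))"
      using ph vm W_value i by (intro finsum_congI) (auto simp: m_ac)
    finally show "frame_coeff i v \<otimes> \<psi> (h i) = (\<Oplus>m\<in>M. v m \<otimes> (W i m \<otimes> \<psi> (h i)))" .
  qed (use ph vm W_value in \<open>auto intro!: finsum_closedI\<close>)
  also have "\<dots> = (\<Oplus>m\<in>M. \<Oplus>i\<in>I. v m \<otimes> (W i m \<otimes> \<psi> (h i)))"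
    using ph vm W_value fin_M fin_I by (intro finsum_swap) auto
  also have "\<dots> = (\<Oplus>m\<in>M. v m \<otimes> (\<Oplus>i\<in>I. W i m \<otimes> \<psi> (h i)))"
    using ph vm W_value fin_I by (intro finsum_congI) (auto simp: finsum_distrib_left intro!: finsum_closedI)
  finally show ?thesis .
qed

abbreviation equiv_J (infix \<open>\<approx>\<^sub>J\<close> 50) where "u \<approx>\<^sub>J v \<equiv> F.mod_eq J u v"

lemma relation_equiv:
  assumes "u \<ominus>\<^bsub>F\<^esub> v \<in> bilinear_relations R V V" "u \<in> carrier F" "v \<in> carrier F"
  shows "u \<approx>\<^sub>J v"
  unfolding F.mod_eq_def by (intro conjI assms(2,3) subsetD[OF relations_J assms(1)])

text \<open>\<open>S\<close> stands for \<open>single\<close> with one slot fixed, which is linear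
  only modulo \<open>J\<close>; the abstract form serves both slots.\<close>

lemma combination_mod_J:
  assumes S: "\<And>v. v \<in> carrier V \<Longrightarrow> S v \<in> carrier F"
    and add: "\<And>v w. \<lbrakk>v \<in> carrier V; w \<in> carrier V\<rbrakk> \<Longrightarrow> S (v \<oplus>\<^bsub>V\<^esub> w) \<approx>\<^sub>J S v \<oplus>\<^bsub>F\<^esub> S w"
    and smult: "\<And>c v. \<lbrakk>c \<in> K; v \<in> carrier V\<rbrakk> \<Longrightarrow> S (c \<odot>\<^bsub>V\<^esub> v) \<approx>\<^sub>J c \<odot>\<^bsub>F\<^esub> S v"
    and A: "finite A" "\<And>i. i \<in> A \<Longrightarrow> c i \<in> K" "\<And>i. i \<in> A \<Longrightarrow> f i \<in> carrier V"
  shows "S (\<lambda>m. \<Oplus>i\<in>A. c i \<otimes> f i m) \<approx>\<^sub>J (\<Oplus>\<^bsub>F\<^esub>i\<in>A. c i \<odot>\<^bsub>F\<^esub> S (f i))"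
  using A
proof (induction A)
  case empty
  let ?z = "\<lambda>_::'m. \<zero>"
  \<comment> \<open>The empty combination is the zero function, written as 0 times itself so that
    \<open>smult\<close> applies.\<close>
  have z: "\<zero> \<in> K" using subringE(2)[OF K_subring] .
  have "\<zero> \<odot>\<^bsub>F\<^esub> S ?z = \<zero>\<^bsub>F\<^esub>"
    using F.smult_l_null[OF S[OF V_zero_closed]] by (simp del: free_module_sel)
  moreover have "\<zero> \<odot>\<^bsub>V\<^esub> ?z = (\<lambda>m. \<Oplus>i\<in>{}. c i \<otimes> f i m)"
    unfolding V_smult by simp
  ultimately show ?case
    using smult[OF z V_zero_closed] F.M.finsum_empty by (simp del: free_module_sel)
next
  case (insert a A)
  let ?r = "\<lambda>m. \<Oplus>i\<in>A. c i \<otimes> f i m"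
  have cf: "c a \<in> K" "f a \<in> carrier V" using insert.prems by auto
  have r: "?r \<in> carrier V" using insert by (intro combination_closed) auto
  have caf: "c a \<odot>\<^bsub>V\<^esub> f a \<in> carrier V" unfolding V_smult using cf by (rule V_smult_closed)
  have eq: "(\<lambda>m. \<Oplus>i\<in>insert a A. c i \<otimes> f i m) = (c a \<odot>\<^bsub>V\<^esub> f a) \<oplus>\<^bsub>V\<^esub> ?r"
    unfolding V_add V_smult using insert by (intro ext finsum_insert) (auto simp: V_value)
  have sm: "d \<odot>\<^bsub>F\<^esub> S g \<in> carrier F" if "d \<in> K" "g \<in> carrier V" for d g
    using F.smult_closed[of d] S[OF that(2)] that(1) by (simp del: free_module_sel)
  have "S ?r \<approx>\<^sub>J (\<Oplus>\<^bsub>F\<^esub>i\<in>A. c i \<odot>\<^bsub>F\<^esub> S (f i))"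
    using insert by simp
  then have "S ((c a \<odot>\<^bsub>V\<^esub> f a) \<oplus>\<^bsub>V\<^esub> ?r)
      \<approx>\<^sub>J c a \<odot>\<^bsub>F\<^esub> S (f a) \<oplus>\<^bsub>F\<^esub> (\<Oplus>\<^bsub>F\<^esub>i\<in>A. c i \<odot>\<^bsub>F\<^esub> S (f i))"
    by (rule F.mod_eq_trans[OF J_submodule add[OF caf r] F.mod_eq_add[OF J_submodule smult[OF cf]]])
  moreover have "(\<Oplus>\<^bsub>F\<^esub>i\<in>insert a A. c i \<odot>\<^bsub>F\<^esub> S (f i))
      = c a \<odot>\<^bsub>F\<^esub> S (f a) \<oplus>\<^bsub>F\<^esub> (\<Oplus>\<^bsub>F\<^esub>i\<in>A. c i \<odot>\<^bsub>F\<^esub> S (f i))"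
    using insert.hyps insert.prems by (intro F.M.finsum_insert) (auto intro!: sm simp del: free_module_sel)
  ultimately show ?case unfolding eq by (simp only:)
qed

lemma single_add_left:
  assumes "v \<in> carrier V" "w \<in> carrier V" "b \<in> carrier V"
  shows "single R (v \<oplus>\<^bsub>V\<^esub> w, b) \<approx>\<^sub>J single R (v, b) \<oplus>\<^bsub>F\<^esub> single R (w, b)"
proof (rule relation_equiv)
  show "single R (v \<oplus>\<^bsub>V\<^esub> w, b) \<ominus>\<^bsub>F\<^esub> (single R (v, b) \<oplus>\<^bsub>F\<^esub> single R (w, b)) \<in> bilinear_relations R V V"
    unfolding bilinear_relations_def Let_def using assms by blast
qed (use assms in \<open>auto intro!: F.M.a_closed single_F V_add_closed simp: V_add simp del: free_module_sel\<close>)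

lemma single_add_right:
  assumes "v \<in> carrier V" "w \<in> carrier V" "b \<in> carrier V"
  shows "single R (b, v \<oplus>\<^bsub>V\<^esub> w) \<approx>\<^sub>J single R (b, v) \<oplus>\<^bsub>F\<^esub> single R (b, w)"
proof (rule relation_equiv)
  show "single R (b, v \<oplus>\<^bsub>V\<^esub> w) \<ominus>\<^bsub>F\<^esub> (single R (b, v) \<oplus>\<^bsub>F\<^esub> single R (b, w)) \<in> bilinear_relations R V V"
    unfolding bilinear_relations_def Let_def using assms by blast
qed (use assms in \<open>auto intro!: F.M.a_closed single_F V_add_closed simp: V_add simp del: free_module_sel\<close>)

lemma single_smult_left:
  assumes c: "c \<in> K" and "v \<in> carrier V" "b \<in> carrier V"
  shows "single R (c \<odot>\<^bsub>V\<^esub> v, b) \<approx>\<^sub>J c \<odot>\<^bsub>F\<^esub> single R (v, b)"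
proof (rule relation_equiv)
  have c': "c \<in> carrier R" using c by simp
  show "single R (c \<odot>\<^bsub>V\<^esub> v, b) \<ominus>\<^bsub>F\<^esub> c \<odot>\<^bsub>F\<^esub> single R (v, b) \<in> bilinear_relations R V V"
    unfolding bilinear_relations_def Let_def using c' assms(2,3) by blast
  show "c \<odot>\<^bsub>F\<^esub> single R (v, b) \<in> carrier F"
    by (rule F.smult_closed[OF c' single_F[OF assms(2,3)]])
  show "single R (c \<odot>\<^bsub>V\<^esub> v, b) \<in> carrier F"
    unfolding V_smult by (rule single_F[OF V_smult_closed[OF assms(1,2)] assms(3)])
qed

lemma single_smult_right:
  assumes c: "c \<in> K" and "v \<in> carrier V" "b \<in> carrier V"
  shows "single R (b, c \<odot>\<^bsub>V\<^esub> v) \<approx>\<^sub>J c \<odot>\<^bsub>F\<^esub> single R (b, v)"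
proof (rule relation_equiv)
  have c': "c \<in> carrier R" using c by simp
  show "single R (b, c \<odot>\<^bsub>V\<^esub> v) \<ominus>\<^bsub>F\<^esub> c \<odot>\<^bsub>F\<^esub> single R (b, v) \<in> bilinear_relations R V V"
    unfolding bilinear_relations_def Let_def using c' assms(2,3) by blast
  show "c \<odot>\<^bsub>F\<^esub> single R (b, v) \<in> carrier F"
    by (rule F.smult_closed[OF c' single_F[OF assms(3,2)]])
  show "single R (b, c \<odot>\<^bsub>V\<^esub> v) \<in> carrier F"
    unfolding V_smult by (rule single_F[OF assms(3) V_smult_closed[OF assms(1,2)]])
qed

text \<open>The coordinate at h_i \<otimes> h_j, obtained by pairing with W_i and W_j. It is read
  off from \<open>tensor_coeff\<close>, so tensors with equal coefficients have equal
  coordinates.\<close>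

definition tensor_frame_coeff :: "(('m \<Rightarrow> 'a) \<times> ('m \<Rightarrow> 'a) \<Rightarrow> 'a) \<Rightarrow> 'i \<times> 'i \<Rightarrow> 'a" where
  "tensor_frame_coeff u ij = (\<Oplus>x\<in>M. \<Oplus>y\<in>M. W (fst ij) x \<otimes> W (snd ij) y \<otimes> tensor_coeff L u x y)"

lemma tensor_frame_coeff_add:
  assumes u: "u \<in> carrier F" and v: "v \<in> carrier F" and ij: "ij \<in> I \<times> I"
  shows "tensor_frame_coeff (u \<oplus>\<^bsub>F\<^esub> v) ij = tensor_frame_coeff u ij \<oplus> tensor_frame_coeff v ij"
proof -
  have w: "W (fst ij) m \<in> carrier L" "W (snd ij) m \<in> carrier L" if "m \<in> M" for m
    using ij W_value that by auto
  note c = tensor_coeff_closed[OF u] tensor_coeff_closed[OF v]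
  have "tensor_frame_coeff (u \<oplus>\<^bsub>F\<^esub> v) ij = (\<Oplus>x\<in>M. \<Oplus>y\<in>M.
      W (fst ij) x \<otimes> W (snd ij) y \<otimes> tensor_coeff L u x y \<oplus> W (fst ij) x \<otimes> W (snd ij) y \<otimes> tensor_coeff L v x y)"
    unfolding tensor_frame_coeff_def using w c
    by (intro finsum_congI finsum_closedI) (simp_all add: tensor_coeff_add[OF u v] r_distr del: free_module_sel)
  also have "\<dots> = (\<Oplus>x\<in>M. (\<Oplus>y\<in>M. W (fst ij) x \<otimes> W (snd ij) y \<otimes> tensor_coeff L u x y)
      \<oplus> (\<Oplus>y\<in>M. W (fst ij) x \<otimes> W (snd ij) y \<otimes> tensor_coeff L v x y))"
    using w c by (intro finsum_congI finsum_add) (auto intro!: finsum_closedI)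
  also have "\<dots> = tensor_frame_coeff u ij \<oplus> tensor_frame_coeff v ij"
    unfolding tensor_frame_coeff_def using w c by (intro finsum_add) (auto intro!: finsum_closedI)
  finally show ?thesis .
qed

lemma tensor_frame_coeff_smult_single:
  assumes c: "c \<in> K" and a: "a \<in> carrier V" and b: "b \<in> carrier V" and ij: "ij \<in> I \<times> I"
  shows "tensor_frame_coeff (c \<odot>\<^bsub>F\<^esub> single R (a, b)) ij = c \<otimes> (frame_coeff (fst ij) a \<otimes> frame_coeff (snd ij) b)"
proof -
  have w: "W (fst ij) m \<in> carrier L" "W (snd ij) m \<in> carrier L" if "m \<in> M" for m
    using ij W_value that by auto
  note v = V_value[OF a] V_value[OF b]
  have cL: "c \<in> carrier L" using c by simp
  have fb: "frame_coeff (snd ij) b \<in> carrier L"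
    unfolding frame_coeff_def using w v by (intro finsum_closedI) auto
  have "tensor_frame_coeff (c \<odot>\<^bsub>F\<^esub> single R (a, b)) ij
      = (\<Oplus>x\<in>M. \<Oplus>y\<in>M. c \<otimes> (W (fst ij) x \<otimes> a x) \<otimes> (W (snd ij) y \<otimes> b y))"
    unfolding tensor_frame_coeff_def
    using w v cL tensor_coeff_smult[OF single_F[OF a b] c] tensor_coeff_single[OF a b]
    by (intro finsum_congI finsum_closedI) (simp_all add: m_ac del: free_module_sel)
  also have "\<dots> = (\<Oplus>x\<in>M. c \<otimes> (W (fst ij) x \<otimes> a x) \<otimes> frame_coeff (snd ij) b)"
    unfolding frame_coeff_def using w v cL fin_M
    by (intro finsum_congI finsum_distrib_left[symmetric]) (auto intro!: finsum_closedI)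
  also have "\<dots> = (\<Oplus>x\<in>M. c \<otimes> (W (fst ij) x \<otimes> a x)) \<otimes> frame_coeff (snd ij) b"
    using w v cL fb fin_M by (intro finsum_distrib_right[symmetric]) auto
  also have "(\<Oplus>x\<in>M. c \<otimes> (W (fst ij) x \<otimes> a x)) = c \<otimes> frame_coeff (fst ij) a"
    unfolding frame_coeff_def using w v cL fin_M by (intro finsum_distrib_left[symmetric]) auto
  finally show ?thesis
    using cL fb w v by (simp add: m_assoc frame_coeff_def finsum_closedI)
qed

text \<open>A representative that depends on \<open>u\<close> only through its coefficients.\<close>

definition frame_tensor :: "(('m \<Rightarrow> 'a) \<times> ('m \<Rightarrow> 'a) \<Rightarrow> 'a) \<Rightarrow> ('m \<Rightarrow> 'a) \<times> ('m \<Rightarrow> 'a) \<Rightarrow> 'a" where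
  "frame_tensor u = (\<Oplus>\<^bsub>F\<^esub>ij\<in>I \<times> I. tensor_frame_coeff u ij \<odot>\<^bsub>F\<^esub> single R (h (fst ij), h (snd ij)))"

lemma single_equiv_frame:
  assumes a: "a \<in> carrier V" and b: "b \<in> carrier V"
  shows "single R (a, b) \<approx>\<^sub>J (\<Oplus>\<^bsub>F\<^esub>ij\<in>I \<times> I. (frame_coeff (fst ij) a \<otimes> frame_coeff (snd ij) b) \<odot>\<^bsub>F\<^esub> single R (h (fst ij), h (snd ij)))"
proof -
  have fc: "frame_coeff i v \<in> carrier R" if "i \<in> I" "v \<in> carrier V" for i v
    using frame_coeff_K that by simp
  have sF: "single R (h i, h j) \<in> carrier F" "single R (h i, b) \<in> carrier F" if "i \<in> I" "j \<in> I" for i j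
    using that b by (auto intro!: single_F h_closed simp del: free_module_sel)
  have "single R (\<lambda>m. \<Oplus>i\<in>I. frame_coeff i a \<otimes> h i m, b) \<approx>\<^sub>J (\<Oplus>\<^bsub>F\<^esub>i\<in>I. frame_coeff i a \<odot>\<^bsub>F\<^esub> single R (h i, b))"
    by (rule combination_mod_J[of "\<lambda>v. single R (v, b)"])
      (use a b frame_coeff_K h_closed fin_I in \<open>auto intro!: single_F single_add_left single_smult_left simp del: free_module_sel\<close>)
  then have 1: "single R (a, b) \<approx>\<^sub>J (\<Oplus>\<^bsub>F\<^esub>i\<in>I. frame_coeff i a \<odot>\<^bsub>F\<^esub> single R (h i, b))"
    unfolding frame_expansion[OF a] .
  have "single R (h i, \<lambda>m. \<Oplus>j\<in>I. frame_coeff j b \<otimes> h j m) \<approx>\<^sub>J (\<Oplus>\<^bsub>F\<^esub>j\<in>I. frame_coeff j b \<odot>\<^bsub>F\<^esub> single R (h i, h j))"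
    if "i \<in> I" for i
    by (rule combination_mod_J[of "\<lambda>v. single R (h i, v)"])
      (use that b frame_coeff_K h_closed fin_I in \<open>auto intro!: single_F single_add_right single_smult_right simp del: free_module_sel\<close>)
  then have 2: "single R (h i, b) \<approx>\<^sub>J (\<Oplus>\<^bsub>F\<^esub>j\<in>I. frame_coeff j b \<odot>\<^bsub>F\<^esub> single R (h i, h j))" if "i \<in> I" for i
    unfolding frame_expansion[OF b] using that .
  have "(\<Oplus>\<^bsub>F\<^esub>i\<in>I. frame_coeff i a \<odot>\<^bsub>F\<^esub> single R (h i, b))
      \<approx>\<^sub>J (\<Oplus>\<^bsub>F\<^esub>i\<in>I. frame_coeff i a \<odot>\<^bsub>F\<^esub> (\<Oplus>\<^bsub>F\<^esub>j\<in>I. frame_coeff j b \<odot>\<^bsub>F\<^esub> single R (h i, h j)))"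
    using fc[OF _ a] 2 by (intro F.mod_eq_finsum[OF J_submodule fin_I] F.mod_eq_smult[OF J_submodule])
  also have "(\<Oplus>\<^bsub>F\<^esub>i\<in>I. frame_coeff i a \<odot>\<^bsub>F\<^esub> (\<Oplus>\<^bsub>F\<^esub>j\<in>I. frame_coeff j b \<odot>\<^bsub>F\<^esub> single R (h i, h j)))
      = (\<Oplus>\<^bsub>F\<^esub>i\<in>I. \<Oplus>\<^bsub>F\<^esub>j\<in>I. (frame_coeff i a \<otimes> frame_coeff j b) \<odot>\<^bsub>F\<^esub> single R (h i, h j))"
  proof (rule F.M.finsum_congI)
    fix i assume i: "i \<in> I"
    have "frame_coeff i a \<odot>\<^bsub>F\<^esub> (\<Oplus>\<^bsub>F\<^esub>j\<in>I. frame_coeff j b \<odot>\<^bsub>F\<^esub> single R (h i, h j))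
        = (\<Oplus>\<^bsub>F\<^esub>j\<in>I. frame_coeff i a \<odot>\<^bsub>F\<^esub> (frame_coeff j b \<odot>\<^bsub>F\<^esub> single R (h i, h j)))"
      using fc i a b sF by (intro F.finsum_smult_ldistr fin_I) (auto intro!: F.smult_closed simp del: free_module_sel)
    also have "\<dots> = (\<Oplus>\<^bsub>F\<^esub>j\<in>I. (frame_coeff i a \<otimes> frame_coeff j b) \<odot>\<^bsub>F\<^esub> single R (h i, h j))"
    proof (rule F.M.finsum_congI)
      fix j assume j: "j \<in> I"
      show "frame_coeff i a \<odot>\<^bsub>F\<^esub> (frame_coeff j b \<odot>\<^bsub>F\<^esub> single R (h i, h j))
          = (frame_coeff i a \<otimes> frame_coeff j b) \<odot>\<^bsub>F\<^esub> single R (h i, h j)"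
        using F.smult_assoc1[OF fc[OF i a] fc[OF j b] sF(1)[OF i j]] by (simp del: free_module_sel)
      show "(frame_coeff i a \<otimes> frame_coeff j b) \<odot>\<^bsub>F\<^esub> single R (h i, h j) \<in> carrier F"
        using F.smult_closed[OF R.m_closed[OF fc[OF i a] fc[OF j b]] sF(1)[OF i j]] by (simp del: free_module_sel)
    qed
    finally show "frame_coeff i a \<odot>\<^bsub>F\<^esub> (\<Oplus>\<^bsub>F\<^esub>j\<in>I. frame_coeff j b \<odot>\<^bsub>F\<^esub> single R (h i, h j))
        = (\<Oplus>\<^bsub>F\<^esub>j\<in>I. (frame_coeff i a \<otimes> frame_coeff j b) \<odot>\<^bsub>F\<^esub> single R (h i, h j))" .
    show "(\<Oplus>\<^bsub>F\<^esub>j\<in>I. (frame_coeff i a \<otimes> frame_coeff j b) \<odot>\<^bsub>F\<^esub> single R (h i, h j)) \<in> carrier F"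
    proof (rule F.M.finsum_closedI)
      fix j assume j: "j \<in> I"
      show "(frame_coeff i a \<otimes> frame_coeff j b) \<odot>\<^bsub>F\<^esub> single R (h i, h j) \<in> carrier F"
        using F.smult_closed[OF R.m_closed[OF fc[OF i a] fc[OF j b]] sF(1)[OF i j]] by (simp del: free_module_sel)
    qed
  qed
  also have "\<dots> = (\<Oplus>\<^bsub>F\<^esub>ij\<in>I \<times> I. (frame_coeff (fst ij) a \<otimes> frame_coeff (snd ij) b) \<odot>\<^bsub>F\<^esub> single R (h (fst ij), h (snd ij)))"
  proof (subst F.M.finsum_Times[OF fin_I fin_I])
    fix i j assume i: "i \<in> I" and j: "j \<in> I"
    show "(frame_coeff (fst (i, j)) a \<otimes> frame_coeff (snd (i, j)) b) \<odot>\<^bsub>F\<^esub> single R (h (fst (i, j)), h (snd (i, j))) \<in> carrier F"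
      using F.smult_closed[OF R.m_closed[OF fc[OF i a] fc[OF j b]] sF(1)[OF i j]] by (simp del: free_module_sel)
  qed (simp del: free_module_sel)
  finally show ?thesis by (rule F.mod_eq_trans[OF J_submodule 1])
qed

text \<open>Linearity in \<open>u\<close> reduces this to \<open>single_equiv_frame\<close>. That
  the coordinates lie in K is proved in the same induction, as it keeps the scalar multiples in
  \<open>frame_tensor\<close> inside \<open>F\<close>.\<close>

lemma equiv_frame_tensor:
  assumes "u \<in> carrier F"
  shows "(\<forall>ij\<in>I \<times> I. tensor_frame_coeff u ij \<in> K) \<and> u \<approx>\<^sub>J frame_tensor u"
proof (rule R.free_module_induct[where P = "\<lambda>u. (\<forall>ij\<in>I \<times> I. tensor_frame_coeff u ij \<in> K) \<and> u \<approx>\<^sub>J frame_tensor u",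
      OF assms])
  have "tensor_frame_coeff \<zero>\<^bsub>F\<^esub> ij = \<zero>" if "ij \<in> I \<times> I" for ij
    unfolding tensor_frame_coeff_def tensor_coeff_zero using that W_value by (intro finsum_eq_zeroI) auto
  moreover have "\<zero> \<odot>\<^bsub>F\<^esub> single R (h (fst ij), h (snd ij)) = \<zero>\<^bsub>F\<^esub>" if "ij \<in> I \<times> I" for ij
    using F.smult_l_null[OF single_F, of "h (fst ij)" "h (snd ij)"] that h_closed by (auto simp del: free_module_sel)
  ultimately have "frame_tensor \<zero>\<^bsub>F\<^esub> = \<zero>\<^bsub>F\<^esub>" "\<forall>ij\<in>I \<times> I. tensor_frame_coeff \<zero>\<^bsub>F\<^esub> ij \<in> K"
    unfolding frame_tensor_def using subringE(2)[OF K_subring]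
    by (auto intro!: F.M.finsum_eq_zeroI simp del: free_module_sel)
  then show "(\<forall>ij\<in>I \<times> I. tensor_frame_coeff \<zero>\<^bsub>F\<^esub> ij \<in> K) \<and> \<zero>\<^bsub>F\<^esub> \<approx>\<^sub>J frame_tensor \<zero>\<^bsub>F\<^esub>"
    using F.mod_eq_refl[OF J_submodule F.M.zero_closed] by simp
next
  fix u c ab
  assume u: "u \<in> carrier F" and IH: "(\<forall>ij\<in>I \<times> I. tensor_frame_coeff u ij \<in> K) \<and> u \<approx>\<^sub>J frame_tensor u"
    and c: "c \<in> carrier R" and ab: "ab \<in> carrier V \<times> carrier V"
  obtain a b where ab_eq: "ab = (a, b)" and a: "a \<in> carrier V" and b: "b \<in> carrier V"
    using ab by auto
  have cK: "c \<in> K" using c by simp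
  let ?cc = "\<lambda>ij. frame_coeff (fst ij) a \<otimes> frame_coeff (snd ij) b"
  let ?s = "\<lambda>ij. single R (h (fst ij), h (snd ij))"
  have cc: "?cc ij \<in> K" if "ij \<in> I \<times> I" for ij
    using that frame_coeff_K[OF _ a] frame_coeff_K[OF _ b] subringE(6)[OF K_subring] by auto
  have sF: "?s ij \<in> carrier F" if "ij \<in> I \<times> I" for ij
    using that h_closed by (intro single_F) auto
  have sm: "k \<odot>\<^bsub>F\<^esub> v \<in> carrier F" if "k \<in> K" "v \<in> carrier F" for k v
    using F.smult_closed[of k v] that by simp
  have csF: "c \<odot>\<^bsub>F\<^esub> single R (a, b) \<in> carrier F"
    using sm[OF cK single_F[OF a b]] .
  have coeff: "tensor_frame_coeff (u \<oplus>\<^bsub>F\<^esub> c \<odot>\<^bsub>F\<^esub> single R (a, b)) ij = tensor_frame_coeff u ij \<oplus> c \<otimes> ?cc ij"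
    if "ij \<in> I \<times> I" for ij
    using tensor_frame_coeff_add[OF u csF that] tensor_frame_coeff_smult_single[OF cK a b that] by (simp only:)
  have "\<forall>ij\<in>I \<times> I. tensor_frame_coeff (u \<oplus>\<^bsub>F\<^esub> c \<odot>\<^bsub>F\<^esub> single R (a, b)) ij \<in> K"
  proof
    fix ij assume ij: "ij \<in> I \<times> I"
    have "tensor_frame_coeff u ij \<in> K" using IH ij by blast
    then show "tensor_frame_coeff (u \<oplus>\<^bsub>F\<^esub> c \<odot>\<^bsub>F\<^esub> single R (a, b)) ij \<in> K"
      unfolding coeff[OF ij] using cc[OF ij] cK subringE(6,7)[OF K_subring] by presburger
  qed
  moreover have "frame_tensor (u \<oplus>\<^bsub>F\<^esub> c \<odot>\<^bsub>F\<^esub> single R (a, b))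
      = frame_tensor u \<oplus>\<^bsub>F\<^esub> c \<odot>\<^bsub>F\<^esub> (\<Oplus>\<^bsub>F\<^esub>ij\<in>I \<times> I. ?cc ij \<odot>\<^bsub>F\<^esub> ?s ij)"
  proof -
    have "frame_tensor (u \<oplus>\<^bsub>F\<^esub> c \<odot>\<^bsub>F\<^esub> single R (a, b))
        = (\<Oplus>\<^bsub>F\<^esub>ij\<in>I \<times> I. tensor_frame_coeff u ij \<odot>\<^bsub>F\<^esub> ?s ij \<oplus>\<^bsub>F\<^esub> c \<odot>\<^bsub>F\<^esub> (?cc ij \<odot>\<^bsub>F\<^esub> ?s ij))"
      unfolding frame_tensor_def
    proof (rule F.M.finsum_congI)
      fix ij assume ij: "ij \<in> I \<times> I"
      have k: "tensor_frame_coeff u ij \<in> carrier R" "?cc ij \<in> carrier R" "c \<otimes> ?cc ij \<in> carrier R"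
        using IH ij cc[OF ij] cK subringE(6)[OF K_subring] by auto
      show "tensor_frame_coeff (u \<oplus>\<^bsub>F\<^esub> c \<odot>\<^bsub>F\<^esub> single R (a, b)) ij \<odot>\<^bsub>F\<^esub> ?s ij
          = tensor_frame_coeff u ij \<odot>\<^bsub>F\<^esub> ?s ij \<oplus>\<^bsub>F\<^esub> c \<odot>\<^bsub>F\<^esub> (?cc ij \<odot>\<^bsub>F\<^esub> ?s ij)"
        unfolding coeff[OF ij]
        using F.smult_l_distr[OF k(1,3) sF[OF ij]] F.smult_assoc1[OF c k(2) sF[OF ij]] by (simp del: free_module_sel)
      show "tensor_frame_coeff u ij \<odot>\<^bsub>F\<^esub> ?s ij \<oplus>\<^bsub>F\<^esub> c \<odot>\<^bsub>F\<^esub> (?cc ij \<odot>\<^bsub>F\<^esub> ?s ij) \<in> carrier F"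
        by (intro F.M.a_closed F.smult_closed k c sF[OF ij])
    qed
    also have "\<dots> = frame_tensor u \<oplus>\<^bsub>F\<^esub> (\<Oplus>\<^bsub>F\<^esub>ij\<in>I \<times> I. c \<odot>\<^bsub>F\<^esub> (?cc ij \<odot>\<^bsub>F\<^esub> ?s ij))"
      unfolding frame_tensor_def using IH cK cc sF by (intro F.M.finsum_add) (auto intro!: sm simp del: free_module_sel)
    also have "(\<Oplus>\<^bsub>F\<^esub>ij\<in>I \<times> I. c \<odot>\<^bsub>F\<^esub> (?cc ij \<odot>\<^bsub>F\<^esub> ?s ij)) = c \<odot>\<^bsub>F\<^esub> (\<Oplus>\<^bsub>F\<^esub>ij\<in>I \<times> I. ?cc ij \<odot>\<^bsub>F\<^esub> ?s ij)"
      using fin_I c cc sF by (intro F.finsum_smult_ldistr[symmetric]) (auto intro!: sm simp del: free_module_sel)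
    finally show ?thesis .
  qed
  moreover have "u \<oplus>\<^bsub>F\<^esub> c \<odot>\<^bsub>F\<^esub> single R (a, b) \<approx>\<^sub>J frame_tensor u \<oplus>\<^bsub>F\<^esub> c \<odot>\<^bsub>F\<^esub> (\<Oplus>\<^bsub>F\<^esub>ij\<in>I \<times> I. ?cc ij \<odot>\<^bsub>F\<^esub> ?s ij)"
    using IH by (intro F.mod_eq_add[OF J_submodule] F.mod_eq_smult[OF J_submodule c] single_equiv_frame[OF a b]) blast
  ultimately show "(\<forall>ij\<in>I \<times> I. tensor_frame_coeff (u \<oplus>\<^bsub>F\<^esub> c \<odot>\<^bsub>F\<^esub> single R ab) ij \<in> K) \<and>
      u \<oplus>\<^bsub>F\<^esub> c \<odot>\<^bsub>F\<^esub> single R ab \<approx>\<^sub>J frame_tensor (u \<oplus>\<^bsub>F\<^esub> c \<odot>\<^bsub>F\<^esub> single R ab)"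
    unfolding ab_eq by (simp only: simp_thms)
qed

text \<open>Injectivity of the map from the tensor square of V to functions on M \<times> M. Equal
  coefficients give equal frame tensors, and every element is congruent to its own.\<close>

lemma equiv_iff_tensor_coeff:
  assumes u: "u \<in> carrier F" and v: "v \<in> carrier F"
  shows "u \<approx>\<^sub>J v \<longleftrightarrow> (\<forall>x\<in>M. \<forall>y\<in>M. tensor_coeff L u x y = tensor_coeff L v x y)"
proof
  assume "u \<approx>\<^sub>J v"
  then have "u \<ominus>\<^bsub>F\<^esub> v \<in> J" by (simp only: F.mod_eq_def)
  then show "\<forall>x\<in>M. \<forall>y\<in>M. tensor_coeff L u x y = tensor_coeff L v x y"
    using J_tensor_coeff tensor_coeff_minus[OF u v] by blast
next
  assume eq: "\<forall>x\<in>M. \<forall>y\<in>M. tensor_coeff L u x y = tensor_coeff L v x y"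
  have "tensor_frame_coeff u ij = tensor_frame_coeff v ij" if "ij \<in> I \<times> I" for ij
    unfolding tensor_frame_coeff_def using that eq W_value tensor_coeff_closed[OF v]
    by (intro finsum_congI finsum_closedI) auto
  then have "frame_tensor u = frame_tensor v"
    unfolding frame_tensor_def using equiv_frame_tensor[OF v] h_closed
    by (intro F.M.finsum_congI) (auto intro!: F.smult_closed single_F simp del: free_module_sel)
  then show "u \<approx>\<^sub>J v"
    using equiv_frame_tensor[OF u] equiv_frame_tensor[OF v]
      F.mod_eq_trans[OF J_submodule] F.mod_eq_sym[OF J_submodule] by metis
qed

lemma tensor_class_eq_iff:
  assumes "u \<in> carrier F" "v \<in> carrier F"
  shows "tensor_class R V V u = tensor_class R V V v
    \<longleftrightarrow> (\<forall>x\<in>M. \<forall>y\<in>M. tensor_coeff L u x y = tensor_coeff L v x y)"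
  unfolding tensor_class_def F.coset_eq_iff_mod_eq[OF J_submodule assms] equiv_iff_tensor_coeff[OF assms] ..

lemma mem_tensor_class_iff:
  assumes v: "v \<in> carrier F"
  shows "u \<in> tensor_class R V V v
    \<longleftrightarrow> u \<in> carrier F \<and> (\<forall>x\<in>M. \<forall>y\<in>M. tensor_coeff L u x y = tensor_coeff L v x y)"
proof (cases "u \<in> carrier F")
  case True
  show ?thesis
    unfolding tensor_class_def F.mem_coset_iff_mod_eq[OF J_submodule v] equiv_iff_tensor_coeff[OF True v]
    using True by (simp only: simp_thms)
next
  case False
  then show ?thesis
    unfolding tensor_class_def F.mem_coset_iff_mod_eq[OF J_submodule v] F.mod_eq_def by (simp only: simp_thms)
qed

end

text \<open>A change of variables along \<phi>. Cancellation can make the support on the left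
  smaller than the image of \<open>S\<close>, so the sum is first extended to that image.\<close>

lemma (in ring) finsum_pushforward:
  assumes S: "finite S" and u: "\<And>s. s \<in> S \<Longrightarrow> u s \<in> carrier R"
    and e: "\<And>s. s \<in> S \<Longrightarrow> e (\<phi> s) \<in> carrier R"
  shows "(\<Oplus>z\<in>{z. (\<Oplus>s\<in>S. if \<phi> s = z then u s else \<zero>) \<noteq> \<zero>}. (\<Oplus>s\<in>S. if \<phi> s = z then u s else \<zero>) \<otimes> e z)
    = (\<Oplus>s\<in>S. u s \<otimes> e (\<phi> s))"
proof -
  define w where "w z = (\<Oplus>s\<in>S. if \<phi> s = z then u s else \<zero>)" for z
  have e': "e z \<in> carrier R" if "z \<in> \<phi> ` S" for z using that e by auto
  have wL: "w z \<in> carrier R" for z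
    unfolding w_def using u by (intro finsum_closedI) auto
  have supp: "{z. w z \<noteq> \<zero>} \<subseteq> \<phi> ` S"
  proof
    fix z assume z: "z \<in> {z. w z \<noteq> \<zero>}"
    show "z \<in> \<phi> ` S"
    proof (rule ccontr)
      assume "z \<notin> \<phi> ` S"
      then have "w z = \<zero>" unfolding w_def by (intro finsum_eq_zeroI) auto
      then show False using z by simp
    qed
  qed
  have "(\<Oplus>z\<in>{z. w z \<noteq> \<zero>}. w z \<otimes> e z) = (\<Oplus>z\<in>\<phi> ` S. w z \<otimes> e z)"
    using S supp e' wL by (intro finsum_mono_neutral) auto
  also have "\<dots> = (\<Oplus>z\<in>\<phi> ` S. \<Oplus>s\<in>S. if z = \<phi> s then u s \<otimes> e z else \<zero>)"
  proof (rule finsum_congI)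
    fix z assume z: "z \<in> \<phi> ` S"
    have "w z \<otimes> e z = (\<Oplus>s\<in>S. (if \<phi> s = z then u s else \<zero>) \<otimes> e z)"
      unfolding w_def using S e'[OF z] u by (intro finsum_distrib_right) auto
    also have "\<dots> = (\<Oplus>s\<in>S. if z = \<phi> s then u s \<otimes> e z else \<zero>)"
      using e'[OF z] u by (intro finsum_congI) auto
    finally show "w z \<otimes> e z = (\<Oplus>s\<in>S. if z = \<phi> s then u s \<otimes> e z else \<zero>)" .
    show "(\<Oplus>s\<in>S. if z = \<phi> s then u s \<otimes> e z else \<zero>) \<in> carrier R"
      using e'[OF z] u by (intro finsum_closedI) auto
  qed
  also have "\<dots> = (\<Oplus>s\<in>S. \<Oplus>z\<in>\<phi> ` S. if z = \<phi> s then u s \<otimes> e z else \<zero>)"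
    using S e' u by (intro finsum_swap) auto
  also have "\<dots> = (\<Oplus>s\<in>S. u s \<otimes> e (\<phi> s))"
  proof (rule finsum_congI)
    fix s assume s: "s \<in> S"
    then show "(\<Oplus>z\<in>\<phi> ` S. if z = \<phi> s then u s \<otimes> e z else \<zero>) = u s \<otimes> e (\<phi> s)"
      using S e u finsum_delta[of "\<phi> ` S" "\<phi> s" "\<lambda>z. u s \<otimes> e z"] by simp
  qed (use e u in auto)
  finally show ?thesis unfolding w_def .
qed

section \<open>Separation by the frame, representatives of comultiplications, and maps of
  tensors\<close>

context framed_module begin

text \<open>The frame read the other way: z(x) is recovered as the sum of W_i(x) times the pairing
  of h_i with z.\<close>

lemma frame_separates:
  assumes w: "\<And>m. m \<in> M \<Longrightarrow> w m \<in> carrier L" and w': "\<And>m. m \<in> M \<Longrightarrow> w' m \<in> carrier L"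
    and eq: "\<And>v. v \<in> carrier V \<Longrightarrow> (\<Oplus>m\<in>M. v m \<otimes> w m) = (\<Oplus>m\<in>M. v m \<otimes> w' m)"
    and x: "x \<in> M"
  shows "w x = w' x"
proof -
  have *: "z x = (\<Oplus>i\<in>I. W i x \<otimes> (\<Oplus>m\<in>M. h i m \<otimes> z m))"
    if z: "\<And>m. m \<in> M \<Longrightarrow> z m \<in> carrier L" for z
  proof -
    have hm: "h i m \<in> carrier L" if "i \<in> I" for i m using V_value[OF h_closed[OF that]] .
    have "(\<Oplus>i\<in>I. W i x \<otimes> (\<Oplus>m\<in>M. h i m \<otimes> z m)) = (\<Oplus>i\<in>I. \<Oplus>m\<in>M. W i x \<otimes> h i m \<otimes> z m)"
      using z hm W_value x fin_M by (intro finsum_congI) (auto simp: finsum_distrib_left m_assoc intro!: finsum_closedI finsum_congI)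
    also have "\<dots> = (\<Oplus>m\<in>M. \<Oplus>i\<in>I. W i x \<otimes> h i m \<otimes> z m)"
      using z hm W_value x fin_M fin_I by (intro finsum_swap) auto
    also have "\<dots> = (\<Oplus>m\<in>M. if m = x then z m else \<zero>)"
    proof (rule finsum_congI)
      fix m assume m: "m \<in> M"
      have "(\<Oplus>i\<in>I. W i x \<otimes> h i m \<otimes> z m) = (\<Oplus>i\<in>I. W i x \<otimes> h i m) \<otimes> z m"
        using z hm W_value x fin_I m by (intro finsum_distrib_right[symmetric]) auto
      then show "(\<Oplus>i\<in>I. W i x \<otimes> h i m \<otimes> z m) = (if m = x then z m else \<zero>)"
        using frame[OF x m] z[OF m] z[OF x] by auto
    qed (use z in auto)
    also have "\<dots> = z x" using z x fin_M by (subst finsum_delta) auto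
    finally show ?thesis by simp
  qed
  have "(\<Oplus>i\<in>I. W i x \<otimes> (\<Oplus>m\<in>M. h i m \<otimes> w m)) = (\<Oplus>i\<in>I. W i x \<otimes> (\<Oplus>m\<in>M. h i m \<otimes> w' m))"
    using eq h_closed W_value x w' V_value[OF h_closed] by (intro finsum_congI) (auto intro!: finsum_closedI)
  then show ?thesis using *[of w, OF w] *[of w', OF w'] by simp
qed

lemma tensor_coeff_finsum:
  assumes "finite A" "\<And>i. i \<in> A \<Longrightarrow> u i \<in> carrier F"
  shows "tensor_coeff L (\<Oplus>\<^bsub>F\<^esub>i\<in>A. u i) x y = (\<Oplus>i\<in>A. tensor_coeff L (u i) x y)"
  using assms
proof (induction A)
  case empty
  show ?case by (simp only: F.M.finsum_empty finsum_empty tensor_coeff_zero)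
next
  case (insert a A)
  have uA: "(\<Oplus>\<^bsub>F\<^esub>i\<in>A. u i) \<in> carrier F" using insert.prems by (intro F.M.finsum_closedI) blast
  have "(\<Oplus>\<^bsub>F\<^esub>i\<in>insert a A. u i) = u a \<oplus>\<^bsub>F\<^esub> (\<Oplus>\<^bsub>F\<^esub>i\<in>A. u i)"
    using insert.hyps insert.prems by (intro F.M.finsum_insert) blast+
  moreover have "(\<Oplus>i\<in>insert a A. tensor_coeff L (u i) x y)
      = tensor_coeff L (u a) x y \<oplus> (\<Oplus>i\<in>A. tensor_coeff L (u i) x y)"
    using insert.hyps tensor_coeff_closed insert.prems by (intro finsum_insert funcsetI) blast+
  ultimately show ?case
    using tensor_coeff_add[OF _ uA, of "u a"] insert by (simp del: free_module_sel)
qed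

text \<open>The sought tensor is the sum of v(m) m \<otimes> m, whose coordinate at h_i \<otimes>
  h_j is the sum over m of W_i(m) W_j(m) v(m). The hypothesis that these lie in K places it in the
  tensor square over K.\<close>

lemma exists_comult_repr:
  assumes v: "\<And>m. m \<in> M \<Longrightarrow> v m \<in> carrier L"
    and c: "\<And>i j. \<lbrakk>i \<in> I; j \<in> I\<rbrakk> \<Longrightarrow> (\<Oplus>m\<in>M. W i m \<otimes> (W j m \<otimes> v m)) \<in> K"
  obtains u where "u \<in> carrier F"
    "\<And>x y. \<lbrakk>x \<in> M; y \<in> M\<rbrakk> \<Longrightarrow> tensor_coeff L u x y = (if x = y then v x else \<zero>)"
proof
  let ?C = "\<lambda>i j. (\<Oplus>m\<in>M. W i m \<otimes> (W j m \<otimes> v m))"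
  let ?s = "\<lambda>i j. ?C i j \<odot>\<^bsub>F\<^esub> single R (h i, h j)"
  let ?u = "\<Oplus>\<^bsub>F\<^esub>j\<in>I. \<Oplus>\<^bsub>F\<^esub>i\<in>I. ?s i j"
  have s: "?s i j \<in> carrier F" if "i \<in> I" "j \<in> I" for i j
    using F.smult_closed[OF _ single_F[OF h_closed h_closed], of "?C i j" i j] c[OF that] that
    by (simp del: free_module_sel)
  then have s': "(\<Oplus>\<^bsub>F\<^esub>i\<in>I. ?s i j) \<in> carrier F" if "j \<in> I" for j
    using that by (intro F.M.finsum_closedI)
  then show "?u \<in> carrier F" by (rule F.M.finsum_closedI)
  fix x y assume x: "x \<in> M" and y: "y \<in> M"
  have hm: "h i m \<in> carrier L" if "i \<in> I" for i m using V_value[OF h_closed[OF that]] .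
  have CL: "?C i j \<in> carrier L" if "i \<in> I" "j \<in> I" for i j using c[OF that] by simp
  have E: "tensor_coeff L (?s i j) x y = ?C i j \<otimes> h i x \<otimes> h j y" if ij: "i \<in> I" "j \<in> I" for i j
  proof -
    have "tensor_coeff L (?s i j) x y = ?C i j \<otimes> (h i x \<otimes> h j y)"
      using tensor_coeff_smult[OF single_F[OF h_closed h_closed] c, of i j i j] tensor_coeff_single[OF h_closed h_closed, of i j] ij
      by (simp del: free_module_sel)
    then show ?thesis using CL[OF ij] hm ij by (simp add: m_assoc)
  qed
  have "tensor_coeff L ?u x y = (\<Oplus>j\<in>I. tensor_coeff L (\<Oplus>\<^bsub>F\<^esub>i\<in>I. ?s i j) x y)"
    using s' by (intro tensor_coeff_finsum fin_I)
  also have "\<dots> = (\<Oplus>j\<in>I. \<Oplus>i\<in>I. ?C i j \<otimes> h i x \<otimes> h j y)"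
  proof (rule finsum_congI)
    fix j assume j: "j \<in> I"
    have "tensor_coeff L (\<Oplus>\<^bsub>F\<^esub>i\<in>I. ?s i j) x y = (\<Oplus>i\<in>I. tensor_coeff L (?s i j) x y)"
      using s j by (intro tensor_coeff_finsum fin_I)
    also have "\<dots> = (\<Oplus>i\<in>I. ?C i j \<otimes> h i x \<otimes> h j y)"
      using E j CL hm by (intro finsum_congI) auto
    finally show "tensor_coeff L (\<Oplus>\<^bsub>F\<^esub>i\<in>I. ?s i j) x y = (\<Oplus>i\<in>I. ?C i j \<otimes> h i x \<otimes> h j y)" .
  qed (use CL hm in \<open>auto intro!: finsum_closedI\<close>)
  \<comment> \<open>The sum over i is a frame expansion of the function sending m to W_j(m) v(m);
    the sum over j that remains is the frame identity.\<close>
  also have "\<dots> = (\<Oplus>j\<in>I. W j x \<otimes> h j y \<otimes> v x)"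
  proof (rule finsum_congI)
    fix j assume j: "j \<in> I"
    have "(\<Oplus>i\<in>I. ?C i j \<otimes> h i x \<otimes> h j y) = (\<Oplus>i\<in>I. ?C i j \<otimes> h i x) \<otimes> h j y"
      using CL hm j fin_I by (intro finsum_distrib_right[symmetric]) auto
    also have "(\<Oplus>i\<in>I. ?C i j \<otimes> h i x) = W j x \<otimes> v x"
      using W_value v j x by (intro frame_sum) auto
    finally show "(\<Oplus>i\<in>I. ?C i j \<otimes> h i x \<otimes> h j y) = W j x \<otimes> h j y \<otimes> v x"
      using W_value v j x hm by (simp add: m_ac)
  qed (use W_value v x hm in auto)
  also have "\<dots> = (\<Oplus>j\<in>I. W j x \<otimes> h j y) \<otimes> v x"
    using W_value v x hm fin_I by (intro finsum_distrib_right[symmetric]) auto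
  also have "\<dots> = (if x = y then v x else \<zero>)"
    using frame[OF x y] v[OF x] by auto
  finally show "tensor_coeff L ?u x y = (if x = y then v x else \<zero>)" .
qed

text \<open>\<open>free_map\<close> merges pairs with equal image; \<open>finsum_pushforward\<close>
  undoes this, and the coefficients can be computed on the support of \<open>u\<close>.\<close>

lemma tensor_coeff_free_map:
  assumes u: "u \<in> carrier F" and f: "\<And>a m. a \<in> carrier V \<Longrightarrow> f a m \<in> carrier L"
  shows "tensor_coeff L (free_map R (map_prod f f) u) x y
    = (\<Oplus>ab\<in>{ab. u ab \<noteq> \<zero>}. u ab \<otimes> (f (fst ab) x \<otimes> f (snd ab) y))"
proof -
  let ?S = "{ab. u ab \<noteq> \<zero>}"
  define \<phi> where "\<phi> = map_prod f f"
  define e where "e z = fst z x \<otimes> snd z y" for z :: "('b \<Rightarrow> 'a) \<times> ('b \<Rightarrow> 'a)"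
  have e: "e (\<phi> s) = f (fst s) x \<otimes> f (snd s) y" for s by (simp add: e_def \<phi>_def)
  have fin: "finite ?S" by (rule F_finite[OF u])
  have uK: "u s \<in> K" for s by (rule F_value[OF u])
  have zR: "\<zero>\<^bsub>R\<^esub> = \<zero>" by simp
  have w: "free_map R \<phi> u = (\<lambda>z. \<Oplus>s\<in>?S. if \<phi> s = z then u s else \<zero>)"
  proof
    fix z
    have "free_map R \<phi> u z = (\<Oplus>\<^bsub>R\<^esub>s\<in>?S. if \<phi> s = z then u s else \<zero>)"
      using R.free_map_eq_finsum[of ?S u \<phi> z, unfolded zR] fin uK by simp
    also have "\<dots> = (\<Oplus>s\<in>?S. if \<phi> s = z then u s else \<zero>)"
      using uK subringE(2)[OF K_subring] by (intro finsum_subring(1)[OF K_subring]) auto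
    finally show "free_map R \<phi> u z = (\<Oplus>s\<in>?S. if \<phi> s = z then u s else \<zero>)" .
  qed
  have "(\<Oplus>z\<in>{z. free_map R \<phi> u z \<noteq> \<zero>}. free_map R \<phi> u z \<otimes> e z) = (\<Oplus>s\<in>?S. u s \<otimes> e (\<phi> s))"
    unfolding w
  proof (rule finsum_pushforward[OF fin])
    fix s assume "s \<in> ?S"
    then show "e (\<phi> s) \<in> carrier L"
      unfolding e using F_supp[OF u, of s] f by simp
  qed (simp add: uK)
  then show ?thesis
    unfolding tensor_coeff_def e unfolding e_def \<phi>_def .
qed

text \<open>One function \<open>u\<close> represents both a tensor over K and a tensor over L. The
  canonical map is the identity on representatives, and it respects classes because both sides are
  classified by the same coefficients.\<close>

lemma tensor_map_inclusion:
  assumes A: "framed_module L (carrier L) M A I' W' h'" and VA: "carrier V \<subseteq> carrier A"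
    and u: "u \<in> carrier F"
  shows "u \<in> carrier (free_module L (carrier A \<times> carrier A))"
    and "tensor_map L A A (\<lambda>a. a) (\<lambda>a. a) (tensor_class R V V u) = tensor_class L A A u"
proof -
  interpret A: framed_module L "carrier L" M A I' W' h' by (rule A)
  have RA: "A.R = L" by simp
  have inc: "w \<in> carrier (free_module L (carrier A \<times> carrier A))" if w: "w \<in> carrier F" for w
  proof -
    have "w z \<in> carrier L" for z using F_value[OF w] by simp
    moreover have "w z = \<zero>" if "z \<notin> carrier A \<times> carrier A" for z
      using that VA F_supp[OF w, of z] by (cases z) auto
    ultimately show ?thesis using F_finite[OF w] by simp
  qed
  show uA: "u \<in> carrier (free_module L (carrier A \<times> carrier A))" by (rule inc[OF u])
  have cl: "tensor_class L A A (free_map L (map_prod (\<lambda>a. a) (\<lambda>a. a)) w) = tensor_class L A A u"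
    if "w \<in> tensor_class R V V u" for w
  proof -
    have w: "w \<in> carrier F" "\<forall>x\<in>M. \<forall>y\<in>M. tensor_coeff L w x y = tensor_coeff L u x y"
      using that mem_tensor_class_iff[OF u] by auto
    have "free_map L (map_prod (\<lambda>a. a) (\<lambda>a. a)) w = w"
      using free_map_id[OF inc[OF w(1)]] by (simp add: map_prod_def)
    then show ?thesis
      using A.tensor_class_eq_iff[unfolded RA, OF inc[OF w(1)] uA] w(2) by simp
  qed
  have "u \<in> tensor_class R V V u" using mem_tensor_class_iff[OF u] u by blast
  then show "tensor_map L A A (\<lambda>a. a) (\<lambda>a. a) (tensor_class R V V u) = tensor_class L A A u"
    unfolding tensor_map_def using cl by auto
qed

lemma tensor_map_id:
  assumes u: "u \<in> carrier F"
  shows "tensor_map R V V (\<lambda>a. a) (\<lambda>a. a) (tensor_class R V V u) = tensor_class R V V u"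
proof -
  have cl: "tensor_class R V V (free_map R (map_prod (\<lambda>a. a) (\<lambda>a. a)) w) = tensor_class R V V u"
    if "w \<in> tensor_class R V V u" for w
  proof -
    have w: "w \<in> carrier F" "\<forall>x\<in>M. \<forall>y\<in>M. tensor_coeff L w x y = tensor_coeff L u x y"
      using that mem_tensor_class_iff[OF u] by auto
    have "free_map R (map_prod (\<lambda>a. a) (\<lambda>a. a)) w = w"
      using R.free_map_id[OF w(1)] by (simp add: map_prod_def)
    then show ?thesis
      using tensor_class_eq_iff[OF w(1) u] w(2) by simp
  qed
  have "u \<in> tensor_class R V V u" using mem_tensor_class_iff[OF u] u by blast
  then show ?thesis
    unfolding tensor_map_def using cl by auto
qed

text \<open>
  Hence the description in \<open>comult (descent_hopf L K M)\<close> is not a junk value; even \<open>H\<^sub>r \<cong> H\<^sub>r\<close>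
  depends on this.
\<close>

lemma the_comult:
  assumes A: "framed_module L (carrier L) M A I' W' h'" and VA: "carrier V \<subseteq> carrier A"
    and u: "u \<in> carrier F" and u0: "u0 \<in> carrier (free_module L (carrier A \<times> carrier A))"
    and eq: "\<forall>x\<in>M. \<forall>y\<in>M. tensor_coeff L u x y = tensor_coeff L u0 x y"
  shows "(THE t. t \<in> tensor_carrier R V V \<and> tensor_map L A A (\<lambda>a. a) (\<lambda>a. a) t = tensor_class L A A u0)
    = tensor_class R V V u"
proof (rule the_equality)
  interpret A: framed_module L "carrier L" M A I' W' h' by (rule A)
  have RA: "A.R = L" by simp
  note inc = tensor_map_inclusion[OF A VA]
  note Aeq = A.tensor_class_eq_iff[unfolded RA]
  show "tensor_class R V V u \<in> tensor_carrier R V V \<and>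
      tensor_map L A A (\<lambda>a. a) (\<lambda>a. a) (tensor_class R V V u) = tensor_class L A A u0"
    using inc(2)[OF u] Aeq[OF inc(1)[OF u] u0] eq u unfolding tensor_carrier_def by blast
  fix t assume t: "t \<in> tensor_carrier R V V \<and> tensor_map L A A (\<lambda>a. a) (\<lambda>a. a) t = tensor_class L A A u0"
  then obtain w where w: "w \<in> carrier F" "t = tensor_class R V V w"
    unfolding tensor_carrier_def by blast
  have "tensor_class L A A w = tensor_class L A A u0" using t inc(2)[OF w(1)] w(2) by simp
  then have "\<forall>x\<in>M. \<forall>y\<in>M. tensor_coeff L w x y = tensor_coeff L u x y"
    using Aeq[OF inc(1)[OF w(1)] u0] eq by simp
  then show "t = tensor_class R V V u"
    using tensor_class_eq_iff[OF w(1) u] w(2) by simp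
qed

end

section \<open>Galois descent of functions on a finite set\<close>

locale descent_set = galois_descent L G K
  for L :: "('a, 'l) ring_scheme" (structure) and G :: "('a \<Rightarrow> 'a) monoid" and K :: "'a set" +
  fixes M :: "'m set" and act :: "('a \<Rightarrow> 'a) \<Rightarrow> 'm \<Rightarrow> 'm"
  assumes fin_G: "finite (carrier G)" and fin_M: "finite M"
    and act_closed: "\<lbrakk>g \<in> carrier G; m \<in> M\<rbrakk> \<Longrightarrow> act g m \<in> M"
    and act_one: "m \<in> M \<Longrightarrow> act \<one>\<^bsub>G\<^esub> m = m"
    and act_mult: "\<lbrakk>g \<in> carrier G; h \<in> carrier G; m \<in> M\<rbrakk> \<Longrightarrow> act (g \<otimes>\<^bsub>G\<^esub> h) m = act g (act h m)"
begin

text \<open>The fixed points of the semilinear action, in pointwise form; \<open>carrier_H\<close>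
  identifies them with the carrier of the descended Hopf algebra.\<close>

definition invariants :: "('m \<Rightarrow> 'a) set" where
  "invariants = {a. (\<forall>m. a m \<in> carrier L) \<and> (\<forall>m. m \<notin> M \<longrightarrow> a m = \<zero>) \<and>
                    (\<forall>g\<in>carrier G. \<forall>m\<in>M. a (act g m) = g (a m))}"

lemma invariants_value: "a \<in> invariants \<Longrightarrow> a m \<in> carrier L"
  and invariants_outside: "\<lbrakk>a \<in> invariants; m \<notin> M\<rbrakk> \<Longrightarrow> a m = \<zero>"
  and invariants_act: "\<lbrakk>a \<in> invariants; g \<in> carrier G; m \<in> M\<rbrakk> \<Longrightarrow> a (act g m) = g (a m)"
  by (auto simp: invariants_def)

lemma act_inv [simp]:
  assumes "g \<in> carrier G" "m \<in> M"
  shows "act (inv\<^bsub>G\<^esub> g) (act g m) = m" "act g (act (inv\<^bsub>G\<^esub> g) m) = m"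
  using assms act_mult[of "inv\<^bsub>G\<^esub> g" g m] act_mult[of g "inv\<^bsub>G\<^esub> g" m] act_one[of m] by simp_all

lemma act_eq_iff: "\<lbrakk>g \<in> carrier G; m \<in> M; x \<in> M\<rbrakk> \<Longrightarrow> act g m = x \<longleftrightarrow> m = act (inv\<^bsub>G\<^esub> g) x"
  by auto

lemma bij_act: "g \<in> carrier G \<Longrightarrow> bij_betw (act g) M M"
  by (rule bij_betw_byWitness[of _ "act (inv\<^bsub>G\<^esub> g)"]) (auto simp: act_closed)

definition ind :: "'m \<Rightarrow> 'm \<Rightarrow> 'a" where
  "ind x y = (if x = y then \<one> else \<zero>)"

lemma ind_closed [simp]: "ind x y \<in> carrier L"
  by (simp add: ind_def)

text \<open>The sum over g in G of the images of l m under the semilinear action. An element of the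
  orbit of m is met once for each g reaching it.\<close>

definition orbit_sum :: "'a \<Rightarrow> 'm \<Rightarrow> 'm \<Rightarrow> 'a" where
  "orbit_sum l m x = (\<Oplus>g\<in>carrier G. ind (act g m) x \<otimes> g l)"

lemma orbit_sum_invariant:
  assumes l: "l \<in> carrier L" and m: "m \<in> M"
  shows "orbit_sum l m \<in> invariants"
  unfolding invariants_def
proof (intro CollectI conjI allI impI ballI)
  show "orbit_sum l m x \<in> carrier L" for x
    unfolding orbit_sum_def using l by (intro finsum_closedI) auto
  show "orbit_sum l m x = \<zero>" if "x \<notin> M" for x
    unfolding orbit_sum_def using l m that act_closed by (intro finsum_eq_zeroI) (auto simp: ind_def)
  fix k x assume k: "k \<in> carrier G" and x: "x \<in> M"
  have "orbit_sum l m (act k x) = (\<Oplus>g\<in>carrier G. ind (act (k \<otimes>\<^bsub>G\<^esub> g) m) (act k x) \<otimes> (k \<otimes>\<^bsub>G\<^esub> g) l)"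
    unfolding orbit_sum_def using l by (intro finsum_reindex_bij[OF bij_left_mult[OF k]]) auto
  also have "\<dots> = (\<Oplus>g\<in>carrier G. k (ind (act g m) x \<otimes> g l))"
  proof (rule finsum_congI)
    fix g assume g: "g \<in> carrier G"
    have "act k (act g m) = act k x \<longleftrightarrow> act g m = x"
      using bij_act[OF k] act_closed[OF g m] x by (auto simp: bij_betw_def inj_on_def)
    then show "ind (act (k \<otimes>\<^bsub>G\<^esub> g) m) (act k x) \<otimes> (k \<otimes>\<^bsub>G\<^esub> g) l = k (ind (act g m) x \<otimes> g l)"
      using k g m l by (simp add: act_mult aut_mult ind_def)
  qed (use k l in auto)
  also have "\<dots> = k (orbit_sum l m x)"
    unfolding orbit_sum_def using k l fin_G by (intro aut_finsum[symmetric]) auto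
  finally show "orbit_sum l m (act k x) = k (orbit_sum l m x)" .
qed

text \<open>The action permutes M, so the sum is fixed by G. Together with
  \<open>invariants_times\<close> this gives the pairing condition of
  \<open>framed_module\<close>.\<close>

lemma sum_invariant_in_K:
  assumes a: "a \<in> invariants"
  shows "(\<Oplus>m\<in>M. a m) \<in> K"
proof (rule fixed_K)
  fix g assume g: "g \<in> carrier G"
  have "g (\<Oplus>m\<in>M. a m) = (\<Oplus>m\<in>M. g (a m))"
    using g fin_M invariants_value[OF a] by (intro aut_finsum) auto
  also have "\<dots> = (\<Oplus>m\<in>M. a (act g m))"
    using g invariants_act[OF a] invariants_value[OF a] by (intro finsum_congI) auto
  also have "\<dots> = (\<Oplus>m\<in>M. a m)"
    using finsum_reindex_bij[OF bij_act[OF g], of a] invariants_value[OF a] by simp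
  finally show "g (\<Oplus>m\<in>M. a m) = (\<Oplus>m\<in>M. a m)" .
qed (use invariants_value[OF a] in \<open>auto intro!: finsum_closedI\<close>)

lemma invariants_times:
  assumes "a \<in> invariants" "b \<in> invariants"
  shows "(\<lambda>m. a m \<otimes> b m) \<in> invariants"
  using assms by (auto simp: invariants_def)

text \<open>The product of two orbit sums is a double sum over g and k. Duality of the l_i and l'_i
  leaves the terms with k = g. For each g only one m can then contribute, and only if x = y; what
  remains is the trace of t, chosen to be 1.\<close>

lemma orbit_sum_frame:
  fixes n :: nat
  assumes l: "\<And>i. i < n \<Longrightarrow> l i \<in> carrier L" and l': "\<And>i. i < n \<Longrightarrow> l' i \<in> carrier L"
    and dual: "\<And>g h. \<lbrakk>g \<in> carrier G; h \<in> carrier G\<rbrakk> \<Longrightarrow>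
       (\<Oplus>i\<in>{..<n}. g (l' i) \<otimes> h (l i)) = (if g = h then \<one> else \<zero>)"
    and t: "t \<in> carrier L" "trace t = \<one>" and x: "x \<in> M" and y: "y \<in> M"
  shows "(\<Oplus>mj\<in>M \<times> {..<n}. orbit_sum (l' (snd mj) \<otimes> t) (fst mj) x \<otimes> orbit_sum (l (snd mj)) (fst mj) y)
    = (if x = y then \<one> else \<zero>)"
proof -
  have oc: "orbit_sum a m z \<in> carrier L" if "a \<in> carrier L" "m \<in> M" for a m z
    using invariants_value[OF orbit_sum_invariant[OF that]] .
  have inner: "(\<Oplus>j\<in>{..<n}. orbit_sum (l' j \<otimes> t) m x \<otimes> orbit_sum (l j) m y)
      = (\<Oplus>g\<in>carrier G. ind (act g m) x \<otimes> ind (act g m) y \<otimes> g t)" if m: "m \<in> M" for m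
  proof -
    let ?X = "\<lambda>g. ind (act g m) x" and ?Y = "\<lambda>g. ind (act g m) y"
    have "(\<Oplus>j\<in>{..<n}. orbit_sum (l' j \<otimes> t) m x \<otimes> orbit_sum (l j) m y)
        = (\<Oplus>j\<in>{..<n}. \<Oplus>g\<in>carrier G. \<Oplus>k\<in>carrier G. ?X g \<otimes> g (l' j \<otimes> t) \<otimes> (?Y k \<otimes> k (l j)))"
    proof (rule finsum_congI)
      fix j assume j: "j \<in> {..<n}"
      have "orbit_sum (l' j \<otimes> t) m x \<otimes> orbit_sum (l j) m y
          = (\<Oplus>g\<in>carrier G. ?X g \<otimes> g (l' j \<otimes> t) \<otimes> orbit_sum (l j) m y)"
        unfolding orbit_sum_def[of "l' j \<otimes> t"] using j l l' t oc m fin_G by (intro finsum_distrib_right) auto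
      also have "\<dots> = (\<Oplus>g\<in>carrier G. \<Oplus>k\<in>carrier G. ?X g \<otimes> g (l' j \<otimes> t) \<otimes> (?Y k \<otimes> k (l j)))"
        unfolding orbit_sum_def[of "l j"] using j l l' t fin_G
        by (intro finsum_congI finsum_distrib_left) (auto intro!: finsum_closedI)
      finally show "orbit_sum (l' j \<otimes> t) m x \<otimes> orbit_sum (l j) m y
          = (\<Oplus>g\<in>carrier G. \<Oplus>k\<in>carrier G. ?X g \<otimes> g (l' j \<otimes> t) \<otimes> (?Y k \<otimes> k (l j)))" .
    qed (use l l' t in \<open>auto intro!: finsum_closedI\<close>)
    also have "\<dots> = (\<Oplus>g\<in>carrier G. \<Oplus>j\<in>{..<n}. \<Oplus>k\<in>carrier G. ?X g \<otimes> g (l' j \<otimes> t) \<otimes> (?Y k \<otimes> k (l j)))"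
      using l l' t fin_G by (intro finsum_swap) (auto intro!: finsum_closedI)
    also have "\<dots> = (\<Oplus>g\<in>carrier G. ?X g \<otimes> ?Y g \<otimes> g t)"
    proof (rule finsum_congI)
      fix g assume g: "g \<in> carrier G"
      have "(\<Oplus>j\<in>{..<n}. \<Oplus>k\<in>carrier G. ?X g \<otimes> g (l' j \<otimes> t) \<otimes> (?Y k \<otimes> k (l j)))
          = (\<Oplus>k\<in>carrier G. \<Oplus>j\<in>{..<n}. ?X g \<otimes> g (l' j \<otimes> t) \<otimes> (?Y k \<otimes> k (l j)))"
        using l l' t fin_G g by (intro finsum_swap) auto
      \<comment> \<open>The factors independent of j are pulled out, so that duality decides the sum
        over j.\<close>
      also have "\<dots> = (\<Oplus>k\<in>carrier G. if k = g then ?X g \<otimes> ?Y k \<otimes> g t else \<zero>)"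
      proof (rule finsum_congI)
        fix k assume k: "k \<in> carrier G"
        have "(\<Oplus>j\<in>{..<n}. ?X g \<otimes> g (l' j \<otimes> t) \<otimes> (?Y k \<otimes> k (l j)))
            = (\<Oplus>j\<in>{..<n}. (?X g \<otimes> ?Y k \<otimes> g t) \<otimes> (g (l' j) \<otimes> k (l j)))"
          using l l' t g k by (intro finsum_congI) (auto simp: m_ac)
        also have "\<dots> = (?X g \<otimes> ?Y k \<otimes> g t) \<otimes> (\<Oplus>j\<in>{..<n}. g (l' j) \<otimes> k (l j))"
          using l l' t g k by (intro finsum_distrib_left[symmetric]) auto
        finally show "(\<Oplus>j\<in>{..<n}. ?X g \<otimes> g (l' j \<otimes> t) \<otimes> (?Y k \<otimes> k (l j)))
            = (if k = g then ?X g \<otimes> ?Y k \<otimes> g t else \<zero>)"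
          using dual[OF g k] g k t by auto
      qed (use g t in auto)
      also have "\<dots> = ?X g \<otimes> ?Y g \<otimes> g t"
        using g t fin_G by (subst finsum_delta) auto
      finally show "(\<Oplus>j\<in>{..<n}. \<Oplus>k\<in>carrier G. ?X g \<otimes> g (l' j \<otimes> t) \<otimes> (?Y k \<otimes> k (l j)))
          = ?X g \<otimes> ?Y g \<otimes> g t" .
    qed (use t in auto)
    finally show ?thesis .
  qed
  have "(\<Oplus>mj\<in>M \<times> {..<n}. orbit_sum (l' (snd mj) \<otimes> t) (fst mj) x \<otimes> orbit_sum (l (snd mj)) (fst mj) y)
      = (\<Oplus>m\<in>M. \<Oplus>j\<in>{..<n}. orbit_sum (l' j \<otimes> t) m x \<otimes> orbit_sum (l j) m y)"
    using l l' t oc fin_M by (subst finsum_Times) auto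
  also have "\<dots> = (\<Oplus>m\<in>M. \<Oplus>g\<in>carrier G. ind (act g m) x \<otimes> ind (act g m) y \<otimes> g t)"
    using inner t by (intro finsum_congI) (auto intro!: finsum_closedI)
  also have "\<dots> = (\<Oplus>g\<in>carrier G. \<Oplus>m\<in>M. ind (act g m) x \<otimes> ind (act g m) y \<otimes> g t)"
    using t fin_G fin_M by (intro finsum_swap) auto
  also have "\<dots> = (\<Oplus>g\<in>carrier G. ind x y \<otimes> g t)"
  proof (rule finsum_congI)
    fix g assume g: "g \<in> carrier G"
    \<comment> \<open>For fixed g the first indicator forces m to be g^-1 applied to x.\<close>
    have "(\<Oplus>m\<in>M. ind (act g m) x \<otimes> ind (act g m) y \<otimes> g t)
        = (\<Oplus>m\<in>M. if m = act (inv\<^bsub>G\<^esub> g) x then ind x y \<otimes> g t else \<zero>)"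
    proof (rule finsum_congI)
      fix m assume m: "m \<in> M"
      show "ind (act g m) x \<otimes> ind (act g m) y \<otimes> g t
          = (if m = act (inv\<^bsub>G\<^esub> g) x then ind x y \<otimes> g t else \<zero>)"
      proof (cases "act g m = x")
        case True
        then have "m = act (inv\<^bsub>G\<^esub> g) x" using act_eq_iff[OF g m x] by simp
        then show ?thesis using True g t by (simp add: ind_def)
      next
        case False
        then have "m \<noteq> act (inv\<^bsub>G\<^esub> g) x" using act_eq_iff[OF g m x] by simp
        then show ?thesis using False g t by (simp add: ind_def)
      qed
    qed (use g t in auto)
    also have "\<dots> = ind x y \<otimes> g t"
      using g t fin_M act_closed[of "inv\<^bsub>G\<^esub> g" x] x by (subst finsum_delta) auto
    finally show "(\<Oplus>m\<in>M. ind (act g m) x \<otimes> ind (act g m) y \<otimes> g t) = ind x y \<otimes> g t" .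
  qed (use t in auto)
  also have "\<dots> = ind x y \<otimes> trace t"
    unfolding trace_def using t fin_G by (intro finsum_distrib_left[symmetric]) auto
  finally show ?thesis using t by (simp add: ind_def)
qed

lemma exists_invariant_frame:
  obtains I :: "('m \<times> nat) set" and W h where "finite I"
    "\<And>i. i \<in> I \<Longrightarrow> W i \<in> invariants" "\<And>i. i \<in> I \<Longrightarrow> h i \<in> invariants"
    "\<And>x y. \<lbrakk>x \<in> M; y \<in> M\<rbrakk> \<Longrightarrow> (\<Oplus>i\<in>I. W i x \<otimes> h i y) = (if x = y then \<one> else \<zero>)"
proof -
  obtain n :: nat and l l' where l: "\<And>i. i < n \<Longrightarrow> l i \<in> carrier L" "\<And>i. i < n \<Longrightarrow> l' i \<in> carrier L"
    and dual: "\<And>g h. \<lbrakk>g \<in> carrier G; h \<in> carrier G\<rbrakk> \<Longrightarrow>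
       (\<Oplus>i\<in>{..<n}. g (l' i) \<otimes> h (l i)) = (if g = h then \<one> else \<zero>)"
    by (rule exists_dual_family[OF fin_G]) blast
  obtain t where t: "t \<in> carrier L" "trace t = \<one>"
    by (rule exists_trace_one[OF fin_G])
  show ?thesis
  proof (rule that[of "M \<times> {..<n}" "\<lambda>mj. orbit_sum (l' (snd mj) \<otimes> t) (fst mj)" "\<lambda>mj. orbit_sum (l (snd mj)) (fst mj)"])
    show "finite (M \<times> {..<n})" using fin_M by simp
    show "orbit_sum (l' (snd mj) \<otimes> t) (fst mj) \<in> invariants" "orbit_sum (l (snd mj)) (fst mj) \<in> invariants"
      if "mj \<in> M \<times> {..<n}" for mj
      using that l t by (auto intro!: orbit_sum_invariant)
  qed (rule orbit_sum_frame[OF l dual t])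
qed

text \<open>\<open>V\<close> is abstract, as the lemma serves both the descended Hopf algebra and
  the bare module in \<open>invariants_separate\<close>.\<close>

lemma invariants_framed_module:
  assumes V: "carrier V = invariants" "\<And>v w. v \<oplus>\<^bsub>V\<^esub> w = (\<lambda>m. v m \<oplus> w m)"
      "\<And>c v. c \<odot>\<^bsub>V\<^esub> v = (\<lambda>m. c \<otimes> v m)"
    and I: "finite I" "\<And>i. i \<in> I \<Longrightarrow> W i \<in> invariants" "\<And>i. i \<in> I \<Longrightarrow> h i \<in> invariants"
      "\<And>x y. \<lbrakk>x \<in> M; y \<in> M\<rbrakk> \<Longrightarrow> (\<Oplus>i\<in>I. W i x \<otimes> h i y) = (if x = y then \<one> else \<zero>)"
  shows "framed_module L K M V I W h"
proof (intro framed_module.intro framed_module_axioms.intro cring_axioms K_subring)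
  fix i v assume "i \<in> I" "v \<in> carrier V"
  then show "(\<Oplus>m\<in>M. W i m \<otimes> v m) \<in> K"
    using sum_invariant_in_K[OF invariants_times[OF I(2)]] V(1) by simp
qed (use V I fin_M act_closed in \<open>auto simp: K_fixed invariants_def\<close>)

text \<open>The invariants contain a frame, so they span the functions on M over L. Every later
  identity between matrix entries is verified by summing against an invariant.\<close>

lemma invariants_separate:
  assumes w: "\<And>m. m \<in> M \<Longrightarrow> w m \<in> carrier L" "\<And>m. m \<in> M \<Longrightarrow> w' m \<in> carrier L"
    and eq: "\<And>v. v \<in> invariants \<Longrightarrow> (\<Oplus>m\<in>M. v m \<otimes> w m) = (\<Oplus>m\<in>M. v m \<otimes> w' m)" and x: "x \<in> M"
  shows "w x = w' x"
proof -
  let ?V = "(free_module L M)\<lparr>carrier := invariants\<rparr>"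
  obtain I :: "('m \<times> nat) set" and W h where I: "finite I"
    "\<And>i. i \<in> I \<Longrightarrow> W i \<in> invariants" "\<And>i. i \<in> I \<Longrightarrow> h i \<in> invariants"
    "\<And>x y. \<lbrakk>x \<in> M; y \<in> M\<rbrakk> \<Longrightarrow> (\<Oplus>i\<in>I. W i x \<otimes> h i y) = (if x = y then \<one> else \<zero>)"
    by (rule exists_invariant_frame) blast
  interpret V: framed_module L K M ?V I W h
    by (rule invariants_framed_module[OF _ _ _ I]) simp_all
  show ?thesis using V.frame_separates[of w w' x] w eq x by simp
qed

end

section \<open>Hopf algebra maps and group-like elements\<close>

lemma (in ring) finsum_fiberwise:
  assumes S: "finite S" and P: "finite P" "\<phi> ` S \<subseteq> P" and u: "\<And>s. s \<in> S \<Longrightarrow> u s \<in> carrier R"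
    and e: "\<And>z. z \<in> P \<Longrightarrow> e z \<in> carrier R"
  shows "(\<Oplus>z\<in>P. (\<Oplus>s\<in>S. u s \<otimes> (if z = \<phi> s then \<one> else \<zero>)) \<otimes> e z) = (\<Oplus>s\<in>S. u s \<otimes> e (\<phi> s))"
proof -
  have "(\<Oplus>z\<in>P. (\<Oplus>s\<in>S. u s \<otimes> (if z = \<phi> s then \<one> else \<zero>)) \<otimes> e z)
      = (\<Oplus>z\<in>P. \<Oplus>s\<in>S. if z = \<phi> s then u s \<otimes> e z else \<zero>)"
  proof (rule finsum_congI)
    fix z assume z: "z \<in> P"
    have "(\<Oplus>s\<in>S. u s \<otimes> (if z = \<phi> s then \<one> else \<zero>)) \<otimes> e z
        = (\<Oplus>s\<in>S. u s \<otimes> (if z = \<phi> s then \<one> else \<zero>) \<otimes> e z)"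
      using S e[OF z] u by (intro finsum_distrib_right) auto
    also have "\<dots> = (\<Oplus>s\<in>S. if z = \<phi> s then u s \<otimes> e z else \<zero>)"
      using e[OF z] u by (intro finsum_congI) auto
    finally show "(\<Oplus>s\<in>S. u s \<otimes> (if z = \<phi> s then \<one> else \<zero>)) \<otimes> e z
        = (\<Oplus>s\<in>S. if z = \<phi> s then u s \<otimes> e z else \<zero>)" .
    show "(\<Oplus>s\<in>S. if z = \<phi> s then u s \<otimes> e z else \<zero>) \<in> carrier R"
      using e[OF z] u by (intro finsum_closedI) auto
  qed
  also have "\<dots> = (\<Oplus>s\<in>S. \<Oplus>z\<in>P. if z = \<phi> s then u s \<otimes> e z else \<zero>)"
    using S P e u by (intro finsum_swap) auto
  also have "\<dots> = (\<Oplus>s\<in>S. u s \<otimes> e (\<phi> s))"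
  proof (rule finsum_congI)
    fix s assume s: "s \<in> S"
    then have "\<phi> s \<in> P" using P by auto
    then show "(\<Oplus>z\<in>P. if z = \<phi> s then u s \<otimes> e z else \<zero>) = u s \<otimes> e (\<phi> s)"
      using P s e u finsum_delta[of P "\<phi> s" "\<lambda>z. u s \<otimes> e z"] by simp
  qed (use e u P in auto)
  finally show ?thesis .
qed

text \<open>The coefficient at z of a product in the group algebra. The condition z = x y is an
  indicator inside nested sums, so that each variable can be transported along a map
  separately.\<close>

definition convolution ::
  "('a, 'l) ring_scheme \<Rightarrow> 'm set \<Rightarrow> ('m \<Rightarrow> 'm \<Rightarrow> 'm) \<Rightarrow> ('m \<Rightarrow> 'a) \<Rightarrow> ('m \<Rightarrow> 'a) \<Rightarrow> 'm \<Rightarrow> 'a" where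
  "convolution L M mul a b z =
     (\<Oplus>\<^bsub>L\<^esub>x\<in>M. a x \<otimes>\<^bsub>L\<^esub> (\<Oplus>\<^bsub>L\<^esub>y\<in>M. b y \<otimes>\<^bsub>L\<^esub> (if z = mul x y then \<one>\<^bsub>L\<^esub> else \<zero>\<^bsub>L\<^esub>)))"

lemma (in ring) finsum_convolution:
  assumes M: "finite M" "\<And>x y. \<lbrakk>x \<in> M; y \<in> M\<rbrakk> \<Longrightarrow> mul x y \<in> M"
    and a: "\<And>x. x \<in> M \<Longrightarrow> a x \<in> carrier R" and b: "\<And>x. x \<in> M \<Longrightarrow> b x \<in> carrier R"
    and e: "\<And>x. x \<in> M \<Longrightarrow> e x \<in> carrier R"
  shows "(\<Oplus>z\<in>M. convolution R M mul a b z \<otimes> e z) = (\<Oplus>x\<in>M. a x \<otimes> (\<Oplus>y\<in>M. b y \<otimes> e (mul x y)))"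
proof -
  let ?c = "\<lambda>x z. \<Oplus>y\<in>M. b y \<otimes> (if z = mul x y then \<one> else \<zero>)"
  have c: "?c x z \<in> carrier R" for x z using b by (intro finsum_closedI) auto
  have "(\<Oplus>z\<in>M. convolution R M mul a b z \<otimes> e z) = (\<Oplus>z\<in>M. \<Oplus>x\<in>M. a x \<otimes> (?c x z \<otimes> e z))"
  proof (rule finsum_congI)
    fix z assume z: "z \<in> M"
    have "convolution R M mul a b z \<otimes> e z = (\<Oplus>x\<in>M. a x \<otimes> ?c x z \<otimes> e z)"
      unfolding convolution_def using M a c e z by (intro finsum_distrib_right) auto
    also have "\<dots> = (\<Oplus>x\<in>M. a x \<otimes> (?c x z \<otimes> e z))"
      using a c e z by (intro finsum_congI) (auto simp: m_assoc)
    finally show "convolution R M mul a b z \<otimes> e z = (\<Oplus>x\<in>M. a x \<otimes> (?c x z \<otimes> e z))" .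
  qed (use a c e in \<open>auto intro!: finsum_closedI\<close>)
  also have "\<dots> = (\<Oplus>x\<in>M. \<Oplus>z\<in>M. a x \<otimes> (?c x z \<otimes> e z))"
    using M(1) a c e by (intro finsum_swap) auto
  also have "\<dots> = (\<Oplus>x\<in>M. a x \<otimes> (\<Oplus>y\<in>M. b y \<otimes> e (mul x y)))"
  proof (rule finsum_congI)
    fix x assume x: "x \<in> M"
    have "(\<Oplus>z\<in>M. a x \<otimes> (?c x z \<otimes> e z)) = a x \<otimes> (\<Oplus>z\<in>M. ?c x z \<otimes> e z)"
      using M(1) a c e x by (intro finsum_distrib_left[symmetric]) auto
    also have "(\<Oplus>z\<in>M. ?c x z \<otimes> e z) = (\<Oplus>y\<in>M. b y \<otimes> e (mul x y))"
      using M b e x by (intro finsum_fiberwise) auto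
    finally show "(\<Oplus>z\<in>M. a x \<otimes> (?c x z \<otimes> e z)) = a x \<otimes> (\<Oplus>y\<in>M. b y \<otimes> e (mul x y))" .
  qed (use a b e M in \<open>auto intro!: finsum_closedI m_closed\<close>)
  finally show ?thesis .
qed

locale descent_pair = A: descent_set L G K M act + B: descent_set L G K M' act'
  for L :: "('a, 'l) ring_scheme" (structure) and G :: "('a \<Rightarrow> 'a) monoid" and K :: "'a set"
    and M :: "'m set" and act :: "('a \<Rightarrow> 'a) \<Rightarrow> 'm \<Rightarrow> 'm"
    and M' :: "'k set" and act' :: "('a \<Rightarrow> 'a) \<Rightarrow> 'k \<Rightarrow> 'k"
begin

text \<open>What a Hopf isomorphism provides, restated for functions. In place of cosets,
  \<open>f_comult\<close> speaks of one representative u of the comultiplication of a: its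
  coefficients form the diagonal matrix of a, and those of its image under f \<otimes> f the
  diagonal matrix of f a.\<close>

context
  fixes V :: "('a, 'm \<Rightarrow> 'a, 'e) module_scheme" and mul mul' f
  assumes V: "carrier V = A.invariants" "\<And>v w. v \<oplus>\<^bsub>V\<^esub> w = (\<lambda>m. v m \<oplus> w m)"
      "\<And>c v. c \<odot>\<^bsub>V\<^esub> v = (\<lambda>m. c \<otimes> v m)"
    and mul: "\<And>x y. \<lbrakk>x \<in> M; y \<in> M\<rbrakk> \<Longrightarrow> mul x y \<in> M"
    and mul': "\<And>x y. \<lbrakk>x \<in> M'; y \<in> M'\<rbrakk> \<Longrightarrow> mul' x y \<in> M'"
    and f_closed: "\<And>a. a \<in> A.invariants \<Longrightarrow> f a \<in> B.invariants"
    and f_surj: "\<And>b. b \<in> B.invariants \<Longrightarrow> \<exists>a\<in>A.invariants. f a = b"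
    and f_add: "\<And>a b. \<lbrakk>a \<in> A.invariants; b \<in> A.invariants\<rbrakk>
       \<Longrightarrow> f (\<lambda>m. a m \<oplus> b m) = (\<lambda>m. f a m \<oplus> f b m)"
    and f_smult: "\<And>c a. \<lbrakk>c \<in> K; a \<in> A.invariants\<rbrakk> \<Longrightarrow> f (\<lambda>m. c \<otimes> a m) = (\<lambda>m. c \<otimes> f a m)"
    and conv_closed: "\<And>a b. \<lbrakk>a \<in> A.invariants; b \<in> A.invariants\<rbrakk> \<Longrightarrow> convolution L M mul a b \<in> A.invariants"
    and f_conv: "\<And>a b. \<lbrakk>a \<in> A.invariants; b \<in> A.invariants\<rbrakk>
       \<Longrightarrow> f (convolution L M mul a b) = convolution L M' mul' (f a) (f b)"
    and f_counit: "\<And>a. a \<in> A.invariants \<Longrightarrow> (\<Oplus>x\<in>M'. f a x) = (\<Oplus>m\<in>M. a m)"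
    and f_comult: "\<And>a. a \<in> A.invariants \<Longrightarrow>
       \<exists>u\<in>carrier (free_module (L\<lparr>carrier := K\<rparr>) (carrier V \<times> carrier V)).
         (\<forall>x\<in>M. \<forall>y\<in>M. tensor_coeff L u x y = (if x = y then a x else \<zero>)) \<and>
         (\<forall>x\<in>M'. \<forall>y\<in>M'. (\<Oplus>ab\<in>{ab. u ab \<noteq> \<zero>}. u ab \<otimes> (f (fst ab) x \<otimes> f (snd ab) y))
                          = (if x = y then f a x else \<zero>))"
begin

lemma f_value: "a \<in> A.invariants \<Longrightarrow> f a x \<in> carrier L"
  using B.invariants_value[OF f_closed] .

text \<open>For fixed x, sending a to f a x is a K-linear functional on the invariants, so
  \<open>linear_functional_repr\<close> supplies column x.\<close>

lemma exists_matrix: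
  obtains \<Phi> where "\<And>m x. m \<in> M \<Longrightarrow> \<Phi> m x \<in> carrier L"
    "\<And>a x. a \<in> A.invariants \<Longrightarrow> f a x = (\<Oplus>m\<in>M. a m \<otimes> \<Phi> m x)"
proof -
  obtain I :: "('m \<times> nat) set" and W h where I: "finite I"
    "\<And>i. i \<in> I \<Longrightarrow> W i \<in> A.invariants" "\<And>i. i \<in> I \<Longrightarrow> h i \<in> A.invariants"
    "\<And>x y. \<lbrakk>x \<in> M; y \<in> M\<rbrakk> \<Longrightarrow> (\<Oplus>i\<in>I. W i x \<otimes> h i y) = (if x = y then \<one> else \<zero>)"
    by (rule A.exists_invariant_frame) blast
  interpret FA: framed_module L K M V I W h
    by (rule A.invariants_framed_module[OF V I])
  show ?thesis
  proof (rule that[of "\<lambda>m x. \<Oplus>i\<in>I. W i m \<otimes> f (h i) x"])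
    show "(\<Oplus>i\<in>I. W i m \<otimes> f (h i) x) \<in> carrier L" for m x
      using I A.invariants_value f_value by (intro A.finsum_closedI) auto
    show "f a x = (\<Oplus>m\<in>M. a m \<otimes> (\<Oplus>i\<in>I. W i m \<otimes> f (h i) x))" if "a \<in> A.invariants" for a x
      using FA.linear_functional_repr[of "\<lambda>v. f v x" a] f_add f_smult f_value that unfolding V(1) by simp
  qed
qed

text \<open>Summing against an invariant a turns the claim into an equation for the coefficient of
  the comultiplication of f a at (x, y). Expanding f in both slots by \<Phi> gives a double sum over
  M, and the diagonal form of the comultiplication of a collapses it.\<close>

lemma matrix_idempotent:
  assumes \<Phi>: "\<And>m x. m \<in> M \<Longrightarrow> \<Phi> m x \<in> carrier L"
    "\<And>a x. a \<in> A.invariants \<Longrightarrow> f a x = (\<Oplus>m\<in>M. a m \<otimes> \<Phi> m x)"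
    and m: "m \<in> M" and x: "x \<in> M'" and y: "y \<in> M'"
  shows "\<Phi> m x \<otimes> \<Phi> m y = (if x = y then \<Phi> m x else \<zero>)"
proof (rule A.invariants_separate[of "\<lambda>m. \<Phi> m x \<otimes> \<Phi> m y" "\<lambda>m. if x = y then \<Phi> m x else \<zero>"])
  fix a assume a: "a \<in> A.invariants"
  have aL: "a m \<in> carrier L" for m by (rule A.invariants_value[OF a])
  from f_comult[OF a] obtain u where u: "u \<in> carrier (free_module (L\<lparr>carrier := K\<rparr>) (carrier V \<times> carrier V))"
    and E: "\<forall>x\<in>M. \<forall>y\<in>M. tensor_coeff L u x y = (if x = y then a x else \<zero>)"
    and fE: "\<forall>x\<in>M'. \<forall>y\<in>M'. (\<Oplus>ab\<in>{ab. u ab \<noteq> \<zero>}. u ab \<otimes> (f (fst ab) x \<otimes> f (snd ab) y))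
                          = (if x = y then f a x else \<zero>)"
    by (elim bexE conjE)
  let ?S = "{ab. u ab \<noteq> \<zero>}"
  have S: "finite ?S" using u by simp
  have uL: "u ab \<in> carrier L" for ab
    using cring.free_module_value[OF A.subring_is_cring[OF A.K_subring] u, of ab] by simp
  have inv: "fst ab \<in> A.invariants" "snd ab \<in> A.invariants" if "ab \<in> ?S" for ab
    using u that V(1) by (cases ab, auto)+
  have v: "fst ab z \<in> carrier L" "snd ab z \<in> carrier L" if "ab \<in> ?S" for ab z
    using A.invariants_value inv[OF that] by auto
  have fa: "(\<Oplus>m\<in>M. a m \<otimes> (if x = y then \<Phi> m x else \<zero>)) = (if x = y then f a x else \<zero>)"
    using \<Phi>(2)[OF a, of y] aL by (cases "x = y") (simp_all add: A.finsum_eq_zeroI)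
  have "(if x = y then f a x else \<zero>) = (\<Oplus>ab\<in>?S. u ab \<otimes> (f (fst ab) x \<otimes> f (snd ab) y))"
    using fE x y by simp
  also have "\<dots> = (\<Oplus>ab\<in>?S. \<Oplus>m\<in>M. \<Oplus>k\<in>M. u ab \<otimes> (fst ab m \<otimes> snd ab k) \<otimes> (\<Phi> m x \<otimes> \<Phi> k y))"
  proof (rule A.finsum_congI)
    fix ab assume ab: "ab \<in> ?S"
    have sy: "(\<Oplus>k\<in>M. snd ab k \<otimes> \<Phi> k y) \<in> carrier L" using v[OF ab] \<Phi>(1) by (intro A.finsum_closedI) auto
    have "u ab \<otimes> (f (fst ab) x \<otimes> f (snd ab) y)
        = u ab \<otimes> ((\<Oplus>m\<in>M. fst ab m \<otimes> \<Phi> m x) \<otimes> (\<Oplus>k\<in>M. snd ab k \<otimes> \<Phi> k y))"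
      using \<Phi>(2) inv[OF ab] by simp
    also have "\<dots> = u ab \<otimes> (\<Oplus>m\<in>M. fst ab m \<otimes> \<Phi> m x \<otimes> (\<Oplus>k\<in>M. snd ab k \<otimes> \<Phi> k y))"
      using v[OF ab] \<Phi>(1) sy A.fin_M by (subst A.finsum_distrib_right) auto
    also have "\<dots> = u ab \<otimes> (\<Oplus>m\<in>M. \<Oplus>k\<in>M. fst ab m \<otimes> \<Phi> m x \<otimes> (snd ab k \<otimes> \<Phi> k y))"
      using v[OF ab] \<Phi>(1) A.fin_M
      by (intro arg_cong[where f = "\<lambda>z. u ab \<otimes> z"] A.finsum_congI A.finsum_distrib_left) (auto intro!: A.finsum_closedI)
    also have "\<dots> = (\<Oplus>m\<in>M. u ab \<otimes> (\<Oplus>k\<in>M. fst ab m \<otimes> \<Phi> m x \<otimes> (snd ab k \<otimes> \<Phi> k y)))"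
      using v[OF ab] \<Phi>(1) A.fin_M uL by (intro A.finsum_distrib_left) (auto intro!: A.finsum_closedI)
    also have "\<dots> = (\<Oplus>m\<in>M. \<Oplus>k\<in>M. u ab \<otimes> (fst ab m \<otimes> \<Phi> m x \<otimes> (snd ab k \<otimes> \<Phi> k y)))"
      using v[OF ab] \<Phi>(1) A.fin_M uL by (intro A.finsum_congI A.finsum_distrib_left) (auto intro!: A.finsum_closedI)
    also have "\<dots> = (\<Oplus>m\<in>M. \<Oplus>k\<in>M. u ab \<otimes> (fst ab m \<otimes> snd ab k) \<otimes> (\<Phi> m x \<otimes> \<Phi> k y))"
      using v[OF ab] \<Phi>(1) uL by (intro A.finsum_congI) (auto simp: A.m_ac intro!: A.finsum_closedI)
    finally show "u ab \<otimes> (f (fst ab) x \<otimes> f (snd ab) y)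
        = (\<Oplus>m\<in>M. \<Oplus>k\<in>M. u ab \<otimes> (fst ab m \<otimes> snd ab k) \<otimes> (\<Phi> m x \<otimes> \<Phi> k y))" .
    show "(\<Oplus>m\<in>M. \<Oplus>k\<in>M. u ab \<otimes> (fst ab m \<otimes> snd ab k) \<otimes> (\<Phi> m x \<otimes> \<Phi> k y)) \<in> carrier L"
      using v[OF ab] \<Phi>(1) uL by (intro A.finsum_closedI) auto
  qed
  also have "\<dots> = (\<Oplus>m\<in>M. \<Oplus>ab\<in>?S. \<Oplus>k\<in>M. u ab \<otimes> (fst ab m \<otimes> snd ab k) \<otimes> (\<Phi> m x \<otimes> \<Phi> k y))"
    by (rule A.finsum_swap[OF S A.fin_M]) (use v \<Phi>(1) uL in \<open>intro A.finsum_closedI A.m_closed\<close>)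
  also have "\<dots> = (\<Oplus>m\<in>M. \<Oplus>k\<in>M. \<Oplus>ab\<in>?S. u ab \<otimes> (fst ab m \<otimes> snd ab k) \<otimes> (\<Phi> m x \<otimes> \<Phi> k y))"
    by (intro A.finsum_congI A.finsum_swap[OF S A.fin_M] A.finsum_closedI A.m_closed) (use v \<Phi>(1) uL in blast)+
  \<comment> \<open>With the sum over the support of u innermost, the coefficient of u at (m, k)
    appears as a factor.\<close>
  also have "\<dots> = (\<Oplus>m\<in>M. \<Oplus>k\<in>M. tensor_coeff L u m k \<otimes> (\<Phi> m x \<otimes> \<Phi> k y))"
    unfolding tensor_coeff_def
    by (intro A.finsum_congI A.finsum_distrib_right[symmetric] A.finsum_closedI A.m_closed S) (use v \<Phi>(1) uL in blast)+
  also have "\<dots> = (\<Oplus>m\<in>M. \<Oplus>k\<in>M. if k = m then a m \<otimes> (\<Phi> m x \<otimes> \<Phi> k y) else \<zero>)"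
    using E \<Phi>(1) aL by (intro A.finsum_congI) (auto intro!: A.finsum_closedI)
  also have "\<dots> = (\<Oplus>m\<in>M. a m \<otimes> (\<Phi> m x \<otimes> \<Phi> m y))"
    using \<Phi>(1) aL A.fin_M by (intro A.finsum_congI) (auto simp: A.finsum_delta)
  finally show "(\<Oplus>m\<in>M. a m \<otimes> (\<Phi> m x \<otimes> \<Phi> m y)) = (\<Oplus>m\<in>M. a m \<otimes> (if x = y then \<Phi> m x else \<zero>))"
    using fa by simp
qed (use \<Phi>(1) m in auto)

text \<open>Summed against an invariant a, the left side is the counit of f a and the right side the
  counit of a.\<close>

lemma matrix_row_sum:
  assumes \<Phi>: "\<And>m x. m \<in> M \<Longrightarrow> \<Phi> m x \<in> carrier L"
    "\<And>a x. a \<in> A.invariants \<Longrightarrow> f a x = (\<Oplus>m\<in>M. a m \<otimes> \<Phi> m x)"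
    and m: "m \<in> M"
  shows "(\<Oplus>x\<in>M'. \<Phi> m x) = \<one>"
proof (rule A.invariants_separate[of "\<lambda>m. \<Oplus>x\<in>M'. \<Phi> m x" "\<lambda>_. \<one>"])
  fix a assume a: "a \<in> A.invariants"
  have aL: "a m \<in> carrier L" for m by (rule A.invariants_value[OF a])
  have "(\<Oplus>m\<in>M. a m \<otimes> (\<Oplus>x\<in>M'. \<Phi> m x)) = (\<Oplus>m\<in>M. \<Oplus>x\<in>M'. a m \<otimes> \<Phi> m x)"
    using \<Phi>(1) aL B.fin_M by (intro A.finsum_congI A.finsum_distrib_left) (auto intro!: A.finsum_closedI)
  also have "\<dots> = (\<Oplus>x\<in>M'. \<Oplus>m\<in>M. a m \<otimes> \<Phi> m x)"
    using \<Phi>(1) aL B.fin_M A.fin_M by (intro A.finsum_swap) auto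
  also have "\<dots> = (\<Oplus>x\<in>M'. f a x)"
    using \<Phi>(2)[OF a] f_value[OF a] by (intro A.finsum_congI) auto
  also have "\<dots> = (\<Oplus>m\<in>M. a m \<otimes> \<one>)"
    using f_counit[OF a] aL by simp
  finally show "(\<Oplus>m\<in>M. a m \<otimes> (\<Oplus>x\<in>M'. \<Phi> m x)) = (\<Oplus>m\<in>M. a m \<otimes> \<one>)" .
qed (use \<Phi>(1) m in \<open>auto intro!: A.finsum_closedI\<close>)

lemma exists_group_like_map:
  obtains \<phi> where "\<And>m. m \<in> M \<Longrightarrow> \<phi> m \<in> M'"
    "\<And>a x. \<lbrakk>a \<in> A.invariants; x \<in> M'\<rbrakk> \<Longrightarrow> f a x = (\<Oplus>m\<in>M. a m \<otimes> (if x = \<phi> m then \<one> else \<zero>))"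
proof -
  obtain \<Phi> where \<Phi>: "\<And>m x. m \<in> M \<Longrightarrow> \<Phi> m x \<in> carrier L"
    "\<And>a x. a \<in> A.invariants \<Longrightarrow> f a x = (\<Oplus>m\<in>M. a m \<otimes> \<Phi> m x)"
    by (rule exists_matrix) blast
  have idem: "\<Phi> m x \<otimes> \<Phi> m y = (if x = y then \<Phi> m x else \<zero>)" if "m \<in> M" "x \<in> M'" "y \<in> M'" for m x y
    using that by (intro matrix_idempotent[of \<Phi>, OF \<Phi>])
  have row_sum: "(\<Oplus>x\<in>M'. \<Phi> m x) = \<one>" if "m \<in> M" for m
    using that by (intro matrix_row_sum[of \<Phi>, OF \<Phi>])
  have ex: "\<exists>x\<in>M'. \<Phi> m x \<noteq> \<zero>" if m: "m \<in> M" for m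
  proof (rule ccontr)
    assume "\<not> ?thesis"
    then have "(\<Oplus>x\<in>M'. \<Phi> m x) = \<zero>" by (intro A.finsum_eq_zeroI) auto
    then show False using row_sum[OF m] by simp
  qed
  define \<phi> where "\<phi> m = (SOME x. x \<in> M' \<and> \<Phi> m x \<noteq> \<zero>)" for m
  have \<phi>: "\<phi> m \<in> M'" "\<Phi> m (\<phi> m) \<noteq> \<zero>" if "m \<in> M" for m
    using someI_ex[of "\<lambda>x. x \<in> M' \<and> \<Phi> m x \<noteq> \<zero>"] ex[OF that] unfolding \<phi>_def by blast+
  \<comment> \<open>A nonzero idempotent of a field is 1 by cancellation; orthogonality to it then
    makes the other entries of the row zero.\<close>
  have row: "\<Phi> m x = (if x = \<phi> m then \<one> else \<zero>)" if m: "m \<in> M" and x: "x \<in> M'" for m x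
  proof -
    have "\<Phi> m (\<phi> m) \<otimes> \<Phi> m (\<phi> m) = \<Phi> m (\<phi> m) \<otimes> \<one>"
      using idem[OF m \<phi>(1)[OF m] \<phi>(1)[OF m]] \<Phi>(1)[OF m] by simp
    then have one: "\<Phi> m (\<phi> m) = \<one>"
      by (rule iffD1[OF A.m_lcancel[OF \<phi>(2)[OF m] \<Phi>(1)[OF m] \<Phi>(1)[OF m] A.one_closed]])
    show ?thesis
    proof (cases "x = \<phi> m")
      case False
      then show ?thesis
        using idem[OF m \<phi>(1)[OF m] x] one \<Phi>(1)[OF m] by auto
    qed (simp add: one)
  qed
  show ?thesis
  proof (rule that[of \<phi>])
    show "f a x = (\<Oplus>m\<in>M. a m \<otimes> (if x = \<phi> m then \<one> else \<zero>))" if "a \<in> A.invariants" "x \<in> M'" for a x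
      unfolding \<Phi>(2)[OF that(1)] using row that A.invariants_value by (intro A.finsum_congI) auto
  qed (rule \<phi>(1))
qed

lemma ind_eq_iff: "(if P then \<one> else \<zero>) = (if Q then \<one> else \<zero>) \<longleftrightarrow> P = Q"
  by auto

theorem exists_equivariant_hom:
  obtains \<phi> where "\<phi> ` M = M'"
    "\<And>x y. \<lbrakk>x \<in> M; y \<in> M\<rbrakk> \<Longrightarrow> \<phi> (mul x y) = mul' (\<phi> x) (\<phi> y)"
    "\<And>g m. \<lbrakk>g \<in> carrier G; m \<in> M\<rbrakk> \<Longrightarrow> \<phi> (act g m) = act' g (\<phi> m)"
proof -
  obtain \<phi> where \<phi>: "\<And>m. m \<in> M \<Longrightarrow> \<phi> m \<in> M'"
    and f: "\<And>a x. \<lbrakk>a \<in> A.invariants; x \<in> M'\<rbrakk> \<Longrightarrow> f a x = (\<Oplus>m\<in>M. a m \<otimes> (if x = \<phi> m then \<one> else \<zero>))"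
    by (rule exists_group_like_map) blast
  let ?i = "\<lambda>P. if P then \<one> else \<zero>"
  \<comment> \<open>f is the pushforward along \<phi>, so a test function on M' is pulled back to
    M.\<close>
  have push: "(\<Oplus>x\<in>M'. f a x \<otimes> e x) = (\<Oplus>m\<in>M. a m \<otimes> e (\<phi> m))"
    if a: "a \<in> A.invariants" and e: "\<And>x. x \<in> M' \<Longrightarrow> e x \<in> carrier L" for a e
  proof -
    have "(\<Oplus>x\<in>M'. f a x \<otimes> e x) = (\<Oplus>x\<in>M'. (\<Oplus>m\<in>M. a m \<otimes> ?i (x = \<phi> m)) \<otimes> e x)"
      using f[OF a] e A.invariants_value[OF a] by (intro A.finsum_congI) (auto intro!: A.finsum_closedI A.m_closed)
    also have "\<dots> = (\<Oplus>m\<in>M. a m \<otimes> e (\<phi> m))"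
      using A.fin_M B.fin_M \<phi> A.invariants_value[OF a] e by (intro A.finsum_fiberwise) auto
    finally show ?thesis .
  qed
  \<comment> \<open>If \<phi> missed x, every f a would vanish at x. As f is onto, all invariants on
    M' would, against separation.\<close>
  have img: "\<phi> ` M = M'"
  proof (rule ccontr)
    assume "\<phi> ` M \<noteq> M'"
    then obtain x where x: "x \<in> M'" "x \<notin> \<phi> ` M" using \<phi> by blast
    have "?i (x = x) = \<zero>"
    proof (rule B.invariants_separate[of "\<lambda>y. ?i (y = x)" "\<lambda>_. \<zero>" x])
      fix b assume b: "b \<in> B.invariants"
      then obtain a where a: "a \<in> A.invariants" "f a = b" using f_surj by blast
      have "(\<Oplus>m\<in>M'. b m \<otimes> ?i (m = x)) = (\<Oplus>m\<in>M. a m \<otimes> ?i (\<phi> m = x))"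
        using push[OF a(1), of "\<lambda>y. ?i (y = x)"] a(2) by simp
      also have "\<dots> = \<zero>"
        using x A.invariants_value[OF a(1)] by (intro A.finsum_eq_zeroI) auto
      also have "\<dots> = (\<Oplus>m\<in>M'. b m \<otimes> \<zero>)"
        using B.invariants_value[OF b] by (intro A.finsum_eq_zeroI[symmetric]) auto
      finally show "(\<Oplus>m\<in>M'. b m \<otimes> ?i (m = x)) = (\<Oplus>m\<in>M'. b m \<otimes> \<zero>)" .
    qed (use x in auto)
    then show False by simp
  qed
  have hom: "\<phi> (mul x y) = mul' (\<phi> x) (\<phi> y)" if x: "x \<in> M" and y: "y \<in> M" for x y
  proof -
    let ?z = "\<phi> (mul x y)"
    have z: "?z \<in> M'" using \<phi> mul x y by blast
    \<comment> \<open>Both sides are functions of x and y, tested against b in y and then against a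
      in x. The resulting sums are values at \<open>?z\<close> of the image of a product and of the
      product of the images.\<close>
    have "?i (?z = \<phi> (mul x y)) = ?i (?z = mul' (\<phi> x) (\<phi> y))"
    proof (rule A.invariants_separate[of "\<lambda>y. ?i (?z = \<phi> (mul x y))" "\<lambda>y. ?i (?z = mul' (\<phi> x) (\<phi> y))" y])
      fix b assume b: "b \<in> A.invariants"
      note bL = A.invariants_value[OF b]
      show "(\<Oplus>y\<in>M. b y \<otimes> ?i (?z = \<phi> (mul x y))) = (\<Oplus>y\<in>M. b y \<otimes> ?i (?z = mul' (\<phi> x) (\<phi> y)))"
      proof (rule A.invariants_separate[of "\<lambda>x. \<Oplus>y\<in>M. b y \<otimes> ?i (?z = \<phi> (mul x y))"
            "\<lambda>x. \<Oplus>y\<in>M. b y \<otimes> ?i (?z = mul' (\<phi> x) (\<phi> y))" x])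
        fix a assume a: "a \<in> A.invariants"
        note aL = A.invariants_value[OF a]
        have "(\<Oplus>x\<in>M. a x \<otimes> (\<Oplus>y\<in>M. b y \<otimes> ?i (?z = \<phi> (mul x y))))
            = (\<Oplus>z\<in>M. convolution L M mul a b z \<otimes> ?i (?z = \<phi> z))"
          using A.fin_M mul aL bL by (intro A.finsum_convolution[symmetric]) auto
        also have "\<dots> = f (convolution L M mul a b) ?z"
          using f[OF conv_closed[OF a b] z] by simp
        also have "\<dots> = convolution L M' mul' (f a) (f b) ?z"
          using f_conv[OF a b] by simp
        also have "\<dots> = (\<Oplus>u\<in>M. a u \<otimes> (\<Oplus>v\<in>M'. f b v \<otimes> ?i (?z = mul' (\<phi> u) v)))"
          unfolding convolution_def using f_value[OF b]
          by (intro push[OF a, of "\<lambda>u. \<Oplus>v\<in>M'. f b v \<otimes> ?i (?z = mul' u v)"]) (auto intro!: A.finsum_closedI)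
        also have "\<dots> = (\<Oplus>u\<in>M. a u \<otimes> (\<Oplus>v\<in>M. b v \<otimes> ?i (?z = mul' (\<phi> u) (\<phi> v))))"
        proof (rule A.finsum_congI)
          fix u assume "u \<in> M"
          show "a u \<otimes> (\<Oplus>v\<in>M'. f b v \<otimes> ?i (?z = mul' (\<phi> u) v))
              = a u \<otimes> (\<Oplus>v\<in>M. b v \<otimes> ?i (?z = mul' (\<phi> u) (\<phi> v)))"
            using push[OF b, of "\<lambda>v. ?i (?z = mul' (\<phi> u) v)"] by simp
        qed (use aL bL in \<open>auto intro!: A.finsum_closedI A.m_closed\<close>)
        finally show "(\<Oplus>x\<in>M. a x \<otimes> (\<Oplus>y\<in>M. b y \<otimes> ?i (?z = \<phi> (mul x y))))
            = (\<Oplus>x\<in>M. a x \<otimes> (\<Oplus>y\<in>M. b y \<otimes> ?i (?z = mul' (\<phi> x) (\<phi> y))))" .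
      qed (use x bL in \<open>auto intro!: A.finsum_closedI\<close>)
    qed (use y in auto)
    then show ?thesis using ind_eq_iff[of True "?z = mul' (\<phi> x) (\<phi> y)"] by simp
  qed
  have equiv: "\<phi> (act g m) = act' g (\<phi> m)" if g: "g \<in> carrier G" and m: "m \<in> M" for g m
  proof -
    let ?x = "\<phi> m"
    have x: "?x \<in> M'" "act' g ?x \<in> M'" using \<phi>[OF m] B.act_closed[OF g] by auto
    have "?i (act' g ?x = \<phi> (act g m)) = ?i (?x = \<phi> m)"
    proof (rule A.invariants_separate[of "\<lambda>m. ?i (act' g ?x = \<phi> (act g m))" "\<lambda>m. ?i (?x = \<phi> m)" m])
      fix a assume a: "a \<in> A.invariants"
      note aL = A.invariants_value[OF a]
      \<comment> \<open>Applying g to this sum and reindexing by the action gives f a at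
        \<open>act' g ?x\<close>, which is g of f a at \<open>?x\<close>. Since g is injective, the
        sum is f a at \<open>?x\<close>.\<close>
      let ?s = "\<Oplus>m\<in>M. a m \<otimes> ?i (act' g ?x = \<phi> (act g m))"
      have s: "?s \<in> carrier L" "f a ?x \<in> carrier L" using aL f_value[OF a] by (auto intro!: A.finsum_closedI)
      have "g ?s = (\<Oplus>m\<in>M. g (a m \<otimes> ?i (act' g ?x = \<phi> (act g m))))"
        using g aL A.fin_M by (intro A.aut_finsum) auto
      also have "\<dots> = (\<Oplus>m\<in>M. a (act g m) \<otimes> ?i (act' g ?x = \<phi> (act g m)))"
        using g aL A.invariants_act[OF a g] by (intro A.finsum_congI) auto
      also have "\<dots> = (\<Oplus>m\<in>M. a m \<otimes> ?i (act' g ?x = \<phi> m))"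
        using A.finsum_reindex_bij[OF A.bij_act[OF g], of "\<lambda>m. a m \<otimes> ?i (act' g ?x = \<phi> m)"] aL by simp
      also have "\<dots> = g (f a ?x)"
        using f[OF a x(2)] B.invariants_act[OF f_closed[OF a] g x(1)] by simp
      finally have "(inv\<^bsub>G\<^esub> g) (g ?s) = (inv\<^bsub>G\<^esub> g) (g (f a ?x))" by simp
      then have "?s = f a ?x"
        using A.aut_mult[of "inv\<^bsub>G\<^esub> g" g] g s A.aut_one by simp
      then show "?s = (\<Oplus>m\<in>M. a m \<otimes> ?i (?x = \<phi> m))"
        using f[OF a x(1)] by simp
    qed (use m in auto)
    then show ?thesis using ind_eq_iff[of "act' g ?x = \<phi> (act g m)" True] by simp
  qed
  show ?thesis by (rule that[OF img hom equiv])
qed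

end

end

section \<open>Cyclic groups of prime power order\<close>

lemma (in group) pow_eq_iff_cong:
  fixes i j :: nat
  assumes "x \<in> carrier G"
  shows "x [^] i = x [^] j \<longleftrightarrow> [i = j] (mod ord x)"
proof -
  have "x [^] i = x [^] j \<longleftrightarrow> x [^] int i = x [^] int j"
    using assms by (simp add: int_pow_int)
  also have "\<dots> \<longleftrightarrow> [int j = int i] (mod int (ord x))"
    using assms by (simp add: int_pow_eq cong_iff_dvd_diff)
  also have "\<dots> \<longleftrightarrow> [i = j] (mod ord x)"
    unfolding cong_int_iff by (rule cong_sym_eq)
  finally show ?thesis .
qed

lemma BijGroup_sel [simp]:
  "carrier (BijGroup S) = Bij S" "\<one>\<^bsub>BijGroup S\<^esub> = (\<lambda>x\<in>S. x)"
  "\<lbrakk>f \<in> Bij S; g \<in> Bij S\<rbrakk> \<Longrightarrow> f \<otimes>\<^bsub>BijGroup S\<^esub> g = compose S f g"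
  by (simp_all add: BijGroup_def)

lemma Bij_closed: "\<lbrakk>f \<in> Bij S; x \<in> S\<rbrakk> \<Longrightarrow> f x \<in> S"
  using Bij_imp_funcset by blast

lemma Bij_eqI: "\<lbrakk>f \<in> Bij S; g \<in> Bij S; \<And>x. x \<in> S \<Longrightarrow> f x = g x\<rbrakk> \<Longrightarrow> f = g"
  using Bij_imp_extensional extensionalityI by blast

lemma AutoGroup_sel [simp]:
  "carrier (AutoGroup N) = auto N" "\<one>\<^bsub>AutoGroup N\<^esub> = (\<lambda>x\<in>carrier N. x)"
  "\<lbrakk>f \<in> auto N; g \<in> auto N\<rbrakk> \<Longrightarrow> f \<otimes>\<^bsub>AutoGroup N\<^esub> g = compose (carrier N) f g"
  by (simp_all add: AutoGroup_def auto_def BijGroup_def)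

locale cyclic_p_group = group N
  for N :: "('n, 'm) monoid_scheme" (structure) +
  fixes p n :: nat and \<eta> :: 'n and \<gamma> \<delta> :: "'n \<Rightarrow> 'n"
  assumes p: "Factorial_Ring.prime p" "odd p" and n: "n \<ge> 1"
    and order_N: "order N = p ^ n"
    and \<eta>: "\<eta> \<in> carrier N" and gen: "carrier N = generate N {\<eta>}"
    and \<gamma>: "\<gamma> \<in> carrier (AutoGroup N)"
    and gen_\<gamma>: "carrier (AutoGroup N) = generate (AutoGroup N) {\<gamma>}"
    and \<delta>: "\<delta> = \<gamma> [^]\<^bsub>AutoGroup N\<^esub> (p - 1)"
begin

lemma q_pos: "p ^ n > 0"
  using p(1) by (simp add: prime_gt_0_nat)

lemma finite_N: "finite (carrier N)"
  using order_N q_pos unfolding order_def by (metis card.infinite less_irrefl)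

text \<open>\<open>right_regular\<close> multiplies by the inverse of its argument, so exponents are
  taken with respect to this generator.\<close>

definition \<epsilon> where "\<epsilon> = inv \<eta>"

lemma \<epsilon>_closed [simp]: "\<epsilon> \<in> carrier N"
  using \<eta> by (simp add: \<epsilon>_def)

lemma ord_\<epsilon>: "ord \<epsilon> = p ^ n"
  using generate_pow_card[OF \<eta>] gen order_N \<eta> by (simp add: \<epsilon>_def order_def)

lemma power_of_\<epsilon>:
  assumes x: "x \<in> carrier N"
  obtains k :: nat where "x = \<epsilon> [^] k"
proof -
  have "inv x \<in> generate N {\<eta>}" using x gen by auto
  then obtain k :: nat where "inv x = \<eta> [^] k"
    using generate_pow_on_finite_carrier[OF finite_N \<eta>] by auto
  then have "x = inv (\<eta> [^] k)" using x inv_inv by metis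
  then show ?thesis using that[of k] \<eta> by (simp add: \<epsilon>_def nat_pow_inv)
qed

lemma \<epsilon>_pow_eq_iff: "\<epsilon> [^] (i::nat) = \<epsilon> [^] (j::nat) \<longleftrightarrow> [i = j] (mod p ^ n)"
  using pow_eq_iff_cong[OF \<epsilon>_closed] ord_\<epsilon> by simp

lemma comm:
  assumes "x \<in> carrier N" "y \<in> carrier N"
  shows "x \<otimes> y = y \<otimes> x"
proof -
  obtain i :: nat where i: "x = \<epsilon> [^] i" using power_of_\<epsilon>[OF assms(1)] .
  obtain j :: nat where j: "y = \<epsilon> [^] j" using power_of_\<epsilon>[OF assms(2)] .
  show ?thesis unfolding i j by (simp add: nat_pow_mult add.commute)
qed

lemma pow_cong:
  assumes x: "x \<in> carrier N" and c: "[i = j] (mod p ^ n)"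
  shows "x [^] i = x [^] j"
proof -
  have "ord x dvd p ^ n" using ord_dvd_group_order[OF x] order_N by simp
  then show ?thesis using pow_eq_iff_cong[OF x, of i j] cong_dvd_modulus_nat[OF c] by simp
qed

lemma pow_distrib: "\<lbrakk>x \<in> carrier N; y \<in> carrier N\<rbrakk> \<Longrightarrow> (x \<otimes> y) [^] (k::nat) = x [^] k \<otimes> y [^] k"
  using pow_mult_distrib[OF comm] by blast

lemma hom_pow:
  assumes f: "f \<in> hom N N" and x: "x \<in> carrier N" and e: "f \<epsilon> = \<epsilon> [^] (k::nat)"
  shows "f x = x [^] k"
proof -
  obtain i :: nat where i: "x = \<epsilon> [^] i" using power_of_\<epsilon>[OF x] .
  interpret f: group_hom N N f using f by unfold_locales
  show ?thesis unfolding i using f.hom_nat_pow[OF \<epsilon>_closed] e by (simp add: nat_pow_pow mult.commute)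
qed

sublocale Aut: group "AutoGroup N"
  by (rule AutoGroup)

lemma auto_pow_closed: "f \<in> auto N \<Longrightarrow> f [^]\<^bsub>AutoGroup N\<^esub> (k::nat) \<in> auto N"
  using Aut.nat_pow_closed[of f k] by simp

lemma auto_pow_apply:
  assumes f: "f \<in> auto N" and e: "\<And>x. x \<in> carrier N \<Longrightarrow> f x = x [^] (g::nat)" and x: "x \<in> carrier N"
  shows "(f [^]\<^bsub>AutoGroup N\<^esub> (k::nat)) x = x [^] (g ^ k)"
  using x
proof (induction k arbitrary: x)
  case (Suc k)
  have "(f [^]\<^bsub>AutoGroup N\<^esub> Suc k) x = (f [^]\<^bsub>AutoGroup N\<^esub> k) (f x)"
    using f auto_pow_closed[OF f, of k] Suc.prems by (simp add: compose_eq)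
  then show ?case
    using Suc e by (simp add: nat_pow_pow)
qed simp

text \<open>\<gamma> is a power map with some exponent g, and p does not divide g since \<gamma> is
  injective. By Fermat the exponent g^(p - 1) of \<delta> is 1 modulo p.\<close>

lemma exists_\<delta>_exponent:
  obtains d where "[d = 1] (mod p)" "\<And>(s::nat) x. x \<in> carrier N \<Longrightarrow> (\<delta> [^]\<^bsub>AutoGroup N\<^esub> s) x = x [^] (d ^ s)"
proof -
  have ga: "\<gamma> \<in> auto N" using \<gamma> by simp
  then have gh: "\<gamma> \<in> hom N N" and gb: "\<gamma> \<in> Bij (carrier N)" by (auto simp: auto_def)
  have "\<gamma> \<epsilon> \<in> carrier N" using Bij_closed[OF gb] by simp
  then obtain g :: nat where "\<gamma> \<epsilon> = \<epsilon> [^] g" using power_of_\<epsilon> by blast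
  then have g: "\<gamma> x = x [^] g" if "x \<in> carrier N" for x using hom_pow[OF gh that] by simp
  have "\<not> p dvd g"
  proof
    assume "p dvd g"
    \<comment> \<open>Otherwise \<gamma> would send \<epsilon> raised to the power
      \<open>p ^ (n - 1)\<close>, an element different from 1, to 1.\<close>
    then have "[p ^ (n - 1) * g = 0] (mod p ^ n)"
      using n unfolding cong_0_iff by (cases n) (auto simp: mult.commute)
    then have "\<gamma> (\<epsilon> [^] (p ^ (n - 1))) = \<gamma> \<one>"
      using pow_cong[OF \<epsilon>_closed] by (simp add: g nat_pow_pow)
    then have "\<epsilon> [^] (p ^ (n - 1)) = \<epsilon> [^] (0::nat)"
      using gb by (auto simp: Bij_def bij_betw_def inj_on_def)
    then have "p ^ n dvd p ^ (n - 1)" unfolding \<epsilon>_pow_eq_iff cong_0_iff .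
    then show False
      using n power_dvd_imp_le[OF _ prime_gt_1_nat[OF p(1)]] by fastforce
  qed
  then have d1: "[g ^ (p - 1) = 1] (mod p)" using fermat_theorem[OF p(1)] by blast
  have da: "\<delta> \<in> auto N" unfolding \<delta> by (rule auto_pow_closed[OF ga])
  have d: "\<delta> x = x [^] (g ^ (p - 1))" if "x \<in> carrier N" for x
    unfolding \<delta> by (rule auto_pow_apply[OF ga g that])
  show ?thesis
    by (rule that[OF d1]) (rule auto_pow_apply[OF da d])
qed

lemma power_map_auto:
  assumes u: "coprime u (p ^ n)"
  shows "(\<lambda>x\<in>carrier N. x [^] (u::nat)) \<in> auto N"
proof -
  obtain v where v: "[u * v = 1] (mod p ^ n)" using cong_solve_coprime_nat[OF u] by auto
  have vu: "(x [^] u) [^] v = x" "(x [^] v) [^] u = x" if x: "x \<in> carrier N" for x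
    using pow_cong[OF x v] x by (simp_all add: nat_pow_pow mult.commute[of v u])
  have "bij_betw (\<lambda>x\<in>carrier N. x [^] u) (carrier N) (carrier N)"
  proof (rule bij_betw_byWitness[of _ "\<lambda>x. x [^] v"])
    show "\<forall>a\<in>carrier N. (\<lambda>x\<in>carrier N. x [^] u) a [^] v = a"
      using vu(1) by simp
    show "\<forall>a'\<in>carrier N. (\<lambda>x\<in>carrier N. x [^] u) (a' [^] v) = a'"
      using vu(2) by simp
  qed auto
  then show ?thesis by (simp add: auto_def Bij_def hom_def pow_distrib)
qed

text \<open>Distinct units modulo \<open>p ^ n\<close> give distinct power maps. The totient is thus
  a lower bound for the order of \<gamma>.\<close>

lemma card_auto_ge: "p ^ (n - 1) * (p - 1) \<le> card (auto N)"
proof -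
  have "inj_on (\<lambda>u. \<lambda>x\<in>carrier N. x [^] u) (totatives (p ^ n))"
  proof (rule inj_onI)
    fix u v assume uv: "u \<in> totatives (p ^ n)" "v \<in> totatives (p ^ n)"
      and eq: "(\<lambda>x\<in>carrier N. x [^] u) = (\<lambda>x\<in>carrier N. x [^] v)"
    have "\<epsilon> [^] u = \<epsilon> [^] v" using fun_cong[OF eq, of \<epsilon>] by simp
    then have "[u = v] (mod p ^ n)" by (simp add: \<epsilon>_pow_eq_iff)
    \<comment> \<open>For modulus 1 the totative 1 is not below the modulus; above 1, congruent
      totatives are equal.\<close>
    moreover have "p ^ n > 1"
      using one_less_power[OF prime_gt_1_nat[OF p(1)], of n] n by simp
    ultimately show "u = v"
      using totatives_less[OF uv(1)] totatives_less[OF uv(2)] by (simp add: cong_def)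
  qed
  moreover have "(\<lambda>u. \<lambda>x\<in>carrier N. x [^] u) ` totatives (p ^ n) \<subseteq> auto N"
    using power_map_auto by (auto simp: totatives_def)
  moreover have "finite (auto N)"
  proof (rule finite_subset)
    show "auto N \<subseteq> (carrier N \<rightarrow>\<^sub>E carrier N)"
      by (auto simp: auto_def PiE_def intro: Bij_closed Bij_imp_extensional)
    show "finite (carrier N \<rightarrow>\<^sub>E carrier N)" using finite_N by (intro finite_PiE) auto
  qed
  ultimately have "card (totatives (p ^ n)) \<le> card (auto N)"
    by (rule card_inj_on_le)
  then show ?thesis
    using totient_prime_power[OF p(1), of n] n by (simp add: totient_def)
qed

text \<open>\<delta>^t is \<gamma> to the power (p - 1) t, and for t below
  \<open>p ^ (n - 1)\<close> this exponent stays below the order of \<gamma>.\<close>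

lemma \<delta>_pow_inj:
  assumes rs: "r < p ^ (n - 1)" "s < p ^ (n - 1)"
    and eq: "\<And>x. x \<in> carrier N \<Longrightarrow> (\<delta> [^]\<^bsub>AutoGroup N\<^esub> r) x = (\<delta> [^]\<^bsub>AutoGroup N\<^esub> s) x"
  shows "r = s"
proof -
  have ga: "\<gamma> \<in> auto N" using \<gamma> by simp
  have da: "\<delta> \<in> auto N" unfolding \<delta> by (rule auto_pow_closed[OF ga])
  have "\<delta> [^]\<^bsub>AutoGroup N\<^esub> r = \<delta> [^]\<^bsub>AutoGroup N\<^esub> s"
    using auto_pow_closed[OF da] eq by (intro Bij_eqI[of _ "carrier N"]) (auto simp: auto_def)
  then have e: "\<gamma> [^]\<^bsub>AutoGroup N\<^esub> ((p - 1) * r) = \<gamma> [^]\<^bsub>AutoGroup N\<^esub> ((p - 1) * s)"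
    unfolding \<delta> using Aut.nat_pow_pow[OF \<gamma>] by simp
  have p1: "p - 1 > 0" using prime_gt_1_nat[OF p(1)] by simp
  have "Aut.ord \<gamma> \<ge> p ^ (n - 1) * (p - 1)"
    using Aut.generate_pow_card[OF \<gamma>] gen_\<gamma> card_auto_ge by simp
  moreover have "(p - 1) * t < p ^ (n - 1) * (p - 1)" if "t < p ^ (n - 1)" for t
    using that p1 by simp
  ultimately have "(p - 1) * r < Aut.ord \<gamma>" "(p - 1) * s < Aut.ord \<gamma>"
    using rs by (meson less_le_trans)+
  then have "(p - 1) * r = (p - 1) * s"
    using inj_onD[OF Aut.ord_inj[OF \<gamma>] e] by auto
  then show ?thesis using p1 by simp
qed

end

section \<open>The regular subgroups\<close>

context group begin

lemma left_regular_Bij: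
  assumes "g \<in> carrier G"
  shows "left_regular G g \<in> Bij (carrier G)"
proof -
  have "bij_betw (left_regular G g) (carrier G) (carrier G)"
    by (rule bij_betw_byWitness[of _ "\<lambda>x. inv g \<otimes> x"])
      (use assms in \<open>auto simp: left_regular_def m_assoc[symmetric]\<close>)
  then show ?thesis by (simp add: Bij_def left_regular_def)
qed

lemma left_regular_one: "left_regular G \<one> = \<one>\<^bsub>BijGroup (carrier G)\<^esub>"
  unfolding left_regular_def BijGroup_sel by (rule restrict_ext) simp

lemma left_regular_mult:
  assumes "g \<in> carrier G" "h \<in> carrier G"
  shows "left_regular G (g \<otimes> h) = left_regular G g \<otimes>\<^bsub>BijGroup (carrier G)\<^esub> left_regular G h"
  using assms left_regular_Bij by (simp add: compose_def left_regular_def m_assoc cong: restrict_cong)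

lemma conj_left_regular_one:
  assumes "m \<in> Bij (carrier G)"
  shows "conj_left_regular G \<one> m = m"
proof -
  interpret B: group "BijGroup (carrier G)" by (rule group_BijGroup)
  have "m \<in> carrier (BijGroup (carrier G))" using assms by simp
  then show ?thesis
    unfolding conj_left_regular_def left_regular_one by (simp only: B.inv_one B.l_one B.r_one)
qed

lemma conj_left_regular_mult:
  assumes g: "g \<in> carrier G" and h: "h \<in> carrier G" and m: "m \<in> Bij (carrier G)"
  shows "conj_left_regular G (g \<otimes> h) m = conj_left_regular G g (conj_left_regular G h m)"
proof -
  interpret B: group "BijGroup (carrier G)" by (rule group_BijGroup)
  have c: "left_regular G g \<in> carrier (BijGroup (carrier G))" "left_regular G h \<in> carrier (BijGroup (carrier G))"
    "m \<in> carrier (BijGroup (carrier G))"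
    using g h m left_regular_Bij by simp_all
  show ?thesis
    unfolding conj_left_regular_def left_regular_mult[OF g h]
    using c by (simp only: B.inv_mult_group B.m_assoc B.m_closed B.inv_closed)
qed

lemma conj_left_regular_hom:
  assumes g: "g \<in> carrier G" and m: "m \<in> Bij (carrier G)" and k: "k \<in> Bij (carrier G)"
  shows "conj_left_regular G g (m \<otimes>\<^bsub>BijGroup (carrier G)\<^esub> k)
    = conj_left_regular G g m \<otimes>\<^bsub>BijGroup (carrier G)\<^esub> conj_left_regular G g k"
proof -
  interpret B: group "BijGroup (carrier G)" by (rule group_BijGroup)
  let ?l = "left_regular G g"
  have c: "?l \<in> carrier (BijGroup (carrier G))" "m \<in> carrier (BijGroup (carrier G))" "k \<in> carrier (BijGroup (carrier G))"
    using g m k left_regular_Bij by simp_all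
  have "inv\<^bsub>BijGroup (carrier G)\<^esub> ?l \<otimes>\<^bsub>BijGroup (carrier G)\<^esub> (?l \<otimes>\<^bsub>BijGroup (carrier G)\<^esub> x) = x"
    if "x \<in> carrier (BijGroup (carrier G))" for x
    using B.m_assoc[OF B.inv_closed[OF c(1)] c(1) that] B.l_inv[OF c(1)] B.l_one[OF that] by (simp only:)
  then show ?thesis
    unfolding conj_left_regular_def
    using c by (simp only: B.m_assoc B.m_closed B.inv_closed)
qed

text \<open>Multiplying by \<open>left_regular G g\<close> on the right removes the inverse, leaving
  a pointwise condition.\<close>

lemma conj_left_regular_eqI:
  assumes g: "g \<in> carrier G" and m: "m \<in> Bij (carrier G)" and k: "k \<in> Bij (carrier G)"
    and eq: "\<And>x. x \<in> carrier G \<Longrightarrow> g \<otimes> m x = k (g \<otimes> x)"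
  shows "conj_left_regular G g m = k"
proof -
  interpret B: group "BijGroup (carrier G)" by (rule group_BijGroup)
  note l = left_regular_Bij[OF g]
  have "left_regular G g \<otimes>\<^bsub>BijGroup (carrier G)\<^esub> m = k \<otimes>\<^bsub>BijGroup (carrier G)\<^esub> left_regular G g"
    using l m k eq Bij_closed[OF m] g by (simp add: compose_def left_regular_def cong: restrict_cong)
  moreover have "k \<otimes>\<^bsub>BijGroup (carrier G)\<^esub> left_regular G g \<otimes>\<^bsub>BijGroup (carrier G)\<^esub> inv\<^bsub>BijGroup (carrier G)\<^esub> left_regular G g = k"
  proof -
    have c: "k \<in> carrier (BijGroup (carrier G))" "left_regular G g \<in> carrier (BijGroup (carrier G))"
      using l k by simp_all
    show ?thesis
      by (simp only: B.m_assoc[OF c(1,2) B.inv_closed[OF c(2)]] B.r_inv[OF c(2)] B.r_one[OF c(1)])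
  qed
  ultimately show ?thesis unfolding conj_left_regular_def by (simp only:)
qed

end

text \<open>\<open>D\<close> is the exponent of \<delta>^s as a power map. In the final proof it is
  a power \<open>d ^ s\<close>, and being 1 modulo p is inherited from d.\<close>

locale cyclic_embedding = cyclic_p_group N p n \<eta> \<gamma> \<delta> + G: group G
  for N :: "('n, 'm) monoid_scheme" (structure) and p n \<eta> \<gamma> \<delta> and G :: "('g, 't) monoid_scheme" +
  fixes \<sigma> :: 'g and s D :: nat
  assumes order_G: "order G = p ^ n" and \<sigma>: "\<sigma> \<in> carrier G" and gen_\<sigma>: "carrier G = generate G {\<sigma>}"
    and D: "[D = 1] (mod p)" and \<delta>_pow: "\<And>x. x \<in> carrier N \<Longrightarrow> (\<delta> [^]\<^bsub>AutoGroup N\<^esub> s) x = x [^] D"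
begin

lemma finite_G: "finite (carrier G)"
  using order_G q_pos unfolding order_def by (metis card.infinite less_irrefl)

lemma power_of_\<sigma>:
  assumes "g \<in> carrier G"
  obtains k :: nat where "g = \<sigma> [^]\<^bsub>G\<^esub> k"
  using G.generate_pow_on_finite_carrier[OF finite_G \<sigma>] gen_\<sigma> assms by auto

lemma \<sigma>_pow_eq_iff: "\<sigma> [^]\<^bsub>G\<^esub> (i::nat) = \<sigma> [^]\<^bsub>G\<^esub> (j::nat) \<longleftrightarrow> [i = j] (mod p ^ n)"
  using G.pow_eq_iff_cong[OF \<sigma>, of i j] G.generate_pow_card[OF \<sigma>] gen_\<sigma> order_G by (simp add: order_def)

section \<open>The homomorphism \<beta> and the bijection b\<close>

abbreviation "Perm_N \<equiv> BijGroup (carrier N)"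

sublocale P: group Perm_N
  by (rule group_BijGroup)

definition B where "B = right_regular N \<eta> \<otimes>\<^bsub>Perm_N\<^esub> (\<delta> [^]\<^bsub>AutoGroup N\<^esub> s)"

lemma \<delta>_pow_auto: "\<delta> [^]\<^bsub>AutoGroup N\<^esub> s \<in> auto N"
  unfolding \<delta> using auto_pow_closed[OF auto_pow_closed] \<gamma> by simp

lemma right_regular_Bij: "right_regular N \<eta> \<in> Bij (carrier N)"
proof -
  have "bij_betw (right_regular N \<eta>) (carrier N) (carrier N)"
    by (rule bij_betw_byWitness[of _ "\<lambda>x. x \<otimes> \<eta>"])
      (use \<eta> in \<open>auto simp: right_regular_def m_assoc\<close>)
  then show ?thesis by (simp add: Bij_def right_regular_def)
qed

lemma B_Bij: "B \<in> Bij (carrier N)"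
  unfolding B_def using \<delta>_pow_auto right_regular_Bij P.m_closed by (auto simp: auto_def)

lemma B_apply: "x \<in> carrier N \<Longrightarrow> B x = x [^] D \<otimes> \<epsilon>"
  unfolding B_def using \<delta>_pow_auto right_regular_Bij
  by (simp add: auto_def compose_eq \<delta>_pow right_regular_def \<epsilon>_def)

lemma B_pow_Bij: "B [^]\<^bsub>Perm_N\<^esub> (k::nat) \<in> Bij (carrier N)"
  using P.nat_pow_closed[of B k] B_Bij by simp

text \<open>Written additively in the coordinate given by \<epsilon>, B is the affine map x to D x +
  1, whose iterates have geometric sums as constant terms.\<close>

lemma B_pow_apply:
  "x \<in> carrier N \<Longrightarrow> (B [^]\<^bsub>Perm_N\<^esub> (k::nat)) x = x [^] (D ^ k) \<otimes> \<epsilon> [^] (geo_sum D k)"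
proof (induction k arbitrary: x)
  case (Suc k)
  have "(B [^]\<^bsub>Perm_N\<^esub> Suc k) x = (B [^]\<^bsub>Perm_N\<^esub> k) (B x)"
    using B_Bij B_pow_Bij[of k] Suc.prems by (simp add: compose_eq)
  also have "\<dots> = (x [^] D \<otimes> \<epsilon>) [^] (D ^ k) \<otimes> \<epsilon> [^] (geo_sum D k)"
    using Suc by (simp add: B_apply)
  also have "\<dots> = x [^] (D ^ Suc k) \<otimes> (\<epsilon> [^] (D ^ k) \<otimes> \<epsilon> [^] (geo_sum D k))"
    using Suc.prems by (simp add: pow_distrib nat_pow_pow m_assoc)
  also have "\<epsilon> [^] (D ^ k) \<otimes> \<epsilon> [^] (geo_sum D k) = \<epsilon> [^] (geo_sum D (Suc k))"
    by (simp add: nat_pow_mult add.commute)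
  finally show ?case .
qed simp

text \<open>The relation of \<sigma> must hold for B if \<beta> is to exist. The linear part is
  \<open>power_prime_power_cong_1\<close>, the translation part the valuation of the geometric
  sum.\<close>

lemma B_pow_q: "B [^]\<^bsub>Perm_N\<^esub> (p ^ n) = \<one>\<^bsub>Perm_N\<^esub>"
proof (rule Bij_eqI[OF B_pow_Bij])
  show "\<one>\<^bsub>Perm_N\<^esub> \<in> Bij (carrier N)" using P.one_closed by simp
  fix x assume x: "x \<in> carrier N"
  have "x [^] (D ^ (p ^ n)) = x [^] (1::nat)"
    by (rule pow_cong[OF x power_prime_power_cong_1[OF p D]])
  moreover have "\<epsilon> [^] (geo_sum D (p ^ n)) = \<epsilon> [^] (0::nat)"
    unfolding \<epsilon>_pow_eq_iff cong_0_iff using prime_power_dvd_geo_sum_iff[OF p D] by simp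
  ultimately show "(B [^]\<^bsub>Perm_N\<^esub> (p ^ n)) x = \<one>\<^bsub>Perm_N\<^esub> x"
    unfolding B_pow_apply[OF x] using x by simp
qed

lemma B_pow_cong:
  assumes "[i = j] (mod p ^ n)"
  shows "B [^]\<^bsub>Perm_N\<^esub> i = B [^]\<^bsub>Perm_N\<^esub> j"
proof -
  have B: "B \<in> carrier Perm_N" using B_Bij by simp
  have "P.ord B dvd p ^ n" using P.pow_eq_id[OF B] B_pow_q by blast
  then show ?thesis using P.pow_eq_iff_cong[OF B, of i j] cong_dvd_modulus_nat[OF assms] by simp
qed

abbreviation "\<beta> \<equiv> beta G \<sigma> N \<eta> \<delta> s"

text \<open>Discharges the definite description in \<open>beta\<close>: a homomorphism on G is
  determined by its value at \<sigma>, and one exists because B satisfies the relation of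
  \<sigma>.\<close>

lemma beta_pow: "\<beta> (\<sigma> [^]\<^bsub>G\<^esub> (k::nat)) = B [^]\<^bsub>Perm_N\<^esub> k"
proof -
  have B: "B \<in> carrier Perm_N" using B_Bij by simp
  let ?Q = "\<lambda>f. f \<in> hom G Perm_N \<and> f \<in> extensional (carrier G) \<and> f \<sigma> = B"
  \<comment> \<open>The chosen k is a discrete logarithm, determined only modulo
    \<open>p ^ n\<close>; \<open>B_pow_cong\<close> shows that the power of B does not depend on the
    choice.\<close>
  define f0 where "f0 = (\<lambda>g\<in>carrier G. B [^]\<^bsub>Perm_N\<^esub> (SOME k::nat. g = \<sigma> [^]\<^bsub>G\<^esub> k))"
  have f0: "f0 (\<sigma> [^]\<^bsub>G\<^esub> k) = B [^]\<^bsub>Perm_N\<^esub> k" for k :: nat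
  proof -
    let ?k = "SOME j::nat. \<sigma> [^]\<^bsub>G\<^esub> k = \<sigma> [^]\<^bsub>G\<^esub> j"
    have "\<sigma> [^]\<^bsub>G\<^esub> k = \<sigma> [^]\<^bsub>G\<^esub> ?k" by (rule someI[of _ k]) simp
    then have "[k = ?k] (mod p ^ n)" unfolding \<sigma>_pow_eq_iff .
    then show ?thesis using B_pow_cong[of k ?k] \<sigma> by (simp add: f0_def)
  qed
  have Q0: "?Q f0"
  proof (intro conjI homI)
    fix x assume "x \<in> carrier G"
    then obtain i :: nat where "x = \<sigma> [^]\<^bsub>G\<^esub> i" by (rule power_of_\<sigma>)
    then show "f0 x \<in> carrier Perm_N" using f0 P.nat_pow_closed[OF B] by simp
  next
    fix x y assume xy: "x \<in> carrier G" "y \<in> carrier G"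
    obtain i :: nat where i: "x = \<sigma> [^]\<^bsub>G\<^esub> i" using power_of_\<sigma>[OF xy(1)] .
    obtain j :: nat where j: "y = \<sigma> [^]\<^bsub>G\<^esub> j" using power_of_\<sigma>[OF xy(2)] .
    note ij = i j
    have "x \<otimes>\<^bsub>G\<^esub> y = \<sigma> [^]\<^bsub>G\<^esub> (i + j)" unfolding ij by (rule G.nat_pow_mult[OF \<sigma>])
    then show "f0 (x \<otimes>\<^bsub>G\<^esub> y) = f0 x \<otimes>\<^bsub>Perm_N\<^esub> f0 y"
      unfolding ij f0 using f0[of "i + j"] P.nat_pow_mult[OF B, of i j] by (simp only:)
  next
    show "f0 \<in> extensional (carrier G)" by (simp add: f0_def)
    show "f0 \<sigma> = B" using f0[of 1] \<sigma> B G.nat_pow_eone P.nat_pow_eone by simp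
  qed
  have uniq: "f = f0" if f: "?Q f" for f
  proof (rule extensionalityI[of _ "carrier G"])
    show "f \<in> extensional (carrier G)" "f0 \<in> extensional (carrier G)" using f Q0 by blast+
    fix x assume "x \<in> carrier G"
    then obtain i :: nat where x: "x = \<sigma> [^]\<^bsub>G\<^esub> i" by (rule power_of_\<sigma>)
    interpret fh: group_hom G Perm_N f using f by unfold_locales blast
    show "f x = f0 x" unfolding x using fh.hom_nat_pow[OF \<sigma>] f f0 by simp
  qed
  have "\<beta> = f0"
    unfolding beta_def B_def[symmetric] using Q0 uniq by (intro the_equality)
  then show ?thesis using f0 by simp
qed

abbreviation "b \<equiv> b_map G \<sigma> N \<eta> \<delta> s"

lemma b_pow: "b (\<sigma> [^]\<^bsub>G\<^esub> (k::nat)) = \<epsilon> [^] (geo_sum D k)"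
  unfolding b_map_def beta_pow B_pow_apply[OF one_closed] by simp

text \<open>Injectivity is \<open>geo_sum_cong_iff\<close>; surjectivity follows because G and N
  have the same finite order.\<close>

lemma b_bij: "bij_betw b (carrier G) (carrier N)"
proof -
  have inj: "inj_on b (carrier G)"
  proof (rule inj_onI)
    fix x y assume xy: "x \<in> carrier G" "y \<in> carrier G" "b x = b y"
    obtain i :: nat where i: "x = \<sigma> [^]\<^bsub>G\<^esub> i" using power_of_\<sigma>[OF xy(1)] .
    obtain j :: nat where j: "y = \<sigma> [^]\<^bsub>G\<^esub> j" using power_of_\<sigma>[OF xy(2)] .
    have "[geo_sum D i = geo_sum D j] (mod p ^ n)"
      using xy(3) unfolding i j b_pow \<epsilon>_pow_eq_iff .
    then show "x = y" unfolding i j \<sigma>_pow_eq_iff geo_sum_cong_iff[OF p D] .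
  qed
  have sub: "b ` carrier G \<subseteq> carrier N"
  proof
    fix y assume "y \<in> b ` carrier G"
    then obtain x where x: "x \<in> carrier G" "y = b x" by blast
    obtain i :: nat where "x = \<sigma> [^]\<^bsub>G\<^esub> i" using power_of_\<sigma>[OF x(1)] .
    then show "y \<in> carrier N" using b_pow x(2) by simp
  qed
  have "card (b ` carrier G) = card (carrier N)"
    using card_image[OF inj] order_G order_N by (simp add: order_def)
  then show ?thesis
    using inj card_subset_eq[OF finite_N sub] by (simp add: bij_betw_def)
qed

lemma b_closed: "x \<in> carrier G \<Longrightarrow> b x \<in> carrier N"
  using b_bij bij_betwE by blast

lemma b_eqD: "\<lbrakk>b x = b y; x \<in> carrier G; y \<in> carrier G\<rbrakk> \<Longrightarrow> x = y"
  using b_bij by (auto simp: bij_betw_def inj_on_def)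

lemma b_one: "b \<one>\<^bsub>G\<^esub> = \<one>"
  using b_pow[of 0] by simp

text \<open>b intertwines left translation by \<sigma> with B. The first term of the geometric sum
  is split off, so that the factor D falls on the remaining sum.\<close>

lemma b_mult_\<sigma>:
  assumes x: "x \<in> carrier G" shows "b (\<sigma> \<otimes>\<^bsub>G\<^esub> x) = b x [^] D \<otimes> \<epsilon>"
proof -
  obtain k :: nat where k: "x = \<sigma> [^]\<^bsub>G\<^esub> k" using power_of_\<sigma>[OF x] .
  have "\<sigma> \<otimes>\<^bsub>G\<^esub> x = \<sigma> [^]\<^bsub>G\<^esub> Suc k" unfolding k by (rule G.nat_pow_Suc2[OF \<sigma>, symmetric])
  then have "b (\<sigma> \<otimes>\<^bsub>G\<^esub> x) = \<epsilon> [^] (geo_sum D (1 + k))" using b_pow[of "Suc k"] by simp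
  also have "geo_sum D (1 + k) = 1 + D * geo_sum D k" unfolding geo_sum_add by simp
  finally show ?thesis unfolding k b_pow
    by (simp add: nat_pow_mult[symmetric] nat_pow_pow comm mult.commute)
qed

section \<open>The embedding \<alpha> and conjugation by \<sigma>\<close>

abbreviation "\<alpha> \<equiv> alpha G \<sigma> N \<eta> \<delta> s"

text \<open>These two facts characterise \<alpha> without \<open>inv_into\<close>; later identities
  are proved by applying the injective map b.\<close>

lemma alpha_apply:
  assumes "\<nu> \<in> carrier N" "x \<in> carrier G"
  shows "\<alpha> \<nu> x \<in> carrier G" "b (\<alpha> \<nu> x) = \<nu> \<otimes> b x"
proof -
  have v: "\<nu> \<otimes> b x \<in> b ` carrier G" using assms b_closed b_bij by (simp add: bij_betw_def)
  have "\<alpha> \<nu> x = inv_into (carrier G) b (\<nu> \<otimes> b x)"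
    using assms b_closed by (simp add: alpha_def left_regular_def)
  then show "\<alpha> \<nu> x \<in> carrier G" "b (\<alpha> \<nu> x) = \<nu> \<otimes> b x"
    using inv_into_into[OF v] f_inv_into_f[OF v] by simp_all
qed

lemma alpha_Bij:
  assumes v: "\<nu> \<in> carrier N" shows "\<alpha> \<nu> \<in> Bij (carrier G)"
proof -
  have "\<alpha> \<nu> (\<alpha> \<mu> x) = x" if "\<nu> \<in> carrier N" "\<mu> \<in> carrier N" "\<nu> \<otimes> \<mu> = \<one>" "x \<in> carrier G" for \<nu> \<mu> x
  proof (rule b_eqD)
    have "b (\<alpha> \<nu> (\<alpha> \<mu> x)) = \<nu> \<otimes> (\<mu> \<otimes> b x)"
      using that alpha_apply by simp
    then show "b (\<alpha> \<nu> (\<alpha> \<mu> x)) = b x" using that b_closed by (simp add: m_assoc[symmetric])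
  qed (use that alpha_apply in auto)
  then have "bij_betw (\<alpha> \<nu>) (carrier G) (carrier G)"
    using v alpha_apply(1) by (intro bij_betw_byWitness[of _ "\<alpha> (inv \<nu>)"]) auto
  then show ?thesis by (simp add: Bij_def alpha_def)
qed

lemma alpha_mult:
  assumes "\<nu> \<in> carrier N" "\<mu> \<in> carrier N"
  shows "\<alpha> \<nu> \<otimes>\<^bsub>BijGroup (carrier G)\<^esub> \<alpha> \<mu> = \<alpha> (\<nu> \<otimes> \<mu>)"
proof -
  have eq: "\<alpha> \<nu> \<otimes>\<^bsub>BijGroup (carrier G)\<^esub> \<alpha> \<mu> = compose (carrier G) (\<alpha> \<nu>) (\<alpha> \<mu>)"
    by (rule BijGroup_sel(3)[OF alpha_Bij[OF assms(1)] alpha_Bij[OF assms(2)]])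
  have "\<alpha> \<nu> (\<alpha> \<mu> x) = \<alpha> (\<nu> \<otimes> \<mu>) x" if x: "x \<in> carrier G" for x
  proof (rule b_eqD)
    have "b (\<alpha> \<nu> (\<alpha> \<mu> x)) = \<nu> \<otimes> (\<mu> \<otimes> b x)"
      using alpha_apply[OF assms(2) x] alpha_apply(2)[OF assms(1)] by simp
    also have "\<dots> = b (\<alpha> (\<nu> \<otimes> \<mu>) x)"
      using alpha_apply(2)[OF m_closed[OF assms] x] m_assoc[OF assms b_closed[OF x]] by simp
    finally show "b (\<alpha> \<nu> (\<alpha> \<mu> x)) = b (\<alpha> (\<nu> \<otimes> \<mu>) x)" .
    show "\<alpha> \<nu> (\<alpha> \<mu> x) \<in> carrier G" "\<alpha> (\<nu> \<otimes> \<mu>) x \<in> carrier G"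
      using assms x by (simp_all add: alpha_apply(1))
  qed
  then show ?thesis
    unfolding eq using alpha_Bij[OF m_closed[OF assms]] compose_Bij[OF alpha_Bij[OF assms(1)] alpha_Bij[OF assms(2)]]
    by (intro Bij_eqI[of _ "carrier G"]) (simp_all add: compose_eq)
qed

lemma alpha_inj:
  assumes "\<nu> \<in> carrier N" "\<mu> \<in> carrier N" "\<alpha> \<nu> = \<alpha> \<mu>"
  shows "\<nu> = \<mu>"
proof -
  have "\<nu> \<otimes> b \<one>\<^bsub>G\<^esub> = \<mu> \<otimes> b \<one>\<^bsub>G\<^esub>"
    using alpha_apply(2)[OF assms(1) G.one_closed] alpha_apply(2)[OF assms(2) G.one_closed] assms(3) by (simp only:)
  then show ?thesis using assms(1,2) by (simp add: b_one)
qed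

text \<open>As N is abelian, (\<nu> b(x))^D \<epsilon> equals \<nu>^D times b(x)^D \<epsilon>. The
  former is b of \<sigma> \<alpha>(\<nu>)(x), the latter b of \<alpha>(\<nu>^D)(\<sigma> x).\<close>

lemma conj_alpha:
  assumes v: "\<nu> \<in> carrier N"
  shows "conj_left_regular G \<sigma> (\<alpha> \<nu>) = \<alpha> (\<nu> [^] D)"
proof (rule G.conj_left_regular_eqI[OF \<sigma>])
  fix x assume x: "x \<in> carrier G"
  show "\<sigma> \<otimes>\<^bsub>G\<^esub> \<alpha> \<nu> x = \<alpha> (\<nu> [^] D) (\<sigma> \<otimes>\<^bsub>G\<^esub> x)"
  proof (rule b_eqD)
    show "b (\<sigma> \<otimes>\<^bsub>G\<^esub> \<alpha> \<nu> x) = b (\<alpha> (\<nu> [^] D) (\<sigma> \<otimes>\<^bsub>G\<^esub> x))"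
      using v x \<sigma> b_closed[OF x] by (simp add: b_mult_\<sigma> alpha_apply pow_distrib m_assoc)
  qed (use v x \<sigma> alpha_apply(1) in auto)
qed (use v alpha_Bij in auto)

abbreviation "Mg \<equiv> alpha_group G \<sigma> N \<eta> \<delta> s"

lemma Mg_sel: "carrier Mg = \<alpha> ` carrier N" "monoid.mult Mg = monoid.mult (BijGroup (carrier G))" "monoid.one Mg = monoid.one (BijGroup (carrier G))"
  by (simp_all add: alpha_group_def)

lemma Mg_Bij: "m \<in> carrier Mg \<Longrightarrow> m \<in> Bij (carrier G)"
  using alpha_Bij by (auto simp: Mg_sel)

lemma Mg_mult_closed: "\<lbrakk>x \<in> carrier Mg; y \<in> carrier Mg\<rbrakk> \<Longrightarrow> x \<otimes>\<^bsub>Mg\<^esub> y \<in> carrier Mg"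
  using alpha_mult by (auto simp: Mg_sel)

lemma Mg_finite: "finite (carrier Mg)"
  using finite_N by (simp add: Mg_sel)

lemma conj_\<sigma>_closed: "m \<in> carrier Mg \<Longrightarrow> conj_left_regular G \<sigma> m \<in> carrier Mg"
  using conj_alpha by (auto simp: Mg_sel)

text \<open>\<sigma> generates G, so the case of \<sigma> is iterated.\<close>

lemma conj_closed:
  assumes "g \<in> carrier G" and m: "m \<in> carrier Mg"
  shows "conj_left_regular G g m \<in> carrier Mg"
proof -
  obtain k :: nat where k: "g = \<sigma> [^]\<^bsub>G\<^esub> k" using power_of_\<sigma>[OF assms(1)] .
  have "conj_left_regular G (\<sigma> [^]\<^bsub>G\<^esub> k) m \<in> carrier Mg"
    using m
  proof (induction k arbitrary: m)
    case 0
    then show ?case using G.conj_left_regular_one[OF Mg_Bij[OF 0]] by simp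
  next
    case (Suc k)
    have "conj_left_regular G (\<sigma> [^]\<^bsub>G\<^esub> k \<otimes>\<^bsub>G\<^esub> \<sigma>) m = conj_left_regular G (\<sigma> [^]\<^bsub>G\<^esub> k) (conj_left_regular G \<sigma> m)"
      using \<sigma> Mg_Bij[OF Suc.prems] by (intro G.conj_left_regular_mult) auto
    then show ?case using Suc.IH[OF conj_\<sigma>_closed[OF Suc.prems]] by simp
  qed
  then show ?thesis unfolding k .
qed

end

section \<open>Descended group Hopf algebras\<close>

lemma group_galois_group:
  assumes "ring L" and K: "K \<subseteq> carrier L"
  shows "group (galois_group L K)"
proof -
  interpret ring L by (rule assms)
  let ?S = "{g \<in> ring_hom L L \<inter> Bij (carrier L). \<forall>k\<in>K. g k = k}"
  have "subgroup ?S (BijGroup (carrier L))"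
  proof (rule subgroup.intro)
    show "?S \<subseteq> carrier (BijGroup (carrier L))" by auto
    show "\<one>\<^bsub>BijGroup (carrier L)\<^esub> \<in> ?S"
      using K id_Bij[of "carrier L"] by (auto intro!: ring_hom_memI)
    fix f g assume f: "f \<in> ?S" and g: "g \<in> ?S"
    then have fB: "f \<in> Bij (carrier L)" and gB: "g \<in> Bij (carrier L)" by auto
    have "compose (carrier L) f g \<in> ring_hom L L"
      using f g by (intro ring_hom_memI)
        (auto simp: compose_eq ring_hom_closed ring_hom_mult ring_hom_add ring_hom_one)
    then show "f \<otimes>\<^bsub>BijGroup (carrier L)\<^esub> g \<in> ?S"
      using f g K fB gB compose_Bij by (auto simp: compose_eq subset_iff)
  next
    fix f assume f: "f \<in> ?S"
    then have fB: "f \<in> Bij (carrier L)" and fh: "f \<in> ring_hom L L" and fK: "\<forall>k\<in>K. f k = k" by auto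
    let ?i = "inv_into (carrier L) f"
    have inj: "inj_on f (carrier L)" using fB by (simp add: Bij_def bij_betw_def)
    have fix_i: "?i x = x" if "f x = x" "x \<in> carrier L" for x
      using inv_into_f_f[OF inj that(2)] that(1) by simp
    have mul: "?i (x \<otimes>\<^bsub>L\<^esub> y) = ?i x \<otimes>\<^bsub>L\<^esub> ?i y" and add: "?i (x \<oplus>\<^bsub>L\<^esub> y) = ?i x \<oplus>\<^bsub>L\<^esub> ?i y"
      if "x \<in> carrier L" "y \<in> carrier L" for x y
      using Bij_inv_into_lemma[of "carrier L" f "(\<otimes>\<^bsub>L\<^esub>)" x y] Bij_inv_into_lemma[of "carrier L" f "(\<oplus>\<^bsub>L\<^esub>)" x y]
        ring_hom_mult[OF fh] ring_hom_add[OF fh] fB that by auto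
    have "(\<lambda>x\<in>carrier L. ?i x) \<in> ring_hom L L"
      using mul add fix_i[OF ring_hom_one[OF fh]] Bij_inv_into_mem[OF fB]
      by (intro ring_hom_memI) auto
    moreover have "\<forall>k\<in>K. (\<lambda>x\<in>carrier L. ?i x) k = k"
      using fix_i fK K by auto
    ultimately show "inv\<^bsub>BijGroup (carrier L)\<^esub> f \<in> ?S"
      using restrict_inv_into_Bij[OF fB] by (simp add: inv_BijGroup[OF fB])
  qed
  then show ?thesis
    unfolding galois_group_def by (rule subgroup.subgroup_is_group[OF _ group_BijGroup])
qed

lemma galois_group_sel:
  "carrier (galois_group L K) = {g \<in> ring_hom L L \<inter> Bij (carrier L). \<forall>k\<in>K. g k = k}"
  "\<one>\<^bsub>galois_group L K\<^esub> = (\<lambda>x\<in>carrier L. x)"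
  "\<lbrakk>f \<in> Bij (carrier L); g \<in> Bij (carrier L)\<rbrakk> \<Longrightarrow> f \<otimes>\<^bsub>galois_group L K\<^esub> g = compose (carrier L) f g"
  by (simp_all add: galois_group_def BijGroup_def)

lemma galois_descent_galois_group:
  assumes ext: "galois_extension L K"
  shows "galois_descent L (galois_group L K) K"
proof -
  have fL: "field L" and sK: "subfield K L"
    and fixed: "{x \<in> carrier L. \<forall>g\<in>carrier (galois_group L K). g x = x} = K"
    using ext by (auto simp: galois_extension_def)
  interpret field L by (rule fL)
  have K: "K \<subseteq> carrier L" using subringE(1)[OF subfieldE(1)[OF sK]] .
  show ?thesis
  proof (intro galois_descent.intro field_automorphisms.intro field_automorphisms_axioms.intro
      galois_descent_axioms.intro fL sK group_galois_group[OF ring_axioms K])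
    fix g h assume "g \<in> carrier (galois_group L K)" "h \<in> carrier (galois_group L K)"
      and "\<And>x. x \<in> carrier L \<Longrightarrow> g x = h x"
    then show "g = h" by (intro Bij_eqI[of _ "carrier L"]) (auto simp: galois_group_sel)
  next
    fix x assume "x \<in> carrier L" "\<And>g. g \<in> carrier (galois_group L K) \<Longrightarrow> g x = x"
    then show "x \<in> K" using fixed by blast
  qed (auto simp: galois_group_sel compose_eq)
qed

lemma group_hopf_sel [simp]:
  "carrier (group_hopf L M) = carrier (free_module L (carrier M))"
  "u \<oplus>\<^bsub>group_hopf L M\<^esub> v = (\<lambda>x. u x \<oplus>\<^bsub>L\<^esub> v x)"
  "c \<odot>\<^bsub>group_hopf L M\<^esub> u = (\<lambda>x. c \<otimes>\<^bsub>L\<^esub> u x)"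
  "a \<otimes>\<^bsub>group_hopf L M\<^esub> b = free_map L (\<lambda>(x, y). x \<otimes>\<^bsub>M\<^esub> y) (\<lambda>(x, y). a x \<otimes>\<^bsub>L\<^esub> b y)"
  "comult (group_hopf L M) a = tensor_class L (group_algebra L M) (group_algebra L M)
                     (free_map L (\<lambda>m. (single L m, single L m)) a)"
  "counit (group_hopf L M) a = finsum L a {m. a m \<noteq> \<zero>\<^bsub>L\<^esub>}"
  by (simp_all add: group_hopf_def group_algebra_def module.extend_def free_module_def)

text \<open>The tensor constructions see only carrier, addition and scalar multiplication. This
  identifies them across records that differ in other fields.\<close>

lemma tensor_class_cong:
  assumes "carrier V = carrier V'" "add V = add V'" "smult V = smult V'"
  shows "tensor_class R V V = tensor_class R V' V'" "tensor_carrier R V V = tensor_carrier R V' V'"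
    "tensor_map R V V = tensor_map R V' V'"
  using assms by (simp_all add: fun_eq_iff tensor_class_def tensor_kernel_def bilinear_relations_def tensor_carrier_def tensor_map_def)

lemma tensor_class_group_hopf:
  "tensor_class L (group_algebra L M) (group_algebra L M) = tensor_class L (group_hopf L M) (group_hopf L M)"
  by (rule tensor_class_cong) (simp_all add: group_hopf_def group_algebra_def module.extend_def free_module_def)

text \<open>The indicator functions form a basis that is its own dual; the subring of scalars is
  here the whole ring.\<close>

lemma (in cring) group_hopf_framed:
  assumes fin: "finite (carrier M)"
  shows "framed_module R (carrier R) (carrier M) (group_hopf R M) (carrier M) (single R) (single R)"
proof (intro framed_module.intro framed_module_axioms.intro cring_axioms carrier_is_subring fin)
  have sub: "finite {x. u x \<noteq> \<zero>}" if "\<And>x. x \<notin> carrier M \<Longrightarrow> u x = \<zero>" for u :: "'c \<Rightarrow> 'a"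
    by (rule finite_subset[OF _ fin]) (use that in blast)
  show "v m \<in> carrier R" if "v \<in> carrier (group_hopf R M)" for v m
    using that free_module_value[of v "carrier M" m] by simp
  show "(\<lambda>m. v m \<oplus> w m) \<in> carrier (group_hopf R M)"
    if "v \<in> carrier (group_hopf R M)" "w \<in> carrier (group_hopf R M)" for v w
    using that by (auto intro!: sub)
  show "(\<lambda>m. c \<otimes> v m) \<in> carrier (group_hopf R M)" if "c \<in> carrier R" "v \<in> carrier (group_hopf R M)" for c v
    using that by (auto intro!: sub)
  show "(\<Oplus>i\<in>carrier M. single R i x \<otimes> single R i y) = (if x = y then \<one> else \<zero>)"
    if "x \<in> carrier M" "y \<in> carrier M" for x y
  proof -
    have "(\<Oplus>i\<in>carrier M. single R i x \<otimes> single R i y)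
        = (\<Oplus>i\<in>carrier M. if i = x then (if x = y then \<one> else \<zero>) else \<zero>)"
      by (rule finsum_congI) (auto simp: single_def)
    then show ?thesis using that fin by (simp add: finsum_delta)
  qed
  show "(\<Oplus>m\<in>carrier M. single R i m \<otimes> v m) \<in> carrier R" if "v \<in> carrier (group_hopf R M)" for i v
    using that free_module_value[of v "carrier M"] by (intro finsum_closedI) (auto simp: single_def)
qed (auto simp: single_def)

text \<open>The comultiplication of the group algebra sends a to the sum of a(m) m \<otimes> m,
  whose coefficient matrix is diagonal.\<close>

lemma (in cring) tensor_coeff_diagonal:
  fixes a :: "'c \<Rightarrow> 'a"
  assumes fin: "finite (carrier M)" and a: "a \<in> carrier (free_module R (carrier M))"
    and x: "x \<in> carrier M" and y: "y \<in> carrier M"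
  shows "tensor_coeff R (free_map R (\<lambda>m. (single R m, single R m)) a) x y = (if x = y then a x else \<zero>)"
proof -
  define \<phi> where "\<phi> = (\<lambda>m :: 'c. (single R m, single R m))"
  define e where "e z = fst z x \<otimes> snd z y" for z :: "('c \<Rightarrow> 'a) \<times> ('c \<Rightarrow> 'a)"
  note aL = free_module_value[OF a]
  have supp: "{m. a m \<noteq> \<zero>} \<subseteq> carrier M" using a by auto
  have e: "e (\<phi> s) = (if s = x \<and> s = y then \<one> else \<zero>)" for s
    by (auto simp: e_def \<phi>_def single_def)
  have w: "free_map R \<phi> a = (\<lambda>z. \<Oplus>s\<in>carrier M. if \<phi> s = z then a s else \<zero>)"
    by (rule ext, rule free_map_eq_finsum[OF fin supp]) (rule aL)
  have "(\<Oplus>z\<in>{z. free_map R \<phi> a z \<noteq> \<zero>}. free_map R \<phi> a z \<otimes> e z) = (\<Oplus>s\<in>carrier M. a s \<otimes> e (\<phi> s))"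
    unfolding w by (rule finsum_pushforward[OF fin]) (simp_all add: aL e)
  also have "\<dots> = (\<Oplus>s\<in>carrier M. if s = x then (if x = y then a x else \<zero>) else \<zero>)"
    by (rule finsum_congI) (auto simp: e aL)
  also have "\<dots> = (if x = y then a x else \<zero>)"
    using x fin aL by (simp add: finsum_delta)
  finally show ?thesis unfolding tensor_coeff_def e_def \<phi>_def .
qed

lemma (in cring) group_hopf_mult_eq_convolution:
  assumes fin: "finite (carrier M)"
    and a: "a \<in> carrier (free_module R (carrier M))" and b: "b \<in> carrier (free_module R (carrier M))"
  shows "a \<otimes>\<^bsub>group_hopf R M\<^esub> b = convolution R (carrier M) (monoid.mult M) a b"
proof
  fix z
  note aL = free_module_value[OF a] and bL = free_module_value[OF b]
  have out: "a x = \<zero>" "b x = \<zero>" if "x \<notin> carrier M" for x using a b that by auto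
  have "(a \<otimes>\<^bsub>group_hopf R M\<^esub> b) z
      = (\<Oplus>xy\<in>carrier M \<times> carrier M. if (\<lambda>(x, y). x \<otimes>\<^bsub>M\<^esub> y) xy = z then (\<lambda>(x, y). a x \<otimes> b y) xy else \<zero>)"
    unfolding group_hopf_sel
  proof (rule free_map_eq_finsum)
    show "{xy. (\<lambda>(x, y). a x \<otimes> b y) xy \<noteq> \<zero>} \<subseteq> carrier M \<times> carrier M"
    proof
      fix xy assume "xy \<in> {xy. (\<lambda>(x, y). a x \<otimes> b y) xy \<noteq> \<zero>}"
      then show "xy \<in> carrier M \<times> carrier M"
        using out aL bL by (cases xy) (force dest: l_null r_null)
    qed
  qed (use fin aL bL in auto)
  also have "\<dots> = (\<Oplus>x\<in>carrier M. \<Oplus>y\<in>carrier M. if x \<otimes>\<^bsub>M\<^esub> y = z then a x \<otimes> b y else \<zero>)"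
    using fin aL bL by (subst finsum_Times) auto
  also have "\<dots> = convolution R (carrier M) (monoid.mult M) a b z"
    unfolding convolution_def
  proof (rule finsum_congI)
    fix x
    have "(\<Oplus>y\<in>carrier M. if x \<otimes>\<^bsub>M\<^esub> y = z then a x \<otimes> b y else \<zero>)
        = (\<Oplus>y\<in>carrier M. a x \<otimes> (b y \<otimes> (if z = x \<otimes>\<^bsub>M\<^esub> y then \<one> else \<zero>)))"
      using aL bL by (intro finsum_congI) auto
    also have "\<dots> = a x \<otimes> (\<Oplus>y\<in>carrier M. b y \<otimes> (if z = x \<otimes>\<^bsub>M\<^esub> y then \<one> else \<zero>))"
      using fin aL bL by (intro finsum_distrib_left[symmetric]) auto
    finally show "(\<Oplus>y\<in>carrier M. if x \<otimes>\<^bsub>M\<^esub> y = z then a x \<otimes> b y else \<zero>)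
        = a x \<otimes> (\<Oplus>y\<in>carrier M. b y \<otimes> (if z = x \<otimes>\<^bsub>M\<^esub> y then \<one> else \<zero>))" .
  qed (use aL bL in \<open>auto intro!: finsum_closedI m_closed\<close>)
  finally show "(a \<otimes>\<^bsub>group_hopf R M\<^esub> b) z = convolution R (carrier M) (monoid.mult M) a b z" .
qed

section \<open>The descended Hopf algebra in terms of invariants\<close>

locale hopf_descent = descent_set L G K "carrier M" "conj_left_regular G"
  for L :: "('a, 'l) ring_scheme" (structure) and G K
    and M :: "(('a \<Rightarrow> 'a) \<Rightarrow> ('a \<Rightarrow> 'a), 's) monoid_scheme" +
  assumes G_eq: "G = galois_group L K"
    and M_mult_closed: "\<lbrakk>x \<in> carrier M; y \<in> carrier M\<rbrakk> \<Longrightarrow> x \<otimes>\<^bsub>M\<^esub> y \<in> carrier M"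
    and conj_mult: "\<lbrakk>g \<in> carrier G; x \<in> carrier M; y \<in> carrier M\<rbrakk> \<Longrightarrow>
      conj_left_regular G g (x \<otimes>\<^bsub>M\<^esub> y) = conj_left_regular G g x \<otimes>\<^bsub>M\<^esub> conj_left_regular G g y"
begin

abbreviation "H \<equiv> descent_hopf L K M"
abbreviation "A \<equiv> group_hopf L M"
abbreviation "RK \<equiv> L\<lparr>carrier := K\<rparr>"

lemma invariants_A: "a \<in> invariants \<Longrightarrow> a \<in> carrier A"
  using finite_subset[OF _ fin_M, of "{x. a x \<noteq> \<zero>}"] by (auto simp: invariants_def)

lemma descent_action_apply:
  assumes a: "a \<in> carrier A" and g: "g \<in> carrier G"
  shows "descent_action L G g a y = (if y \<in> carrier M then g (a (conj_left_regular G (inv\<^bsub>G\<^esub> g) y)) else \<zero>)"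
proof -
  have aL: "a m \<in> carrier L" for m using a free_module_value[of a "carrier M" m] by simp
  have "descent_action L G g a y = (\<Oplus>x\<in>carrier M. if conj_left_regular G g x = y then g (a x) else \<zero>)"
    unfolding descent_action_def using a g aL by (intro free_map_eq_finsum[OF fin_M]) auto
  also have "\<dots> = (if y \<in> carrier M then g (a (conj_left_regular G (inv\<^bsub>G\<^esub> g) y)) else \<zero>)"
  proof (cases "y \<in> carrier M")
    case True
    let ?x = "conj_left_regular G (inv\<^bsub>G\<^esub> g) y"
    have "(\<Oplus>x\<in>carrier M. if conj_left_regular G g x = y then g (a x) else \<zero>)
        = (\<Oplus>x\<in>carrier M. if x = ?x then g (a x) else \<zero>)"
      using act_eq_iff[OF g _ True] g aL by (intro finsum_congI) auto
    also have "\<dots> = g (a ?x)"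
      using act_closed[OF _ True, of "inv\<^bsub>G\<^esub> g"] g aL fin_M by (subst finsum_delta) auto
    finally show ?thesis using True by simp
  next
    case False
    then show ?thesis using act_closed[OF g] by (auto intro!: finsum_eq_zeroI)
  qed
  finally show ?thesis .
qed

lemma carrier_H: "carrier H = invariants"
proof -
  have "carrier H = {a \<in> carrier A. \<forall>g\<in>carrier G. descent_action L G g a = a}"
    by (simp add: descent_hopf_def Let_def G_eq)
  also have "\<dots> = invariants"
  proof (intro subset_antisym subsetI)
    fix a assume a: "a \<in> {a \<in> carrier A. \<forall>g\<in>carrier G. descent_action L G g a = a}"
    then have aA: "a \<in> carrier A" by simp
    have "a (conj_left_regular G g m) = g (a m)" if g: "g \<in> carrier G" and m: "m \<in> carrier M" for g m
    proof -
      have "descent_action L G g a (conj_left_regular G g m) = a (conj_left_regular G g m)" using a g by auto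
      then show ?thesis
        unfolding descent_action_apply[OF aA g] using act_closed[OF g m] g m by simp
    qed
    then show "a \<in> invariants"
      using aA free_module_value[of a "carrier M"] by (auto simp: invariants_def)
  next
    fix a assume a: "a \<in> invariants"
    note aA = invariants_A[OF a]
    have "descent_action L G g a = a" if g: "g \<in> carrier G" for g
    proof
      fix y
      show "descent_action L G g a y = a y"
        unfolding descent_action_apply[OF aA g]
        using invariants_act[OF a g, of "conj_left_regular G (inv\<^bsub>G\<^esub> g) y"] act_closed[of "inv\<^bsub>G\<^esub> g" y] g
          invariants_outside[OF a, of y] by auto
    qed
    then show "a \<in> {a \<in> carrier A. \<forall>g\<in>carrier G. descent_action L G g a = a}" using aA by blast
  qed
  finally show ?thesis .
qed

lemma H_sel:
  "u \<oplus>\<^bsub>H\<^esub> v = (\<lambda>x. u x \<oplus> v x)" "c \<odot>\<^bsub>H\<^esub> u = (\<lambda>x. c \<otimes> u x)"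
  "a \<otimes>\<^bsub>H\<^esub> b = a \<otimes>\<^bsub>A\<^esub> b" "counit H a = counit A a"
  by (simp_all add: descent_hopf_def Let_def)

text \<open>The definition forms its tensor product over the record before \<open>comult\<close> is
  replaced; both records have the same tensor product.\<close>

lemma comult_H:
  "comult H a = (THE t. t \<in> tensor_carrier RK H H \<and> tensor_map L A A (\<lambda>a. a) (\<lambda>a. a) t = comult A a)"
proof -
  let ?H0 = "A\<lparr>carrier := {a \<in> carrier A. \<forall>g\<in>carrier (galois_group L K). descent_action L (galois_group L K) g a = a}\<rparr>"
  have "tensor_carrier RK ?H0 ?H0 = tensor_carrier RK H H"
    by (rule tensor_class_cong) (simp_all add: descent_hopf_def Let_def)
  then show ?thesis by (simp add: descent_hopf_def Let_def)
qed

lemma counit_H: "a \<in> invariants \<Longrightarrow> counit H a = (\<Oplus>m\<in>carrier M. a m)"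
  unfolding H_sel group_hopf_sel
  using invariants_value invariants_outside fin_M by (intro finsum_mono_neutral) auto

lemma mult_H:
  assumes "a \<in> invariants" "b \<in> invariants"
  shows "a \<otimes>\<^bsub>H\<^esub> b = convolution L (carrier M) (monoid.mult M) a b"
  unfolding H_sel(3)
  using invariants_A[OF assms(1)] invariants_A[OF assms(2)] by (intro group_hopf_mult_eq_convolution fin_M) simp_all

text \<open>Conjugation by g is multiplicative on M, so reindexing both sums by it moves g out
  through the equivariant coefficients.\<close>

lemma convolution_invariant:
  assumes a: "a \<in> invariants" and b: "b \<in> invariants"
  shows "convolution L (carrier M) (monoid.mult M) a b \<in> invariants"
proof -
  note aL = invariants_value[OF a] and bL = invariants_value[OF b]
  let ?i = "\<lambda>P. if P then \<one> else \<zero>"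
  let ?c = "convolution L (carrier M) (monoid.mult M) a b"
  let ?in = "\<lambda>z x. \<Oplus>y\<in>carrier M. b y \<otimes> ?i (z = x \<otimes>\<^bsub>M\<^esub> y)"
  have inL: "?in z x \<in> carrier L" for z x using bL by (intro finsum_closedI) auto
  have c: "?c z = (\<Oplus>x\<in>carrier M. a x \<otimes> ?in z x)" for z by (simp add: convolution_def)
  have "?c z \<in> carrier L" for z unfolding c using aL inL by (intro finsum_closedI) auto
  moreover have "?c z = \<zero>" if "z \<notin> carrier M" for z
  proof -
    have "?in z x = \<zero>" if "x \<in> carrier M" for x
      using M_mult_closed[OF that] \<open>z \<notin> carrier M\<close> bL by (intro finsum_eq_zeroI) auto
    then show ?thesis unfolding c using aL by (intro finsum_eq_zeroI) auto
  qed
  moreover have "?c (conj_left_regular G g z) = g (?c z)" if g: "g \<in> carrier G" and z: "z \<in> carrier M" for g z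
  proof -
    let ?g = "conj_left_regular G g"
    have in_g: "?in (?g z) (?g x) = g (?in z x)" if x: "x \<in> carrier M" for x
    proof -
      have "?in (?g z) (?g x) = (\<Oplus>y\<in>carrier M. b (?g y) \<otimes> ?i (?g z = ?g x \<otimes>\<^bsub>M\<^esub> ?g y))"
        using bL by (intro finsum_reindex_bij[OF bij_act[OF g]]) auto
      also have "\<dots> = (\<Oplus>y\<in>carrier M. g (b y \<otimes> ?i (z = x \<otimes>\<^bsub>M\<^esub> y)))"
      proof (rule finsum_congI)
        fix y assume y: "y \<in> carrier M"
        have "?g z = ?g (x \<otimes>\<^bsub>M\<^esub> y) \<longleftrightarrow> z = x \<otimes>\<^bsub>M\<^esub> y"
          using bij_act[OF g] z M_mult_closed[OF x y] by (auto simp: bij_betw_def inj_on_def)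
        then show "b (?g y) \<otimes> ?i (?g z = ?g x \<otimes>\<^bsub>M\<^esub> ?g y) = g (b y \<otimes> ?i (z = x \<otimes>\<^bsub>M\<^esub> y))"
          using g bL invariants_act[OF b g y] conj_mult[OF g x y] by simp
      qed (use g bL in auto)
      also have "\<dots> = g (?in z x)"
        using g bL fin_M by (intro aut_finsum[symmetric]) auto
      finally show ?thesis .
    qed
    have "?c (?g z) = (\<Oplus>x\<in>carrier M. a (?g x) \<otimes> ?in (?g z) (?g x))"
      unfolding c using aL inL by (intro finsum_reindex_bij[OF bij_act[OF g]]) auto
    also have "\<dots> = (\<Oplus>x\<in>carrier M. g (a x \<otimes> ?in z x))"
      using g aL inL in_g invariants_act[OF a g] by (intro finsum_congI) auto
    also have "\<dots> = g (?c z)"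
      unfolding c using g aL inL fin_M by (intro aut_finsum[symmetric]) auto
    finally show ?thesis .
  qed
  ultimately show ?thesis by (simp add: invariants_def)
qed

text \<open>The coordinates of the comultiplication lie in K because W_i, W_j and a are invariants,
  and so are their products. The frame is returned too, so that \<open>framed_module\<close> can be
  interpreted where the representative is used.\<close>

lemma comult_H_repr:
  assumes a: "a \<in> invariants"
  obtains u I W h where "framed_module L K (carrier M) H (I :: ((('a \<Rightarrow> 'a) \<Rightarrow> 'a \<Rightarrow> 'a) \<times> nat) set) W h"
    "u \<in> carrier (free_module RK (carrier H \<times> carrier H))"
    "\<forall>x\<in>carrier M. \<forall>y\<in>carrier M. tensor_coeff L u x y = (if x = y then a x else \<zero>)"
    "comult H a = tensor_class RK H H u"
proof -
  obtain I :: "((('a \<Rightarrow> 'a) \<Rightarrow> 'a \<Rightarrow> 'a) \<times> nat) set" and W h where I: "finite I"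
    "\<And>i. i \<in> I \<Longrightarrow> W i \<in> invariants" "\<And>i. i \<in> I \<Longrightarrow> h i \<in> invariants"
    "\<And>x y. \<lbrakk>x \<in> carrier M; y \<in> carrier M\<rbrakk> \<Longrightarrow> (\<Oplus>i\<in>I. W i x \<otimes> h i y) = (if x = y then \<one> else \<zero>)"
    by (rule exists_invariant_frame) blast
  have fr: "framed_module L K (carrier M) H I W h"
    by (rule invariants_framed_module[OF carrier_H H_sel(1,2) I])
  interpret FH: framed_module L K "carrier M" H I W h by (rule fr)
  obtain u where u: "u \<in> carrier FH.F"
    "\<And>x y. \<lbrakk>x \<in> carrier M; y \<in> carrier M\<rbrakk> \<Longrightarrow> tensor_coeff L u x y = (if x = y then a x else \<zero>)"
  proof (rule FH.exists_comult_repr[of a])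
    show "(\<Oplus>m\<in>carrier M. W i m \<otimes> (W j m \<otimes> a m)) \<in> K" if "i \<in> I" "j \<in> I" for i j
      by (rule sum_invariant_in_K[OF invariants_times[OF I(2)[OF that(1)] invariants_times[OF I(2)[OF that(2)] a]]])
  qed (use invariants_value[OF a] in auto)
  let ?u0 = "free_map L (\<lambda>m. (single L m, single L m)) a"
  have aF: "a \<in> carrier (free_module L (carrier M))" using invariants_A[OF a] by simp
  have u0: "?u0 \<in> carrier (free_module L (carrier A \<times> carrier A))"
    by (rule free_map_closed(1)[OF aF]) (simp add: single_def)
  have eq: "\<forall>x\<in>carrier M. \<forall>y\<in>carrier M. tensor_coeff L u x y = tensor_coeff L ?u0 x y"
    using u(2) tensor_coeff_diagonal[OF fin_M aF] by simp
  have "comult H a = tensor_class RK H H u"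
    unfolding comult_H group_hopf_sel tensor_class_group_hopf
    by (rule FH.the_comult[OF group_hopf_framed[OF fin_M] _ u(1) u0 eq]) (use invariants_A carrier_H in blast)
  then show ?thesis using that[OF fr u(1)] u(2) by blast
qed

text \<open>The comultiplication is the nontrivial condition: \<open>tensor_map\<close> is a union
  over representatives, and it gives back the set it is applied to because that set is a genuine
  tensor class.\<close>

lemma hopf_isomorphic_refl: "hopf_isomorphic RK H H"
proof -
  have "(\<lambda>a. a) \<in> hopf_iso RK H H"
    unfolding hopf_iso_def ring_iso_def
  proof (intro CollectI conjI ballI)
    show "(\<lambda>a. a) \<in> ring_hom H H" by (rule ring_hom_memI) auto
    show "bij_betw (\<lambda>a. a) (carrier H) (carrier H)" by (simp add: bij_betw_def)
    fix a assume "a \<in> carrier H"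
    then have a: "a \<in> invariants" using carrier_H by simp
    show "comult H a = tensor_map RK H H (\<lambda>a. a) (\<lambda>a. a) (comult H a)"
    proof (rule comult_H_repr[OF a])
      fix u I W h
      assume fr: "framed_module L K (carrier M) H (I :: ((('a \<Rightarrow> 'a) \<Rightarrow> 'a \<Rightarrow> 'a) \<times> nat) set) W h"
        and u: "u \<in> carrier (free_module RK (carrier H \<times> carrier H))" and c: "comult H a = tensor_class RK H H u"
      show ?thesis unfolding c by (rule framed_module.tensor_map_id[OF fr u, symmetric])
    qed
  qed auto
  then show ?thesis unfolding hopf_isomorphic_def by blast
qed

end

lemma hopf_iso_imp_equivariant_hom:
  fixes M M' :: "(('a \<Rightarrow> 'a) \<Rightarrow> ('a \<Rightarrow> 'a), 's) monoid_scheme"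
  assumes M: "hopf_descent L G K M" and M': "hopf_descent L G K M'"
    and iso: "hopf_isomorphic (L\<lparr>carrier := K\<rparr>) (descent_hopf L K M) (descent_hopf L K M')"
  obtains \<phi> where "\<phi> ` carrier M = carrier M'"
    "\<And>x y. \<lbrakk>x \<in> carrier M; y \<in> carrier M\<rbrakk> \<Longrightarrow> \<phi> (x \<otimes>\<^bsub>M\<^esub> y) = \<phi> x \<otimes>\<^bsub>M'\<^esub> \<phi> y"
    "\<And>g m. \<lbrakk>g \<in> carrier G; m \<in> carrier M\<rbrakk> \<Longrightarrow> \<phi> (conj_left_regular G g m) = conj_left_regular G g (\<phi> m)"
proof -
  interpret A: hopf_descent L G K M by (rule M)
  interpret B: hopf_descent L G K M' by (rule M')
  interpret P: descent_pair L G K "carrier M" "conj_left_regular G" "carrier M'" "conj_left_regular G" ..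
  let ?R = "L\<lparr>carrier := K\<rparr>"
  obtain f where f: "f \<in> hopf_iso ?R A.H B.H" using iso unfolding hopf_isomorphic_def by blast
  have hom: "f \<in> ring_hom A.H B.H" and bij: "bij_betw f (carrier A.H) (carrier B.H)"
    using f by (auto simp: hopf_iso_def ring_iso_def)
  have sm: "\<And>c h. \<lbrakk>c \<in> K; h \<in> A.invariants\<rbrakk> \<Longrightarrow> f (c \<odot>\<^bsub>A.H\<^esub> h) = c \<odot>\<^bsub>B.H\<^esub> f h"
    and cm: "\<And>h. h \<in> A.invariants \<Longrightarrow> comult B.H (f h) = tensor_map ?R B.H B.H f f (comult A.H h)"
    and cu: "\<And>h. h \<in> A.invariants \<Longrightarrow> counit B.H (f h) = counit A.H h"
    using f A.carrier_H by (auto simp: hopf_iso_def)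
  have fc: "f a \<in> B.invariants" if "a \<in> A.invariants" for a
    using ring_hom_closed[OF hom] that A.carrier_H B.carrier_H by simp
  show ?thesis
  proof (rule P.exists_equivariant_hom[of A.H "monoid.mult M" "monoid.mult M'" f])
    show "carrier A.H = A.invariants" by (rule A.carrier_H)
    show "\<exists>a\<in>A.invariants. f a = b" if "b \<in> B.invariants" for b
    proof -
      have "b \<in> f ` A.invariants" using bij that by (simp add: A.carrier_H B.carrier_H bij_betw_def)
      then show ?thesis by (elim imageE) auto
    qed
    show "f (\<lambda>m. a m \<oplus>\<^bsub>L\<^esub> b m) = (\<lambda>m. f a m \<oplus>\<^bsub>L\<^esub> f b m)" if "a \<in> A.invariants" "b \<in> A.invariants" for a b
      using ring_hom_add[OF hom, of a b] that A.carrier_H unfolding A.H_sel B.H_sel by simp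
    show "f (\<lambda>m. c \<otimes>\<^bsub>L\<^esub> a m) = (\<lambda>m. c \<otimes>\<^bsub>L\<^esub> f a m)" if "c \<in> K" "a \<in> A.invariants" for c a
      using sm[OF that] unfolding A.H_sel B.H_sel .
    show "f (convolution L (carrier M) (monoid.mult M) a b) = convolution L (carrier M') (monoid.mult M') (f a) (f b)"
      if "a \<in> A.invariants" "b \<in> A.invariants" for a b
      using ring_hom_mult[OF hom, of a b] that A.carrier_H A.mult_H[OF that] B.mult_H[OF fc fc, OF that] by simp
    show "finsum L (f a) (carrier M') = finsum L a (carrier M)" if "a \<in> A.invariants" for a
      using cu[OF that] A.counit_H[OF that] B.counit_H[OF fc[OF that]] by simp
    show "\<exists>u\<in>carrier (free_module ?R (carrier A.H \<times> carrier A.H)).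
         (\<forall>x\<in>carrier M. \<forall>y\<in>carrier M. tensor_coeff L u x y = (if x = y then a x else \<zero>\<^bsub>L\<^esub>)) \<and>
         (\<forall>x\<in>carrier M'. \<forall>y\<in>carrier M'.
           (\<Oplus>\<^bsub>L\<^esub>ab\<in>{ab. u ab \<noteq> \<zero>\<^bsub>L\<^esub>}. u ab \<otimes>\<^bsub>L\<^esub> (f (fst ab) x \<otimes>\<^bsub>L\<^esub> f (snd ab) y))
             = (if x = y then f a x else \<zero>\<^bsub>L\<^esub>))" if a: "a \<in> A.invariants" for a
    proof (rule A.comult_H_repr[OF a], rule B.comult_H_repr[OF fc[OF a]])
      fix u I W h u' I' W' h'
      assume frA: "framed_module L K (carrier M) A.H (I :: ((('a \<Rightarrow> 'a) \<Rightarrow> 'a \<Rightarrow> 'a) \<times> nat) set) W h"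
        and u: "u \<in> carrier (free_module ?R (carrier A.H \<times> carrier A.H))"
        and E: "\<forall>x\<in>carrier M. \<forall>y\<in>carrier M. tensor_coeff L u x y = (if x = y then a x else \<zero>\<^bsub>L\<^esub>)"
        and c: "comult A.H a = tensor_class ?R A.H A.H u"
        and frB: "framed_module L K (carrier M') B.H (I' :: ((('a \<Rightarrow> 'a) \<Rightarrow> 'a \<Rightarrow> 'a) \<times> nat) set) W' h'"
        and u': "u' \<in> carrier (free_module ?R (carrier B.H \<times> carrier B.H))"
        and E': "\<forall>x\<in>carrier M'. \<forall>y\<in>carrier M'. tensor_coeff L u' x y = (if x = y then f a x else \<zero>\<^bsub>L\<^esub>)"
        and c': "comult B.H (f a) = tensor_class ?R B.H B.H u'"
      interpret FA: framed_module L K "carrier M" A.H I W h by (rule frA)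
      interpret FB: framed_module L K "carrier M'" B.H I' W' h' by (rule frB)
      let ?w = "free_map ?R (map_prod f f) u"
      have w: "?w \<in> carrier FB.F"
        by (rule FA.R.free_map_closed(1)[OF u]) (use fc A.carrier_H B.carrier_H in auto)
      \<comment> \<open>One member of the union suffices. The class of \<open>?w\<close> is
        contained in the union, which by \<open>cm\<close> is the class of \<open>u'\<close>, so
        \<open>?w\<close> has the diagonal coefficients of \<open>u'\<close>.\<close>
      have "u \<in> tensor_class ?R A.H A.H u" using FA.mem_tensor_class_iff[OF u] u by blast
      then have "tensor_class ?R B.H B.H ?w \<subseteq> tensor_map ?R B.H B.H f f (tensor_class ?R A.H A.H u)"
        unfolding tensor_map_def by blast
      also have "\<dots> = tensor_class ?R B.H B.H u'" using cm[OF a] c c' by simp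
      finally have "?w \<in> tensor_class ?R B.H B.H u'"
        using FB.mem_tensor_class_iff[OF w] w by blast
      then have "\<forall>x\<in>carrier M'. \<forall>y\<in>carrier M'. tensor_coeff L ?w x y = (if x = y then f a x else \<zero>\<^bsub>L\<^esub>)"
        using FB.mem_tensor_class_iff[OF u'] E' by simp
      moreover have "f v m \<in> carrier L" if "v \<in> carrier A.H" for v m
        using B.invariants_value[OF fc] that A.carrier_H by simp
      ultimately show ?thesis
        using E u FA.tensor_coeff_free_map[OF u, of f] by (intro bexI[of _ u]) auto
    qed
  qed (use A.M_mult_closed B.M_mult_closed A.H_sel B.H_sel fc A.convolution_invariant that in auto)
qed

lemma cyclic_hopf_descent:
  assumes GD: "galois_descent L G K" and G_eq: "G = galois_group L K"
    and ce: "cyclic_embedding N p n \<eta> \<gamma> \<delta> G \<sigma> s D"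
  shows "hopf_descent L G K (alpha_group G \<sigma> N \<eta> \<delta> s)"
proof -
  interpret GD: galois_descent L G K by (rule GD)
  interpret C: cyclic_embedding N p n \<eta> \<gamma> \<delta> G \<sigma> s D by (rule ce)
  show ?thesis
  proof (intro hopf_descent.intro descent_set.intro descent_set_axioms.intro hopf_descent_axioms.intro
      GD G_eq C.finite_G C.Mg_finite C.conj_closed C.Mg_mult_closed)
    show "conj_left_regular G \<one>\<^bsub>G\<^esub> m = m" if "m \<in> carrier C.Mg" for m
      by (rule GD.G.conj_left_regular_one[OF C.Mg_Bij[OF that]])
    show "conj_left_regular G (g \<otimes>\<^bsub>G\<^esub> h) m = conj_left_regular G g (conj_left_regular G h m)"
      if "g \<in> carrier G" "h \<in> carrier G" "m \<in> carrier C.Mg" for g h m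
      by (rule GD.G.conj_left_regular_mult[OF that(1,2) C.Mg_Bij[OF that(3)]])
    show "conj_left_regular G g (x \<otimes>\<^bsub>C.Mg\<^esub> y) = conj_left_regular G g x \<otimes>\<^bsub>C.Mg\<^esub> conj_left_regular G g y"
      if "g \<in> carrier G" "x \<in> carrier C.Mg" "y \<in> carrier C.Mg" for g x y
      unfolding C.Mg_sel by (rule GD.G.conj_left_regular_hom[OF that(1) C.Mg_Bij[OF that(2)] C.Mg_Bij[OF that(3)]])
  qed
qed

section \<open>Comparison of the actions of \<sigma> for r and s\<close>

theorem theorem4p1:
  fixes p n r s :: nat
    and L :: "('a, 'l) ring_scheme" and K :: "'a set" and \<sigma> :: "'a \<Rightarrow> 'a"
    and N :: "('n, 'm) monoid_scheme" and \<eta> :: 'n and \<gamma> \<delta> :: "'n \<Rightarrow> 'n"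
  assumes "Factorial_Ring.prime p" and "odd p" and "n \<ge> 1"
    and "galois_extension L K"
    and "ring.dimension L (p ^ n) K (carrier L)"
    and "\<sigma> \<in> carrier (galois_group L K)"
    and "carrier (galois_group L K) = generate (galois_group L K) {\<sigma>}"
    and "group N" and "order N = p ^ n"
    and "\<eta> \<in> carrier N" and "carrier N = generate N {\<eta>}"
    and "\<gamma> \<in> carrier (AutoGroup N)"
    and "carrier (AutoGroup N) = generate (AutoGroup N) {\<gamma>}"
    and "\<delta> = \<gamma> [^]\<^bsub>AutoGroup N\<^esub> (p - 1)"
    and "r < p ^ (n - 1)" and "s < p ^ (n - 1)"
  shows "hopf_isomorphic (L\<lparr>carrier := K\<rparr>)
           (hopf_galois_structure L K \<sigma> N \<eta> \<delta> r) (hopf_galois_structure L K \<sigma> N \<eta> \<delta> s)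
         \<longleftrightarrow> r = s"
proof -
  let ?G = "galois_group L K"
  let ?M = "\<lambda>t. alpha_group ?G \<sigma> N \<eta> \<delta> t"
  have GD: "galois_descent L ?G K" by (rule galois_descent_galois_group[OF assms(4)])
  interpret GD: galois_descent L ?G K by (rule GD)
  have order_G: "order ?G = p ^ n"
    unfolding order_def by (rule GD.card_automorphisms[OF assms(5)])
  interpret C: cyclic_p_group N p n \<eta> \<gamma> \<delta>
    by (intro cyclic_p_group.intro cyclic_p_group_axioms.intro assms)
  obtain d where d: "[d = 1] (mod p)"
    and \<delta>_pow: "\<And>(t::nat) x. x \<in> carrier N \<Longrightarrow> (\<delta> [^]\<^bsub>AutoGroup N\<^esub> t) x = x [^]\<^bsub>N\<^esub> (d ^ t)"
    by (rule C.exists_\<delta>_exponent) blast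
  \<comment> \<open>All t share one d, so that the exponents compared at the end are powers of the
    same number.\<close>
  have CE: "cyclic_embedding N p n \<eta> \<gamma> \<delta> ?G \<sigma> t (d ^ t)" for t
    using cong_pow[OF d, of t] \<delta>_pow
    by (intro cyclic_embedding.intro cyclic_embedding_axioms.intro C.cyclic_p_group_axioms
        GD.G.group_axioms order_G assms) simp_all
  have HD: "hopf_descent L ?G K (?M t)" for t
    by (rule cyclic_hopf_descent[OF GD refl CE])
  show ?thesis
    unfolding hopf_galois_structure_def
  proof
    assume "r = s"
    then show "hopf_isomorphic (L\<lparr>carrier := K\<rparr>) (descent_hopf L K (?M r)) (descent_hopf L K (?M s))"
      using hopf_descent.hopf_isomorphic_refl[OF HD] by simp
  next
    assume iso: "hopf_isomorphic (L\<lparr>carrier := K\<rparr>) (descent_hopf L K (?M r)) (descent_hopf L K (?M s))"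
    obtain \<phi> where img: "\<phi> ` carrier (?M r) = carrier (?M s)"
      and hom: "\<And>x y. \<lbrakk>x \<in> carrier (?M r); y \<in> carrier (?M r)\<rbrakk> \<Longrightarrow> \<phi> (x \<otimes>\<^bsub>?M r\<^esub> y) = \<phi> x \<otimes>\<^bsub>?M s\<^esub> \<phi> y"
      and equiv: "\<And>g m. \<lbrakk>g \<in> carrier ?G; m \<in> carrier (?M r)\<rbrakk>
        \<Longrightarrow> \<phi> (conj_left_regular ?G g m) = conj_left_regular ?G g (\<phi> m)"
      by (rule hopf_iso_imp_equivariant_hom[OF HD HD iso]) blast
    interpret Cr: cyclic_embedding N p n \<eta> \<gamma> \<delta> ?G \<sigma> r "d ^ r" by (rule CE)
    interpret Cs: cyclic_embedding N p n \<eta> \<gamma> \<delta> ?G \<sigma> s "d ^ s" by (rule CE)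
    have \<alpha>r: "Cr.\<alpha> \<nu> \<in> carrier (?M r)" if "\<nu> \<in> carrier N" for \<nu>
      using that by (simp add: Cr.Mg_sel)
    \<comment> \<open>\<phi> acts on permutations; through the two embeddings it is followed along
      the powers of one element of N.\<close>
    have \<phi>_pow: "\<phi> (Cr.\<alpha> (\<nu> [^]\<^bsub>N\<^esub> k)) = Cs.\<alpha> (\<mu> [^]\<^bsub>N\<^esub> k)"
      if \<nu>: "\<nu> \<in> carrier N" and \<mu>: "\<mu> \<in> carrier N" and eq: "\<phi> (Cr.\<alpha> \<nu>) = Cs.\<alpha> \<mu>" for \<nu> \<mu> and k :: nat
    proof (induction k)
      case 0
      have "\<phi> (Cr.\<alpha> \<one>\<^bsub>N\<^esub>) \<in> carrier (?M s)" using img \<alpha>r[OF C.one_closed] by blast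
      then obtain w where w: "w \<in> carrier N" "\<phi> (Cr.\<alpha> \<one>\<^bsub>N\<^esub>) = Cs.\<alpha> w" unfolding Cs.Mg_sel by blast
      \<comment> \<open>The image of the identity is idempotent, and the only idempotent of a group
        is 1.\<close>
      have "Cr.\<alpha> \<one>\<^bsub>N\<^esub> \<otimes>\<^bsub>?M r\<^esub> Cr.\<alpha> \<one>\<^bsub>N\<^esub> = Cr.\<alpha> \<one>\<^bsub>N\<^esub>"
        unfolding Cr.Mg_sel Cr.alpha_mult[OF C.one_closed C.one_closed] by simp
      then have "Cs.\<alpha> w = Cs.\<alpha> w \<otimes>\<^bsub>?M s\<^esub> Cs.\<alpha> w"
        using hom[OF \<alpha>r[OF C.one_closed] \<alpha>r[OF C.one_closed]] w(2) by simp
      also have "\<dots> = Cs.\<alpha> (w \<otimes>\<^bsub>N\<^esub> w)"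
        unfolding Cs.Mg_sel by (rule Cs.alpha_mult[OF w(1) w(1)])
      finally have "w = w \<otimes>\<^bsub>N\<^esub> w"
        using Cs.alpha_inj w(1) by simp
      then have "w = \<one>\<^bsub>N\<^esub>" using w(1) C.r_cancel_one by metis
      then show ?case using w(2) by simp
    next
      case (Suc k)
      have "Cr.\<alpha> (\<nu> [^]\<^bsub>N\<^esub> Suc k) = Cr.\<alpha> (\<nu> [^]\<^bsub>N\<^esub> k) \<otimes>\<^bsub>?M r\<^esub> Cr.\<alpha> \<nu>"
        unfolding Cr.Mg_sel using Cr.alpha_mult[OF C.nat_pow_closed[OF \<nu>, of k] \<nu>] by simp
      then have "\<phi> (Cr.\<alpha> (\<nu> [^]\<^bsub>N\<^esub> Suc k)) = Cs.\<alpha> (\<mu> [^]\<^bsub>N\<^esub> k) \<otimes>\<^bsub>?M s\<^esub> Cs.\<alpha> \<mu>"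
        using hom[OF \<alpha>r[OF C.nat_pow_closed[OF \<nu>, of k]] \<alpha>r[OF \<nu>]] Suc eq by simp
      also have "\<dots> = Cs.\<alpha> (\<mu> [^]\<^bsub>N\<^esub> Suc k)"
        unfolding Cs.Mg_sel using Cs.alpha_mult[OF C.nat_pow_closed[OF \<mu>, of k] \<mu>] by simp
      finally show ?case .
    qed
    \<comment> \<open>Surjectivity puts some \<nu> over the generator \<epsilon>.\<close>
    have "Cs.\<alpha> C.\<epsilon> \<in> \<phi> ` carrier (?M r)" unfolding img Cs.Mg_sel by simp
    then obtain \<nu> where \<nu>: "\<nu> \<in> carrier N" "\<phi> (Cr.\<alpha> \<nu>) = Cs.\<alpha> C.\<epsilon>" unfolding Cr.Mg_sel by auto
    \<comment> \<open>The image of the conjugate of \<nu> by \<sigma> is computed twice: conjugating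
      first raises to the power \<open>d ^ r\<close>, applying \<phi> first leads to the power
      \<open>d ^ s\<close>.\<close>
    have "Cs.\<alpha> (C.\<epsilon> [^]\<^bsub>N\<^esub> (d ^ r)) = \<phi> (conj_left_regular ?G \<sigma> (Cr.\<alpha> \<nu>))"
      unfolding Cr.conj_alpha[OF \<nu>(1)] using \<phi>_pow[OF \<nu>(1) C.\<epsilon>_closed \<nu>(2)] by simp
    also have "\<dots> = Cs.\<alpha> (C.\<epsilon> [^]\<^bsub>N\<^esub> (d ^ s))"
      using equiv[OF assms(6) \<alpha>r[OF \<nu>(1)]] \<nu>(2) Cs.conj_alpha[OF C.\<epsilon>_closed] by simp
    finally have eq: "C.\<epsilon> [^]\<^bsub>N\<^esub> (d ^ r) = C.\<epsilon> [^]\<^bsub>N\<^esub> (d ^ s)"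
      using Cs.alpha_inj by simp
    show "r = s"
    proof (rule C.\<delta>_pow_inj[OF assms(15,16)])
      fix x assume x: "x \<in> carrier N"
      \<comment> \<open>Agreement at the generator spreads to its powers, that is, to all of
        N.\<close>
      obtain k :: nat where k: "x = C.\<epsilon> [^]\<^bsub>N\<^esub> k" by (rule C.power_of_\<epsilon>[OF x])
      have "x [^]\<^bsub>N\<^esub> (d ^ t) = (C.\<epsilon> [^]\<^bsub>N\<^esub> (d ^ t)) [^]\<^bsub>N\<^esub> k" for t
        unfolding k by (simp add: C.nat_pow_pow mult.commute)
      then show "(\<delta> [^]\<^bsub>AutoGroup N\<^esub> r) x = (\<delta> [^]\<^bsub>AutoGroup N\<^esub> s) x"
        using eq \<delta>_pow[OF x] by simp
    qed
  qed
qed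

end
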